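(* Let $X$ be a scheme such that $2$ is invertible in all residue fields of points of $X$. Let $\mathcal{A}$ be a quadratic étale algebra on $X$, with trace map $\operatorname{Tr}:\mathcal{A}\to\mathcal{O}_X$, and let $\mathcal{L}=\ker(\operatorname{Tr})$ be the associated line bundle. Suppose $a_1,\dots,a_r$ are global sections of $\mathcal{A}$. Then $a_1,\dots,a_r$ generate $\mathcal{A}$ as an algebra if and only if $a_1-\frac12\operatorname{Tr}(a_1),\dots,a_r-\frac12\operatorname{Tr}(a_r)$ generate $\mathcal{L}$ as a line bundle.
   Context: A quadratic étale algebra on a scheme $X$ is a locally free sheaf $\mathcal{A}$ of commutative $\mathcal{O}_X$-algebras of constant rank $2$ such that $\mathcal{A}(U)$ is an étale (flat, separable, finitely presented) $\mathcal{O}_X(U)$-algebra for each affine open $U\subset X$. $\operatorname{Tr}$ is the usual trace of a finite locally free algebra. Global sections $a_1,\dots,a_r$ generate $\mathcal{A}$ as an algebra if for every affine open $U$ their restrictions generate $\mathcal{A}(U)$ as an $\mathcal{O}_X(U)$-algebra. Since $2$ is invertible on $X$, the sequence $0\to\mathcal{L}\to\mathcal{A}\xrightarrow{\operatorname{Tr}}\mathcal{O}_X\to0$ is split exact (splitting $x\mapsto\frac12x$), $\mathcal{L}$ is a line bundle, and $a-\frac12\operatorname{Tr}(a)$ is a section of $\mathcal{L}$ for every section $a$ of $\mathcal{A}$. Sections $l_1,\dots,l_r$ of $\mathcal{L}$ generate it as a line bundle if the induced map $\mathcal{O}_X^r\to\mathcal{L}$ is surjective. *)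

theory Defs
  imports "HOL-Analysis.Abstract_Topology" "HOL-Algebra.Algebra"
begin

section \<open>Sheaves and ringed spaces\<close>

text \<open>Gluing and uniqueness are stated together.  A covering family may be indexed by the
  covering open sets themselves, because compatibility makes sections with equal index domains
  equal.  The empty cover is allowed, so there is exactly one section over the empty set.\<close>

locale sheaf =
  fixes T :: "'x topology" and S :: "'x set \<Rightarrow> 's set" and \<rho> :: "'x set \<Rightarrow> 'x set \<Rightarrow> 's \<Rightarrow> 's"
  assumes restr_closed: "\<lbrakk>openin T U; openin T V; V \<subseteq> U; s \<in> S U\<rbrakk> \<Longrightarrow> \<rho> U V s \<in> S V"
    and restr_id: "\<lbrakk>openin T U; s \<in> S U\<rbrakk> \<Longrightarrow> \<rho> U U s = s"
    and restr_trans: "\<lbrakk>openin T U; openin T V; openin T W; W \<subseteq> V; V \<subseteq> U; s \<in> S U\<rbrakk>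
          \<Longrightarrow> \<rho> V W (\<rho> U V s) = \<rho> U W s"
    and glue: "\<lbrakk>\<And>U. U \<in> \<U> \<Longrightarrow> openin T U; \<And>U. U \<in> \<U> \<Longrightarrow> \<sigma> U \<in> S U;
           \<And>U V. \<lbrakk>U \<in> \<U>; V \<in> \<U>\<rbrakk> \<Longrightarrow> \<rho> U (U \<inter> V) (\<sigma> U) = \<rho> V (U \<inter> V) (\<sigma> V)\<rbrakk>
          \<Longrightarrow> \<exists>!s. s \<in> S (\<Union>\<U>) \<and> (\<forall>U\<in>\<U>. \<rho> (\<Union>\<U>) U s = \<sigma> U)"

text \<open>The values of \<open>secs\<close> and \<open>restr\<close> matter only at open sets.\<close>

record ('x, 'r) ringed_space =
  pts :: "'x topology"
  secs :: "'x set \<Rightarrow> 'r ring"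
  restr :: "'x set \<Rightarrow> 'x set \<Rightarrow> 'r \<Rightarrow> 'r"

locale ringed_space =
  sheaf "pts Y" "\<lambda>U. carrier (secs Y U)" "restr Y" for Y :: "('x, 'r) ringed_space" +
  assumes secs_cring: "openin (pts Y) U \<Longrightarrow> cring (secs Y U)"
    and restr_hom: "\<lbrakk>openin (pts Y) U; openin (pts Y) V; V \<subseteq> U\<rbrakk>
          \<Longrightarrow> restr Y U V \<in> ring_hom (secs Y U) (secs Y V)"

text \<open>Restricting to an open subset \<open>U\<close> only shrinks the topology: the open sets of the subtopology
  are open sets of \<open>Y\<close>, with the same sections.  For the same reason a sheaf of modules on \<open>Y\<close>
  (below) is used unchanged as its own restriction to \<open>U\<close>.\<close>

definition open_subspace :: "('x, 'r) ringed_space \<Rightarrow> 'x set \<Rightarrow> ('x, 'r) ringed_space" where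
  "open_subspace Y U = Y\<lparr>pts := subtopology (pts Y) U\<rparr>"

subsection \<open>Stalks and residue fields\<close>

definition germ :: "('x, 'r) ringed_space \<Rightarrow> 'x \<Rightarrow> 'x set \<Rightarrow> 'r \<Rightarrow> ('x set \<times> 'r) set" where
  "germ Y x U s = {(V, t). openin (pts Y) V \<and> x \<in> V \<and> t \<in> carrier (secs Y V) \<and>
     (\<exists>W. openin (pts Y) W \<and> x \<in> W \<and> W \<subseteq> U \<inter> V \<and> restr Y U W s = restr Y V W t)}"

text \<open>The unions range over all representatives; they all contribute the same germ.\<close>

definition stalk :: "('x, 'r) ringed_space \<Rightarrow> 'x \<Rightarrow> ('x set \<times> 'r) set ring" where
  "stalk Y x =
    \<lparr>carrier = {germ Y x U s | U s. openin (pts Y) U \<and> x \<in> U \<and> s \<in> carrier (secs Y U)},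
     monoid.mult = (\<lambda>g h. \<Union>(U, s)\<in>g. \<Union>(V, t)\<in>h.
        germ Y x (U \<inter> V) (restr Y U (U \<inter> V) s \<otimes>\<^bsub>secs Y (U \<inter> V)\<^esub> restr Y V (U \<inter> V) t)),
     one = germ Y x (topspace (pts Y)) \<one>\<^bsub>secs Y (topspace (pts Y))\<^esub>,
     ring.zero = germ Y x (topspace (pts Y)) \<zero>\<^bsub>secs Y (topspace (pts Y))\<^esub>,
     ring.add = (\<lambda>g h. \<Union>(U, s)\<in>g. \<Union>(V, t)\<in>h.
        germ Y x (U \<inter> V) (restr Y U (U \<inter> V) s \<oplus>\<^bsub>secs Y (U \<inter> V)\<^esub> restr Y V (U \<inter> V) t))\<rparr>"

definition local_ring :: "('a, 'b) ring_scheme \<Rightarrow> bool" where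
  "local_ring R \<longleftrightarrow> cring R \<and> (\<exists>!m. maximalideal m R)"

locale locally_ringed_space = ringed_space +
  assumes local_stalks: "x \<in> topspace (pts Y) \<Longrightarrow> local_ring (stalk Y x)"

definition residue_field :: "('x, 'r) ringed_space \<Rightarrow> 'x \<Rightarrow> ('x set \<times> 'r) set set ring" where
  "residue_field Y x = stalk Y x Quot (THE m. maximalideal m (stalk Y x))"

section \<open>Schemes\<close>

subsection \<open>The spectrum of a ring\<close>

definition basic_open :: "'r ring \<Rightarrow> 'r \<Rightarrow> 'r set set" where
  "basic_open R f = {P. primeideal P R \<and> f \<notin> P}"

definition zariski_topology :: "'r ring \<Rightarrow> 'r set topology" where
  "zariski_topology R = topology_generated_by (basic_open R ` carrier R)"

text \<open>The fraction \<open>a / s\<close> in the localization of \<open>R\<close> at the prime ideal \<open>P\<close>, as an equivalence class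
  of pairs (numerator, denominator).\<close>

definition frac_at :: "'r ring \<Rightarrow> 'r set \<Rightarrow> 'r \<Rightarrow> 'r \<Rightarrow> ('r \<times> 'r) set" where
  "frac_at R P a s = {(b, t). b \<in> carrier R \<and> t \<in> carrier R - P \<and>
     (\<exists>u\<in>carrier R - P. u \<otimes>\<^bsub>R\<^esub> (t \<otimes>\<^bsub>R\<^esub> a) = u \<otimes>\<^bsub>R\<^esub> (s \<otimes>\<^bsub>R\<^esub> b))}"

definition localization_at :: "'r ring \<Rightarrow> 'r set \<Rightarrow> ('r \<times> 'r) set ring" where
  "localization_at R P =
    \<lparr>carrier = {frac_at R P a s | a s. a \<in> carrier R \<and> s \<in> carrier R - P},
     monoid.mult = (\<lambda>p q. \<Union>(a, s)\<in>p. \<Union>(b, t)\<in>q. frac_at R P (a \<otimes>\<^bsub>R\<^esub> b) (s \<otimes>\<^bsub>R\<^esub> t)),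
     one = frac_at R P \<one>\<^bsub>R\<^esub> \<one>\<^bsub>R\<^esub>,
     ring.zero = frac_at R P \<zero>\<^bsub>R\<^esub> \<one>\<^bsub>R\<^esub>,
     ring.add = (\<lambda>p q. \<Union>(a, s)\<in>p. \<Union>(b, t)\<in>q.
        frac_at R P ((a \<otimes>\<^bsub>R\<^esub> t) \<oplus>\<^bsub>R\<^esub> (b \<otimes>\<^bsub>R\<^esub> s)) (s \<otimes>\<^bsub>R\<^esub> t))\<rparr>"

text \<open>Sections of the structure sheaf are the functions into the localizations that are locally
  given by one fraction.\<close>

definition spec_secs :: "'r ring \<Rightarrow> 'r set set \<Rightarrow> ('r set \<Rightarrow> ('r \<times> 'r) set) ring" where
  "spec_secs R U =
    \<lparr>carrier = {\<sigma> \<in> (\<Pi>\<^sub>E P\<in>U. carrier (localization_at R P)).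
       \<forall>P\<in>U. \<exists>V a s. openin (zariski_topology R) V \<and> P \<in> V \<and> V \<subseteq> U \<and>
         a \<in> carrier R \<and> s \<in> carrier R \<and> (\<forall>Q\<in>V. s \<notin> Q \<and> \<sigma> Q = frac_at R Q a s)},
     monoid.mult = (\<lambda>\<sigma> \<tau>. \<lambda>P\<in>U. \<sigma> P \<otimes>\<^bsub>localization_at R P\<^esub> \<tau> P),
     one = (\<lambda>P\<in>U. \<one>\<^bsub>localization_at R P\<^esub>),
     ring.zero = (\<lambda>P\<in>U. \<zero>\<^bsub>localization_at R P\<^esub>),
     ring.add = (\<lambda>\<sigma> \<tau>. \<lambda>P\<in>U. \<sigma> P \<oplus>\<^bsub>localization_at R P\<^esub> \<tau> P)\<rparr>"

definition Spec :: "'r ring \<Rightarrow> ('r set, 'r set \<Rightarrow> ('r \<times> 'r) set) ringed_space" where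
  "Spec R = \<lparr>pts = zariski_topology R, secs = spec_secs R, restr = (\<lambda>U V \<sigma>. restrict \<sigma> V)\<rparr>"

subsection \<open>Affine opens and schemes\<close>

text \<open>An isomorphism of ringed spaces; between locally ringed spaces it is automatically local on
  stalks, hence an isomorphism of locally ringed spaces.\<close>

definition ringed_space_iso ::
  "('x, 'r) ringed_space \<Rightarrow> ('y, 's) ringed_space \<Rightarrow> ('x \<Rightarrow> 'y) \<Rightarrow> ('y set \<Rightarrow> 's \<Rightarrow> 'r) \<Rightarrow> bool" where
  "ringed_space_iso Y Z f \<psi> \<longleftrightarrow>
     homeomorphic_map (pts Y) (pts Z) f \<and>
     (\<forall>V. openin (pts Z) V \<longrightarrow> \<psi> V \<in> ring_iso (secs Z V) (secs Y (topspace (pts Y) \<inter> f -` V))) \<and>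
     (\<forall>V W s. openin (pts Z) V \<and> openin (pts Z) W \<and> W \<subseteq> V \<and> s \<in> carrier (secs Z V) \<longrightarrow>
        \<psi> W (restr Z V W s) =
        restr Y (topspace (pts Y) \<inter> f -` V) (topspace (pts Y) \<inter> f -` W) (\<psi> V s))"

text \<open>It is no restriction that \<open>R\<close> lives on the type \<open>'r\<close>: if \<open>Y\<close> is isomorphic to the spectrum of
  some ring, then that ring is isomorphic to the ring of global sections of \<open>Y\<close>.\<close>

definition affine_scheme :: "('x, 'r) ringed_space \<Rightarrow> bool" where
  "affine_scheme Y \<longleftrightarrow> (\<exists>R :: 'r ring. cring R \<and> (\<exists>f \<psi>. ringed_space_iso Y (Spec R) f \<psi>))"

definition affine_open :: "('x, 'r) ringed_space \<Rightarrow> 'x set \<Rightarrow> bool" where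
  "affine_open Y U \<longleftrightarrow> openin (pts Y) U \<and> affine_scheme (open_subspace Y U)"

locale scheme = locally_ringed_space +
  assumes affine_cover: "x \<in> topspace (pts Y) \<Longrightarrow> \<exists>U. affine_open Y U \<and> x \<in> U"

section \<open>Algebras over a ring\<close>

definition linear_maps :: "'r ring \<Rightarrow> ('r, 'm) module \<Rightarrow> ('r, 'n) module \<Rightarrow> ('m \<Rightarrow> 'n) set" where
  "linear_maps R M N = {f \<in> hom (add_monoid M) (add_monoid N).
     \<forall>r\<in>carrier R. \<forall>x\<in>carrier M. f (r \<odot>\<^bsub>M\<^esub> x) = r \<odot>\<^bsub>N\<^esub> f x}"

subsection \<open>Tensor products\<close>

text \<open>The tensor product over \<open>R\<close>, as an abelian group: the free abelian group on the pairs modulo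
  the relations of biadditivity and \<open>R\<close>-balance.\<close>

definition tensor_relations :: "'r ring \<Rightarrow> ('r, 'm) module \<Rightarrow> ('r, 'n) module \<Rightarrow> ('m \<times> 'n \<Rightarrow>\<^sub>0 int) set"
  where "tensor_relations R M N = generate (free_Abelian_group (carrier M \<times> carrier N))
    ({frag_of (x \<oplus>\<^bsub>M\<^esub> x', y) - frag_of (x, y) - frag_of (x', y) | x x' y.
        x \<in> carrier M \<and> x' \<in> carrier M \<and> y \<in> carrier N} \<union>
     {frag_of (x, y \<oplus>\<^bsub>N\<^esub> y') - frag_of (x, y) - frag_of (x, y') | x y y'.
        x \<in> carrier M \<and> y \<in> carrier N \<and> y' \<in> carrier N} \<union>
     {frag_of (r \<odot>\<^bsub>M\<^esub> x, y) - frag_of (x, r \<odot>\<^bsub>N\<^esub> y) | r x y.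
        r \<in> carrier R \<and> x \<in> carrier M \<and> y \<in> carrier N})"

definition tensor :: "'r ring \<Rightarrow> ('r, 'm) module \<Rightarrow> ('r, 'n) module \<Rightarrow> ('m \<times> 'n \<Rightarrow>\<^sub>0 int) set monoid"
  where "tensor R M N =
    free_Abelian_group (carrier M \<times> carrier N) Mod tensor_relations R M N"

definition tensor_class ::
  "'r ring \<Rightarrow> ('r, 'm) module \<Rightarrow> ('r, 'n) module \<Rightarrow> ('m \<times> 'n \<Rightarrow>\<^sub>0 int) \<Rightarrow> ('m \<times> 'n \<Rightarrow>\<^sub>0 int) set" where
  "tensor_class R M N c =
    tensor_relations R M N #>\<^bsub>free_Abelian_group (carrier M \<times> carrier N)\<^esub> c"

text \<open>For linear maps \<open>f\<close> and \<open>g\<close> from \<open>M\<close> to \<open>M'\<close> and from \<open>N\<close> to \<open>N'\<close>, the induced map of tensor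
  products over \<open>R\<close>.  All representatives \<open>c\<close> of the class \<open>\<xi>\<close> contribute the same class.\<close>

definition tensor_map ::
  "'r ring \<Rightarrow> ('r, 'm') module \<Rightarrow> ('r, 'n') module \<Rightarrow> ('m \<Rightarrow> 'm') \<Rightarrow> ('n \<Rightarrow> 'n')
    \<Rightarrow> ('m \<times> 'n \<Rightarrow>\<^sub>0 int) set \<Rightarrow> ('m' \<times> 'n' \<Rightarrow>\<^sub>0 int) set" where
  "tensor_map R M' N' f g \<xi> =
    (\<Union>c\<in>\<xi>. tensor_class R M' N' (frag_extend (\<lambda>(x, y). frag_of (f x, g y)) c))"

subsection \<open>Etale algebras\<close>

text \<open>Tensoring with \<open>M\<close> preserves injectivity.  The type \<open>(nat \<Rightarrow> 'r) set\<close> is large enough to carry a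
  copy of every countably generated \<open>R\<close>-module (as a quotient of a free module, by cosets);
  inclusions of ideals into \<open>R\<close> already detect flatness.\<close>

definition flat :: "'r ring \<Rightarrow> ('r, 'm) module \<Rightarrow> bool" where
  "flat R M \<longleftrightarrow> (\<forall>(N :: ('r, (nat \<Rightarrow> 'r) set) module) (N' :: ('r, (nat \<Rightarrow> 'r) set) module) f.
     Module.module R N \<and> Module.module R N' \<and> f \<in> linear_maps R N N' \<and> inj_on f (carrier N) \<longrightarrow>
     inj_on (tensor_map R N' M f (\<lambda>x. x)) (carrier (tensor R N M)))"

text \<open>\<open>A\<close> is projective over its enveloping algebra, that is, the multiplication map \<open>\<mu>\<close> from the
  tensor square of \<open>A\<close> to \<open>A\<close> has a section \<open>\<sigma>\<close> that is a map of bimodules.\<close>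

definition separable :: "'r ring \<Rightarrow> ('r, 'a) module \<Rightarrow> bool" where
  "separable R A \<longleftrightarrow> (\<exists>\<mu> \<sigma>.
     \<mu> \<in> hom (tensor R A A) (add_monoid A) \<and>
     (\<forall>x\<in>carrier A. \<forall>y\<in>carrier A. \<mu> (tensor_class R A A (frag_of (x, y))) = x \<otimes>\<^bsub>A\<^esub> y) \<and>
     \<sigma> \<in> hom (add_monoid A) (tensor R A A) \<and>
     (\<forall>a\<in>carrier A. \<forall>x\<in>carrier A.
        \<sigma> (a \<otimes>\<^bsub>A\<^esub> x) = tensor_map R A A (\<lambda>z. a \<otimes>\<^bsub>A\<^esub> z) (\<lambda>z. z) (\<sigma> x) \<and>
        \<sigma> (x \<otimes>\<^bsub>A\<^esub> a) = tensor_map R A A (\<lambda>z. z) (\<lambda>z. z \<otimes>\<^bsub>A\<^esub> a) (\<sigma> x)) \<and>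
     (\<forall>x\<in>carrier A. \<mu> (\<sigma> x) = x))"

text \<open>The polynomial ring over \<open>R\<close> in the variables \<open>0, \<dots>, n - 1\<close>; monomials are multisets of
  variables.\<close>

definition mpoly_ring :: "'r ring \<Rightarrow> nat \<Rightarrow> (nat multiset \<Rightarrow> 'r) ring" where
  "mpoly_ring R n =
    \<lparr>carrier = ring.indexed_pset R {..<n} (carrier R),
     monoid.mult = (\<lambda>p q m. \<Oplus>\<^bsub>R\<^esub>d\<in>{d. d \<subseteq># m}. p d \<otimes>\<^bsub>R\<^esub> q (m - d)),
     one = ring.indexed_const R \<one>\<^bsub>R\<^esub>,
     ring.zero = ring.indexed_const R \<zero>\<^bsub>R\<^esub>,
     ring.add = ring.indexed_padd R\<rparr>"

definition finitely_presented_algebra :: "'r ring \<Rightarrow> ('r, 'a) module \<Rightarrow> bool" where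
  "finitely_presented_algebra R A \<longleftrightarrow> (\<exists>n \<phi> F.
     \<phi> \<in> ring_hom (mpoly_ring R n) A \<and>
     (\<forall>k\<in>carrier R. \<phi> (ring.indexed_const R k) = k \<odot>\<^bsub>A\<^esub> \<one>\<^bsub>A\<^esub>) \<and>
     \<phi> ` carrier (mpoly_ring R n) = carrier A \<and>
     finite F \<and> F \<subseteq> carrier (mpoly_ring R n) \<and>
     a_kernel (mpoly_ring R n) A \<phi> = Idl\<^bsub>mpoly_ring R n\<^esub> F)"

definition etale_algebra :: "'r ring \<Rightarrow> ('r, 'a) module \<Rightarrow> bool" where
  "etale_algebra R A \<longleftrightarrow>
     algebra R A \<and> flat R A \<and> separable R A \<and> finitely_presented_algebra R A"

text \<open>The \<open>R\<close>-subalgebra generated by \<open>S\<close> is the subring generated by \<open>S\<close> and the image of \<open>R\<close>.\<close>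

definition generated_subalgebra :: "'r ring \<Rightarrow> ('r, 'a) module \<Rightarrow> 'a set \<Rightarrow> 'a set" where
  "generated_subalgebra R A S = generate_ring A ((\<lambda>k. k \<odot>\<^bsub>A\<^esub> \<one>\<^bsub>A\<^esub>) ` carrier R \<union> S)"

section \<open>Sheaves of modules and of algebras\<close>

record ('x, 'r, 'a) module_sheaf =
  msecs :: "'x set \<Rightarrow> ('r, 'a) module"
  mrestr :: "'x set \<Rightarrow> 'x set \<Rightarrow> 'a \<Rightarrow> 'a"

locale algebra_sheaf =
  ringed_space Y + A: sheaf "pts Y" "\<lambda>U. carrier (msecs A U)" "mrestr A"
  for Y :: "('x, 'r) ringed_space" and A :: "('x, 'r, 'a) module_sheaf" +
  assumes msecs_algebra: "openin (pts Y) U \<Longrightarrow> algebra (secs Y U) (msecs A U)"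
    and mrestr_hom: "\<lbrakk>openin (pts Y) U; openin (pts Y) V; V \<subseteq> U\<rbrakk>
          \<Longrightarrow> mrestr A U V \<in> ring_hom (msecs A U) (msecs A V)"
    and mrestr_smult: "\<lbrakk>openin (pts Y) U; openin (pts Y) V; V \<subseteq> U;
           k \<in> carrier (secs Y U); x \<in> carrier (msecs A U)\<rbrakk>
          \<Longrightarrow> mrestr A U V (k \<odot>\<^bsub>msecs A U\<^esub> x) = restr Y U V k \<odot>\<^bsub>msecs A V\<^esub> mrestr A U V x"

definition module_sheaf_hom :: "('x, 'r) ringed_space \<Rightarrow> ('x, 'r, 'a) module_sheaf
    \<Rightarrow> ('x, 'r, 'b) module_sheaf \<Rightarrow> ('x set \<Rightarrow> 'a \<Rightarrow> 'b) \<Rightarrow> bool" where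
  "module_sheaf_hom Y M N \<phi> \<longleftrightarrow>
     (\<forall>U. openin (pts Y) U \<longrightarrow> \<phi> U \<in> linear_maps (secs Y U) (msecs M U) (msecs N U)) \<and>
     (\<forall>U V x. openin (pts Y) U \<and> openin (pts Y) V \<and> V \<subseteq> U \<and> x \<in> carrier (msecs M U) \<longrightarrow>
        \<phi> V (mrestr M U V x) = mrestr N U V (\<phi> U x))"

definition module_sheaf_iso :: "('x, 'r) ringed_space \<Rightarrow> ('x, 'r, 'a) module_sheaf
    \<Rightarrow> ('x, 'r, 'b) module_sheaf \<Rightarrow> ('x set \<Rightarrow> 'a \<Rightarrow> 'b) \<Rightarrow> bool" where
  "module_sheaf_iso Y M N \<phi> \<longleftrightarrow> module_sheaf_hom Y M N \<phi> \<and>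
     (\<forall>U. openin (pts Y) U \<longrightarrow> bij_betw (\<phi> U) (carrier (msecs M U)) (carrier (msecs N U)))"

text \<open>Surjectivity of a map of sheaves: every section locally lifts.\<close>

definition sheaf_surjective :: "('x, 'r) ringed_space \<Rightarrow> ('x, 'r, 'a) module_sheaf
    \<Rightarrow> ('x, 'r, 'b) module_sheaf \<Rightarrow> ('x set \<Rightarrow> 'a \<Rightarrow> 'b) \<Rightarrow> bool" where
  "sheaf_surjective Y M N \<phi> \<longleftrightarrow>
     (\<forall>U y x. openin (pts Y) U \<and> y \<in> carrier (msecs N U) \<and> x \<in> U \<longrightarrow>
        (\<exists>V. openin (pts Y) V \<and> x \<in> V \<and> V \<subseteq> U \<and> mrestr N U V y \<in> \<phi> V ` carrier (msecs M V)))"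

text \<open>The free module sheaf of rank \<open>n\<close>.  The record type also asks for a multiplication and a unit;
  they are taken componentwise.\<close>

definition free_sheaf :: "('x, 'r) ringed_space \<Rightarrow> nat \<Rightarrow> ('x, 'r, nat \<Rightarrow> 'r) module_sheaf" where
  "free_sheaf Y n =
    \<lparr>msecs = (\<lambda>U.
      \<lparr>carrier = {..<n} \<rightarrow>\<^sub>E carrier (secs Y U),
       monoid.mult = (\<lambda>c d. \<lambda>i\<in>{..<n}. c i \<otimes>\<^bsub>secs Y U\<^esub> d i),
       one = (\<lambda>i\<in>{..<n}. \<one>\<^bsub>secs Y U\<^esub>),
       ring.zero = (\<lambda>i\<in>{..<n}. \<zero>\<^bsub>secs Y U\<^esub>),
       ring.add = (\<lambda>c d. \<lambda>i\<in>{..<n}. c i \<oplus>\<^bsub>secs Y U\<^esub> d i),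
       smult = (\<lambda>k c. \<lambda>i\<in>{..<n}. k \<otimes>\<^bsub>secs Y U\<^esub> c i)\<rparr>),
     mrestr = (\<lambda>U V c. \<lambda>i\<in>{..<n}. restr Y U V (c i))\<rparr>"

definition trivialization ::
  "('x, 'r) ringed_space \<Rightarrow> ('x, 'r, 'a) module_sheaf \<Rightarrow> nat \<Rightarrow> 'x set \<Rightarrow> ('x set \<Rightarrow> (nat \<Rightarrow> 'r) \<Rightarrow> 'a) \<Rightarrow> bool"
  where "trivialization Y M n U \<phi> \<longleftrightarrow> openin (pts Y) U \<and>
     module_sheaf_iso (open_subspace Y U) (free_sheaf (open_subspace Y U) n) M \<phi>"

definition locally_free :: "('x, 'r) ringed_space \<Rightarrow> ('x, 'r, 'a) module_sheaf \<Rightarrow> nat \<Rightarrow> bool" where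
  "locally_free Y M n \<longleftrightarrow> (\<forall>x\<in>topspace (pts Y). \<exists>U \<phi>. x \<in> U \<and> trivialization Y M n U \<phi>)"

definition quadratic_etale_algebra ::
  "('x, 'r) ringed_space \<Rightarrow> ('x, 'r, 'a) module_sheaf \<Rightarrow> bool" where
  "quadratic_etale_algebra Y A \<longleftrightarrow> algebra_sheaf Y A \<and> locally_free Y A 2 \<and>
     (\<forall>U. affine_open Y U \<longrightarrow> etale_algebra (secs Y U) (msecs A U))"

subsection \<open>The trace\<close>

text \<open>The trace of the matrix of multiplication by \<open>a\<close> with respect to the basis of \<open>A\<close> over \<open>U\<close> given by
  the trivialization \<open>\<phi>\<close>, whose \<open>j\<close>-th element is the image of the \<open>j\<close>-th unit vector.\<close>

definition local_trace :: "('x, 'r) ringed_space \<Rightarrow> ('x, 'r, 'a) module_sheaf \<Rightarrow> nat \<Rightarrow> 'x set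
    \<Rightarrow> ('x set \<Rightarrow> (nat \<Rightarrow> 'r) \<Rightarrow> 'a) \<Rightarrow> 'a \<Rightarrow> 'r" where
  "local_trace Y A n U \<phi> a =
    (\<Oplus>\<^bsub>secs Y U\<^esub>j\<in>{..<n}.
       inv_into ({..<n} \<rightarrow>\<^sub>E carrier (secs Y U)) (\<phi> U)
         (a \<otimes>\<^bsub>msecs A U\<^esub> \<phi> U (\<lambda>i\<in>{..<n}. if i = j then \<one>\<^bsub>secs Y U\<^esub> else \<zero>\<^bsub>secs Y U\<^esub>)) j)"

text \<open>The trace of a section over \<open>U\<close> is glued from the local traces.\<close>

definition sheaf_trace :: "('x, 'r) ringed_space \<Rightarrow> ('x, 'r, 'a) module_sheaf \<Rightarrow> 'x set \<Rightarrow> 'a \<Rightarrow> 'r" where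
  "sheaf_trace Y A U a = (THE t. t \<in> carrier (secs Y U) \<and>
     (\<forall>V n \<phi>. V \<subseteq> U \<and> trivialization Y A n V \<phi> \<longrightarrow>
        restr Y U V t = local_trace Y A n V \<phi> (mrestr A U V a)))"

definition trace_kernel ::
  "('x, 'r) ringed_space \<Rightarrow> ('x, 'r, 'a) module_sheaf \<Rightarrow> ('x, 'r, 'a) module_sheaf" where
  "trace_kernel Y A = A\<lparr>msecs := (\<lambda>U. (msecs A U)
     \<lparr>carrier := {a \<in> carrier (msecs A U). sheaf_trace Y A U a = \<zero>\<^bsub>secs Y U\<^esub>}\<rparr>)\<rparr>"

subsection \<open>Generation by global sections\<close>

definition generate_as_algebra ::
  "('x, 'r) ringed_space \<Rightarrow> ('x, 'r, 'a) module_sheaf \<Rightarrow> nat \<Rightarrow> (nat \<Rightarrow> 'a) \<Rightarrow> bool" where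
  "generate_as_algebra Y A r a \<longleftrightarrow> (\<forall>U. affine_open Y U \<longrightarrow>
     generated_subalgebra (secs Y U) (msecs A U)
       ((\<lambda>i. mrestr A (topspace (pts Y)) U (a i)) ` {..<r}) = carrier (msecs A U))"

text \<open>The map from the free sheaf of rank \<open>r\<close> sending the \<open>i\<close>-th unit vector to \<open>l i\<close>.\<close>

definition sections_map :: "('x, 'r) ringed_space \<Rightarrow> ('x, 'r, 'a) module_sheaf \<Rightarrow> nat \<Rightarrow> (nat \<Rightarrow> 'a)
    \<Rightarrow> 'x set \<Rightarrow> (nat \<Rightarrow> 'r) \<Rightarrow> 'a" where
  "sections_map Y M r l U c =
    (\<Oplus>\<^bsub>msecs M U\<^esub>i\<in>{..<r}. c i \<odot>\<^bsub>msecs M U\<^esub> mrestr M (topspace (pts Y)) U (l i))"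

definition generate_as_module ::
  "('x, 'r) ringed_space \<Rightarrow> ('x, 'r, 'a) module_sheaf \<Rightarrow> nat \<Rightarrow> (nat \<Rightarrow> 'a) \<Rightarrow> bool" where
  "generate_as_module Y M r l \<longleftrightarrow>
     (\<forall>i<r. l i \<in> carrier (msecs M (topspace (pts Y)))) \<and>
     sheaf_surjective Y (free_sheaf Y r) M (sections_map Y M r l)"

end

theory Submission
  imports Defs
begin

text \<open>Since \<open>2\<close> is a unit in every residue field it is a unit in every stalk, hence on \<open>Y\<close>, and every section
  \<open>s\<close> of \<open>A\<close> is the sum of the scalar \<open>Tr(s)/2\<close> and a traceless section.  By Cayley--Hamilton the square of a
  traceless section is a scalar, and by polarization so is the product of two of them.  Hence the
  module spanned by \<open>1\<close> and the traceless parts \<open>l\<^sub>i\<close> of the \<open>a\<^sub>i\<close> is closed under multiplication: over an affine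
  open set, the \<open>a\<^sub>i\<close> generate \<open>A\<close> as an algebra iff the \<open>l\<^sub>i\<close> span the traceless sections as a module.
  Passing between this and local generation of the kernel of the trace uses that a locally free
  sheaf on an affine open set is quasi-coherent: a section over \<open>D(h)\<close> extends after multiplication by a power of
  \<open>h\<close>, and a section that vanishes on \<open>D(h)\<close> is killed by a power of \<open>h\<close>.\<close>

section \<open>Prime ideals and the spectrum of a ring\<close>

text \<open>The two sides of the equivalence live on different scales: generation as an algebra is a
  statement about sections over every affine open set, generation of the kernel is local. Each
  direction uses one half of quasi-coherence: algebra to module extends a section from
  \<open>D h\<close> to the affine open set, module to algebra kills a difference that vanishes on
  \<open>D h\<close>.

  Quasi-coherence is not part of the data. It is derived from local freeness: coordinates reduce it
  to the structure sheaf, where it says that sections over \<open>D h\<close> are fractions with a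
  power of \<open>h\<close> as denominator. For a structure sheaf of locally fractional functions
  this is the hard fact about spectra, and since an affine open set is only isomorphic to a
  spectrum, the locale \<open>affine_chart\<close> collects exactly the consequences that are used.

  The trace is a definite description ranging over all trivializations of any rank, so it first has
  to be shown to exist, by gluing.

  Exponents appear as "for all large \<open>m\<close>", so that finitely many coordinates and
  finitely many pieces of a cover can share one exponent.\<close>

context cring
begin

text \<open>Zorn's lemma, kept general in \<open>f\<close> because two cases are needed: an
  arbitrary \<open>f\<close> yields prime ideals, and \<open>f = \<one>\<close> yields maximal
  ideals.\<close>

lemma exists_ideal_maximal_avoiding_powers:
  assumes "ideal J R" "\<And>n::nat. f [^] n \<notin> J"
  obtains P where "ideal P R" "J \<subseteq> P" "\<And>n::nat. f [^] n \<notin> P"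
    "\<And>I. ideal I R \<Longrightarrow> P \<subseteq> I \<Longrightarrow> (\<And>n::nat. f [^] n \<notin> I) \<Longrightarrow> I = P"
proof -
  define A where "A = {I. ideal I R \<and> J \<subseteq> I \<and> (\<forall>n::nat. f [^] n \<notin> I)}"
  have "\<exists>M\<in>A. \<forall>N\<in>A. M \<subseteq> N \<longrightarrow> N = M"
  proof (rule subset_Zorn_nonempty)
    show "A \<noteq> {}" using assms unfolding A_def by blast
    fix C assume C: "C \<noteq> {}" "subset.chain A C"
    then have CA: "C \<subseteq> A" unfolding pred_on.chain_def by blast
    have "subset.chain {I. ideal I R} C"
      using C(2) unfolding pred_on.chain_def A_def by blast
    then have "ideal (\<Union>C) R" using chain_Union_is_ideal[of C] C(1) by simp
    then show "\<Union>C \<in> A" using CA C(1) unfolding A_def by blast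
  qed
  then obtain P where P: "P \<in> A" and max: "\<And>N. N \<in> A \<Longrightarrow> P \<subseteq> N \<Longrightarrow> N = P" by blast
  show ?thesis
  proof (rule that)
    show "ideal P R" "J \<subseteq> P" "\<And>n::nat. f [^] n \<notin> P" using P unfolding A_def by auto
    show "I = P" if "ideal I R" "P \<subseteq> I" "\<And>n::nat. f [^] n \<notin> I" for I
      using that P by (intro max) (auto simp: A_def)
  qed
qed

text \<open>An ideal that is maximal among those avoiding the powers of \<open>f\<close> is prime:
  if \<open>a\<close> and \<open>b\<close> lie outside \<open>P\<close>, then both P + (a) and P +
  (b) contain a power of \<open>f\<close>, and the product of these powers lies in P + (ab).\<close>

lemma exists_prime_avoiding_powers:
  assumes J: "ideal J R" and f: "f \<in> carrier R" and pow: "\<And>n::nat. f [^] n \<notin> J"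
  obtains P where "primeideal P R" "J \<subseteq> P" "f \<notin> P"
proof -
  obtain P where P: "ideal P R" "J \<subseteq> P" "\<And>n::nat. f [^] n \<notin> P"
    and max: "\<And>I. ideal I R \<Longrightarrow> P \<subseteq> I \<Longrightarrow> (\<And>n::nat. f [^] n \<notin> I) \<Longrightarrow> I = P"
    using exists_ideal_maximal_avoiding_powers[OF J pow] by blast
  interpret P: ideal P R by fact
  have step: "\<exists>(n::nat) p x. p \<in> P \<and> x \<in> carrier R \<and> f [^] n = p \<oplus> x \<otimes> a"
    if a: "a \<in> carrier R" "a \<notin> P" for a
  proof -
    have I: "ideal (P <+> PIdl a) R" using P(1) cgenideal_ideal[OF a(1)] by (rule add_ideals)
    have "P \<subseteq> P <+> PIdl a"
    proof
      fix p assume p: "p \<in> P"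
      have "\<zero> \<in> PIdl a"
        using additive_subgroup.zero_closed[OF ideal.axioms(1)[OF cgenideal_ideal[OF a(1)]]] .
      then have "p \<oplus> \<zero> \<in> P <+> PIdl a" unfolding set_add_def' using p by blast
      then show "p \<in> P <+> PIdl a" using P.Icarr[OF p] by simp
    qed
    moreover have "\<zero> \<oplus> a \<in> P <+> PIdl a"
      unfolding set_add_def' using P.zero_closed cgenideal_self[OF a(1)] by blast
    ultimately have "\<exists>n::nat. f [^] n \<in> P <+> PIdl a" using max[OF I] a by auto
    then show ?thesis unfolding set_add_def' cgenideal_def by blast
  qed
  have "primeideal P R"
  proof (rule primeidealI[OF P(1) cring_axioms])
    show "carrier R \<noteq> P" using P(3) f by blast
    fix a b assume ab: "a \<in> carrier R" "b \<in> carrier R" "a \<otimes> b \<in> P"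
    show "a \<in> P \<or> b \<in> P"
    proof (rule ccontr)
      assume "\<not> ?thesis"
      then obtain n m :: nat and p q x y where
        1: "p \<in> P" "x \<in> carrier R" "f [^] n = p \<oplus> x \<otimes> a" and
        2: "q \<in> P" "y \<in> carrier R" "f [^] m = q \<oplus> y \<otimes> b"
        using step ab by meson
      note c = P.Icarr[OF 1(1)] P.Icarr[OF 2(1)] 1(2) 2(2) ab(1,2)
      \<comment> \<open>The product is expanded so that each of the three summands has a factor in
        \<open>P\<close>: \<open>p\<close>, \<open>q\<close> or the product of \<open>a\<close> and
        \<open>b\<close>.\<close>
      have "f [^] (n + m) = (p \<oplus> x \<otimes> a) \<otimes> (q \<oplus> y \<otimes> b)"
        using 1 2 f by (simp flip: nat_pow_mult)
      also have "\<dots> = ((q \<oplus> y \<otimes> b) \<otimes> p \<oplus> (x \<otimes> a) \<otimes> q) \<oplus> (x \<otimes> y) \<otimes> (a \<otimes> b)"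
        using c by (simp add: l_distr r_distr a_ac m_ac)
      also have "\<dots> \<in> P"
        by (intro P.a_closed P.I_l_closed 1(1) 2(1) ab(3) add.m_closed m_closed c)
      finally show False using P(3) by blast
    qed
  qed
  moreover have "f \<notin> P" using P(3)[of 1] f by simp
  ultimately show ?thesis using that P(2) by blast
qed

text \<open>For \<open>f = \<one>\<close>, avoiding all powers of \<open>f\<close> means being a
  proper ideal, so the Zorn argument applied to the principal ideal of \<open>a\<close> gives a
  maximal ideal.\<close>

lemma exists_maximalideal_nonunit:
  assumes a: "a \<in> carrier R" "a \<notin> Units R"
  obtains P where "maximalideal P R" "a \<in> P"
proof -
  have one: "I = carrier R" if "ideal I R" "\<one> [^] (n::nat) \<in> I" for I n
    using that ideal.one_imp_carrier by fastforce
  have "\<one> \<notin> PIdl a"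
  proof
    assume "\<one> \<in> PIdl a"
    then obtain x where "x \<in> carrier R" "\<one> = x \<otimes> a" unfolding cgenideal_def by blast
    then show False using a m_comm unfolding Units_def by auto
  qed
  then obtain P where P: "ideal P R" "PIdl a \<subseteq> P" "\<And>n::nat. \<one> [^] n \<notin> P"
    and max: "\<And>I. ideal I R \<Longrightarrow> P \<subseteq> I \<Longrightarrow> (\<And>n::nat. \<one> [^] n \<notin> I) \<Longrightarrow> I = P"
    using exists_ideal_maximal_avoiding_powers[OF cgenideal_ideal[OF a(1)], of \<one>] by auto
  have "maximalideal P R"
  proof (rule maximalidealI[OF P(1)])
    show "carrier R \<noteq> P" using P(3) by fastforce
    show "I = P \<or> I = carrier R" if "ideal I R" "P \<subseteq> I" for I
      using max[OF that] one[OF that(1)] by blast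
  qed
  then show ?thesis using that P(2) cgenideal_self[OF a(1)] by blast
qed

text \<open>Meant for the ideals generated by the finite subsets of a set; these form a directed
  family but in general no chain.\<close>

lemma ideal_directed_Union:
  assumes ne: "F \<noteq> {}" and id: "\<And>I. I \<in> F \<Longrightarrow> ideal I R"
    and dir: "\<And>I J. I \<in> F \<Longrightarrow> J \<in> F \<Longrightarrow> \<exists>K\<in>F. I \<subseteq> K \<and> J \<subseteq> K"
  shows "ideal (\<Union>F) R"
proof (rule idealI[OF ring_axioms])
  show "subgroup (\<Union>F) (add_monoid R)"
  proof
    show "\<Union>F \<subseteq> carrier (add_monoid R)" using id ideal.Icarr by fastforce
    show "x \<otimes>\<^bsub>add_monoid R\<^esub> y \<in> \<Union>F" if xy: "x \<in> \<Union>F" "y \<in> \<Union>F" for x y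
    proof -
      obtain I J where "I \<in> F" "x \<in> I" "J \<in> F" "y \<in> J" using xy by blast
      then obtain K where K: "K \<in> F" "x \<in> K" "y \<in> K" using dir[of I J] by blast
      then show ?thesis using additive_subgroup.a_closed[OF ideal.axioms(1)[OF id[OF K(1)]]] by auto
    qed
    show "\<one>\<^bsub>add_monoid R\<^esub> \<in> \<Union>F"
      using ne additive_subgroup.zero_closed[OF ideal.axioms(1)[OF id]] by auto
    show "inv\<^bsub>add_monoid R\<^esub> x \<in> \<Union>F" if "x \<in> \<Union>F" for x
      using that additive_subgroup.a_inv_closed[OF ideal.axioms(1)[OF id]]
      unfolding a_inv_def[symmetric] by auto
  qed
  show "x \<otimes> a \<in> \<Union>F" "a \<otimes> x \<in> \<Union>F" if "a \<in> \<Union>F" "x \<in> carrier R" for a x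
    using that ideal.I_l_closed[OF id] ideal.I_r_closed[OF id] by blast+
qed

text \<open>Contrapositive of the existence of primes avoiding the powers of \<open>f\<close>.
  Local-to-global arguments on a spectrum take this form: collect the good multipliers in an ideal
  \<open>J\<close>, find one outside each prime of D(f), and conclude that a power of
  \<open>f\<close> is good.\<close>

lemma prime_cover_power_mem:
  assumes J: "ideal J R" and f: "f \<in> carrier R"
    and cov: "\<And>P. primeideal P R \<Longrightarrow> f \<notin> P \<Longrightarrow> \<not> J \<subseteq> P"
  obtains n :: nat where "f [^] n \<in> J"
  using exists_prime_avoiding_powers[OF J f] cov by metis

text \<open>The union of the ideals generated by finite subsets of \<open>H\<close> lies in no prime
  of D(f), so it contains a power of \<open>f\<close>. That power already lies in one of these
  ideals, and the finitely many generators of that ideal suffice.\<close>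

lemma basic_open_quasi_compact:
  assumes f: "f \<in> carrier R" and H: "H \<subseteq> carrier R"
    and cov: "\<And>P. primeideal P R \<Longrightarrow> f \<notin> P \<Longrightarrow> \<not> H \<subseteq> P"
  obtains F where "finite F" "F \<subseteq> H" "\<And>P. primeideal P R \<Longrightarrow> f \<notin> P \<Longrightarrow> \<not> F \<subseteq> P"
proof -
  let ?F = "{Idl G | G. finite G \<and> G \<subseteq> H}"
  have "ideal (\<Union>?F) R"
  proof (rule ideal_directed_Union)
    show "?F \<noteq> {}" by blast
    show "ideal I R" if "I \<in> ?F" for I using that H genideal_ideal by blast
    fix I I' assume "I \<in> ?F" "I' \<in> ?F"
    then obtain G G' where G: "finite G" "G \<subseteq> H" "I = Idl G" "finite G'" "G' \<subseteq> H" "I' = Idl G'"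
      by blast
    then have "Idl (G \<union> G') \<in> ?F" by blast
    moreover have "I \<subseteq> Idl (G \<union> G')" "I' \<subseteq> Idl (G \<union> G')" unfolding G(3,6) genideal_def by auto
    ultimately show "\<exists>K\<in>?F. I \<subseteq> K \<and> I' \<subseteq> K" by blast
  qed
  moreover have "\<not> \<Union>?F \<subseteq> P" if P: "primeideal P R" "f \<notin> P" for P
  proof -
    obtain h where h: "h \<in> H" "h \<notin> P" using cov[OF P] by blast
    have "h \<in> Idl {h}" using h H genideal_self' by blast
    then show ?thesis using h by blast
  qed
  ultimately obtain n :: nat where "f [^] n \<in> \<Union>?F" using prime_cover_power_mem[OF _ f] by blast
  then obtain G where G: "finite G" "G \<subseteq> H" "f [^] n \<in> Idl G" by blast
  have "\<not> G \<subseteq> P" if P: "primeideal P R" "f \<notin> P" for P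
  proof
    assume "G \<subseteq> P"
    interpret P: primeideal P R by fact
    have "f [^] n \<in> P" using G(3) genideal_minimal[OF P.is_ideal \<open>G \<subseteq> P\<close>] by blast
    then have "f \<in> P"
    proof (induction n)
      case 0 then show ?case using P.I_notcarr P.one_imp_carrier by fastforce
    next
      case (Suc n) then show ?case using P.I_prime[of "f [^] n" f] f by auto
    qed
    then show False using P by blast
  qed
  then show ?thesis using that G by blast
qed

end

text \<open>Finitely many properties that hold for all large exponents hold together from some
  exponent on. This is why the extension and killing lemmas are stated for all \<open>m\<close>
  beyond a bound.\<close>

lemma finite_uniform_exponent:
  fixes Q :: "'i \<Rightarrow> nat \<Rightarrow> bool"
  assumes "finite F" "\<And>i. i \<in> F \<Longrightarrow> \<exists>n. \<forall>m\<ge>n. Q i m"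
  obtains N where "\<And>i m. i \<in> F \<Longrightarrow> N \<le> m \<Longrightarrow> Q i m"
proof -
  have "\<forall>\<^sub>F m in sequentially. \<forall>i\<in>F. Q i m"
    using assms by (intro eventually_ball_finite ballI) (auto simp: eventually_sequentially)
  then show ?thesis using that unfolding eventually_sequentially by blast
qed

lemma (in primeideal) diff_mult_closed:
  "\<lbrakk>u \<in> carrier R - I; v \<in> carrier R - I\<rbrakk> \<Longrightarrow> u \<otimes> v \<in> carrier R - I"
  using I_prime by auto

lemma (in primeideal) one_diff: "\<one> \<in> carrier R - I"
  using I_notcarr one_imp_carrier by auto

lemma (in primeideal) diff_pow_closed: "u \<in> carrier R - I \<Longrightarrow> u [^] (n::nat) \<in> carrier R - I"
  by (induction n) (use one_diff diff_mult_closed in auto)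

text \<open>Operations on localizations and on stalks are unions over all pairs of representatives;
  such a union collapses to one class once all choices give the same class.\<close>

lemma UN_pairs_constant:
  assumes "A \<noteq> {}" "B \<noteq> {}"
    and "\<And>x y u v. (x, y) \<in> A \<Longrightarrow> (u, v) \<in> B \<Longrightarrow> G x y u v = C"
  shows "(\<Union>(x, y)\<in>A. \<Union>(u, v)\<in>B. G x y u v) = C"
proof -
  have "(case w of (u, v) \<Rightarrow> G x y u v) = C" if "(x, y) \<in> A" "w \<in> B" for x y w
    using that assms(3) by (cases w) simp
  then have "(case z of (x, y) \<Rightarrow> \<Union>(u, v)\<in>B. G x y u v) = C" if "z \<in> A" for z
    using that assms(2) by (cases z) simp
  then show ?thesis using assms(1) by simp
qed

section \<open>Fractions and the localization at a prime ideal\<close>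

locale spectrum = cring R for R :: "'r ring" (structure)
begin

lemma frac_at_eq_iff:
  assumes P: "primeideal P R" and "a \<in> carrier R" "b \<in> carrier R" "s \<in> carrier R - P" "t \<in> carrier R - P"
  shows "frac_at R P a s = frac_at R P b t \<longleftrightarrow> (\<exists>u\<in>carrier R - P. u \<otimes> (t \<otimes> a) = u \<otimes> (s \<otimes> b))"
proof -
  interpret P: primeideal P R by fact
  have sub: "frac_at R P a s \<subseteq> frac_at R P b t"
    if c: "a \<in> carrier R" "b \<in> carrier R" "s \<in> carrier R - P" "t \<in> carrier R - P"
      and u: "u \<in> carrier R - P" "u \<otimes> (t \<otimes> a) = u \<otimes> (s \<otimes> b)" for a b s t u
  proof
    fix z assume "z \<in> frac_at R P a s"
    then obtain d v w where z: "z = (d, v)" "d \<in> carrier R" "v \<in> carrier R - P" "w \<in> carrier R - P"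
      "w \<otimes> (v \<otimes> a) = w \<otimes> (s \<otimes> d)" unfolding frac_at_def by blast
    have "(w \<otimes> (u \<otimes> s)) \<otimes> (v \<otimes> b) = (w \<otimes> v) \<otimes> (u \<otimes> (s \<otimes> b))" using c u(1) z(2-4) by (simp add: m_ac)
    also have "\<dots> = (u \<otimes> t) \<otimes> (w \<otimes> (v \<otimes> a))" unfolding u(2)[symmetric] using c u(1) z(2-4) by (simp add: m_ac)
    also have "\<dots> = (w \<otimes> (u \<otimes> s)) \<otimes> (t \<otimes> d)" unfolding z(5) using c u(1) z(2-4) by (simp add: m_ac)
    finally have "(w \<otimes> (u \<otimes> s)) \<otimes> (v \<otimes> b) = (w \<otimes> (u \<otimes> s)) \<otimes> (t \<otimes> d)" .
    moreover have "w \<otimes> (u \<otimes> s) \<in> carrier R - P" using c u z P.diff_mult_closed by blast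
    ultimately show "z \<in> frac_at R P b t" unfolding frac_at_def z(1) using z(2,3) by blast
  qed
  show ?thesis
  proof
    assume eq: "frac_at R P a s = frac_at R P b t"
    have "\<one> \<otimes> (t \<otimes> b) = \<one> \<otimes> (t \<otimes> b)" ..
    then have "(b, t) \<in> frac_at R P b t" unfolding frac_at_def using assms P.one_diff by blast
    then show "\<exists>u\<in>carrier R - P. u \<otimes> (t \<otimes> a) = u \<otimes> (s \<otimes> b)"
      unfolding eq[symmetric] unfolding frac_at_def by blast
  next
    assume "\<exists>u\<in>carrier R - P. u \<otimes> (t \<otimes> a) = u \<otimes> (s \<otimes> b)"
    then show "frac_at R P a s = frac_at R P b t"
      using sub[of a b s t] sub[of b a t s] assms by (metis subset_antisym)
  qed
qed

lemma frac_at_self: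
  assumes "primeideal P R" "a \<in> carrier R" "s \<in> carrier R - P"
  shows "(a, s) \<in> frac_at R P a s"
  unfolding frac_at_def using assms primeideal.one_diff[OF assms(1)] by blast

lemma frac_at_rep:
  assumes P: "primeideal P R" and c: "a \<in> carrier R" "s \<in> carrier R - P" and z: "(b, t) \<in> frac_at R P a s"
  shows "b \<in> carrier R" "t \<in> carrier R - P" "frac_at R P b t = frac_at R P a s"
proof -
  show bt: "b \<in> carrier R" "t \<in> carrier R - P" using z unfolding frac_at_def by auto
  show "frac_at R P b t = frac_at R P a s"
    using z frac_at_eq_iff[OF P c(1) bt(1) c(2) bt(2)] unfolding frac_at_def by auto
qed

lemma localization_mult:
  assumes P: "primeideal P R" and c: "a \<in> carrier R" "b \<in> carrier R" "s \<in> carrier R - P" "t \<in> carrier R - P"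
  shows "frac_at R P a s \<otimes>\<^bsub>localization_at R P\<^esub> frac_at R P b t = frac_at R P (a \<otimes> b) (s \<otimes> t)"
proof -
  interpret P: primeideal P R by fact
  have "frac_at R P (a' \<otimes> b') (s' \<otimes> t') = frac_at R P (a \<otimes> b) (s \<otimes> t)"
    if z: "(a', s') \<in> frac_at R P a s" "(b', t') \<in> frac_at R P b t" for a' s' b' t'
  proof -
    note 1 = frac_at_rep[OF P c(1,3) z(1)] and 2 = frac_at_rep[OF P c(2,4) z(2)]
    obtain u where u: "u \<in> carrier R - P" "u \<otimes> (s \<otimes> a') = u \<otimes> (s' \<otimes> a)"
      using 1 c frac_at_eq_iff[OF P] by meson
    obtain v where v: "v \<in> carrier R - P" "v \<otimes> (t \<otimes> b') = v \<otimes> (t' \<otimes> b)"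
      using 2 c frac_at_eq_iff[OF P] by meson
    have "(u \<otimes> v) \<otimes> ((s \<otimes> t) \<otimes> (a' \<otimes> b')) = (u \<otimes> (s \<otimes> a')) \<otimes> (v \<otimes> (t \<otimes> b'))"
      using 1(1,2) 2(1,2) c u(1) v(1) by (simp add: m_ac)
    also have "\<dots> = (u \<otimes> v) \<otimes> ((s' \<otimes> t') \<otimes> (a \<otimes> b))"
      unfolding u(2) v(2) using 1(1,2) 2(1,2) c u(1) v(1) by (simp add: m_ac)
    finally have "\<exists>w\<in>carrier R - P. w \<otimes> ((s \<otimes> t) \<otimes> (a' \<otimes> b')) = w \<otimes> ((s' \<otimes> t') \<otimes> (a \<otimes> b))"
      using P.diff_mult_closed[OF u(1) v(1)] by blast
    then show ?thesis
      using frac_at_eq_iff[OF P _ _ P.diff_mult_closed[OF 1(2) 2(2)] P.diff_mult_closed[OF c(3,4)],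
        of "a' \<otimes> b'" "a \<otimes> b"] 1(1) 2(1) c(1,2) by simp
  qed
  moreover have "frac_at R P a s \<noteq> {}" "frac_at R P b t \<noteq> {}" using frac_at_self[OF P] c by blast+
  ultimately show ?thesis
    unfolding localization_at_def by (simp only: ring.simps monoid.simps) (rule UN_pairs_constant)
qed

lemma localization_add:
  assumes P: "primeideal P R" and c: "a \<in> carrier R" "b \<in> carrier R" "s \<in> carrier R - P" "t \<in> carrier R - P"
  shows "frac_at R P a s \<oplus>\<^bsub>localization_at R P\<^esub> frac_at R P b t
    = frac_at R P (a \<otimes> t \<oplus> b \<otimes> s) (s \<otimes> t)"
proof -
  interpret P: primeideal P R by fact
  have "frac_at R P (a' \<otimes> t' \<oplus> b' \<otimes> s') (s' \<otimes> t') = frac_at R P (a \<otimes> t \<oplus> b \<otimes> s) (s \<otimes> t)"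
    if z: "(a', s') \<in> frac_at R P a s" "(b', t') \<in> frac_at R P b t" for a' s' b' t'
  proof -
    note 1 = frac_at_rep[OF P c(1,3) z(1)] and 2 = frac_at_rep[OF P c(2,4) z(2)]
    obtain u where u: "u \<in> carrier R - P" "u \<otimes> (s \<otimes> a') = u \<otimes> (s' \<otimes> a)"
      using 1 c frac_at_eq_iff[OF P] by meson
    obtain v where v: "v \<in> carrier R - P" "v \<otimes> (t \<otimes> b') = v \<otimes> (t' \<otimes> b)"
      using 2 c frac_at_eq_iff[OF P] by meson
    have "(u \<otimes> v) \<otimes> ((s \<otimes> t) \<otimes> (a' \<otimes> t' \<oplus> b' \<otimes> s'))
        = (v \<otimes> t \<otimes> t') \<otimes> (u \<otimes> (s \<otimes> a')) \<oplus> (u \<otimes> s \<otimes> s') \<otimes> (v \<otimes> (t \<otimes> b'))"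
      using 1(1,2) 2(1,2) c u(1) v(1) by (simp add: m_ac r_distr)
    also have "\<dots> = (u \<otimes> v) \<otimes> ((s' \<otimes> t') \<otimes> (a \<otimes> t \<oplus> b \<otimes> s))"
      unfolding u(2) v(2) using 1(1,2) 2(1,2) c u(1) v(1) by (simp add: m_ac r_distr)
    finally have "\<exists>w\<in>carrier R - P. w \<otimes> ((s \<otimes> t) \<otimes> (a' \<otimes> t' \<oplus> b' \<otimes> s'))
        = w \<otimes> ((s' \<otimes> t') \<otimes> (a \<otimes> t \<oplus> b \<otimes> s))"
      using P.diff_mult_closed[OF u(1) v(1)] by blast
    then show ?thesis
      using frac_at_eq_iff[OF P _ _ P.diff_mult_closed[OF 1(2) 2(2)] P.diff_mult_closed[OF c(3,4)],
        of "a' \<otimes> t' \<oplus> b' \<otimes> s'" "a \<otimes> t \<oplus> b \<otimes> s"] 1(1,2) 2(1,2) c by simp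
  qed
  moreover have "frac_at R P a s \<noteq> {}" "frac_at R P b t \<noteq> {}" using frac_at_self[OF P] c by blast+
  ultimately show ?thesis
    unfolding localization_at_def by (simp only: ring.simps monoid.simps) (rule UN_pairs_constant)
qed

section \<open>The Zariski topology and its basic open sets\<close>

lemma openin_basic_open: "f \<in> carrier R \<Longrightarrow> openin (zariski_topology R) (basic_open R f)"
  unfolding zariski_topology_def by (intro topology_generated_by_Basis) auto

lemma basic_open_mult:
  assumes "f \<in> carrier R" "g \<in> carrier R"
  shows "basic_open R (f \<otimes> g) = basic_open R f \<inter> basic_open R g"
  using assms primeideal.I_prime ideal.I_l_closed ideal.I_r_closed primeideal.axioms(1)
  unfolding basic_open_def by fast

lemma basic_open_one: "basic_open R \<one> = {P. primeideal P R}"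
  using primeideal.one_diff unfolding basic_open_def by fastforce

lemma topspace_zariski: "topspace (zariski_topology R) = {P. primeideal P R}"
proof -
  have "basic_open R \<one> \<in> basic_open R ` carrier R" by auto
  then show ?thesis unfolding zariski_topology_def topology_generated_by_topspace
    using basic_open_one unfolding basic_open_def by blast
qed

text \<open>The topology is generated by the sets D(h) as a subbasis. They form a basis because D(h)
  and D(k) meet in D(hk), which settles the only nontrivial case of the induction.\<close>

lemma zariski_basis:
  assumes "openin (zariski_topology R) V" "P \<in> V"
  shows "\<exists>h\<in>carrier R. P \<in> basic_open R h \<and> basic_open R h \<subseteq> V"
proof -
  have "generate_topology_on (basic_open R ` carrier R) V"
    using assms(1) unfolding zariski_topology_def openin_topology_generated_by_iff .
  then show ?thesis using assms(2)
  proof induction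
    case (Int V W)
    then obtain h k where "h \<in> carrier R" "P \<in> basic_open R h" "basic_open R h \<subseteq> V"
      "k \<in> carrier R" "P \<in> basic_open R k" "basic_open R k \<subseteq> W" by auto
    then show ?case using basic_open_mult[of h k] by (intro bexI[of _ "h \<otimes> k"]) auto
  next
    case (UN K)
    then obtain V where V: "V \<in> K" "P \<in> V" by blast
    then show ?case using UN.IH[OF V] by blast
  qed auto
qed

text \<open>The multipliers that make the cross products equal form an ideal. Equality of the
  fractions at a prime \<open>P\<close> provides such a multiplier outside \<open>P\<close>, so the
  ideal contains a power of \<open>f\<close>.\<close>

lemma frac_eq_on_basic_open:
  assumes c: "f \<in> carrier R" "a \<in> carrier R" "b \<in> carrier R" "s \<in> carrier R" "t \<in> carrier R"
    and nz: "\<And>P. P \<in> basic_open R f \<Longrightarrow> s \<notin> P \<and> t \<notin> P"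
    and eq: "\<And>P. P \<in> basic_open R f \<Longrightarrow> frac_at R P a s = frac_at R P b t"
  shows "\<exists>n::nat. f [^] n \<otimes> (t \<otimes> a) = f [^] n \<otimes> (s \<otimes> b)"
proof -
  let ?J = "{x \<in> carrier R. x \<otimes> (t \<otimes> a) = x \<otimes> (s \<otimes> b)}"
  have "ideal ?J R"
  proof (intro idealI[OF ring_axioms] add.subgroupI)
    show "x \<oplus> y \<in> ?J" if "x \<in> ?J" "y \<in> ?J" for x y
      using that c by (auto simp: l_distr)
    show "\<ominus> x \<in> ?J" if "x \<in> ?J" for x
      using that c by (auto simp: l_minus)
    show "y \<otimes> x \<in> ?J" "x \<otimes> y \<in> ?J" if x: "x \<in> ?J" "y \<in> carrier R" for x y
    proof -
      have "y \<otimes> x \<otimes> (t \<otimes> a) = y \<otimes> (x \<otimes> (t \<otimes> a))" using x c by (simp add: m_assoc)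
      also have "\<dots> = y \<otimes> x \<otimes> (s \<otimes> b)" using x c by (simp add: m_assoc)
      finally show "y \<otimes> x \<in> ?J" "x \<otimes> y \<in> ?J" using x m_comm[of x y] by auto
    qed
  qed (use c in auto)
  moreover have "\<not> ?J \<subseteq> P" if P': "primeideal P R" "f \<notin> P" for P
  proof -
    have P: "P \<in> basic_open R f" using P' unfolding basic_open_def by blast
    then obtain u where "u \<in> carrier R - P" "u \<otimes> (t \<otimes> a) = u \<otimes> (s \<otimes> b)"
      using frac_at_eq_iff[OF P'(1) c(2,3), of s t] eq nz c by blast
    then show ?thesis by blast
  qed
  ultimately show ?thesis using prime_cover_power_mem[OF _ c(1)] by blast
qed

text \<open>The ideal of denominators of a section over \<open>D(f)\<close> lies in no prime of \<open>D(f)\<close>, so it contains a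
  power of \<open>f\<close>.\<close>

lemma section_over_basic_open:
  assumes f: "f \<in> carrier R" and \<xi>: "\<xi> \<in> carrier (spec_secs R (basic_open R f))"
  obtains a n where "a \<in> carrier R" "\<And>P. P \<in> basic_open R f \<Longrightarrow> \<xi> P = frac_at R P a (f [^] (n::nat))"
proof -
  let ?D = "basic_open R"
  \<comment> \<open>Elements \<open>h\<close> for which \<open>\<xi>\<close> is on all of D(h) one
    fraction with denominator \<open>h\<close> itself, so that domain and denominator are governed
    by the same element.\<close>
  define H where "H = {h \<in> carrier R. ?D h \<subseteq> ?D f \<and> (\<exists>a\<in>carrier R. \<forall>Q\<in>?D h. \<xi> Q = frac_at R Q a h)}"
  have H: "\<exists>h\<in>H. P \<in> ?D h" if P: "P \<in> ?D f" for P
  proof -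
    obtain V a s where V: "openin (zariski_topology R) V" "P \<in> V" "V \<subseteq> ?D f" "a \<in> carrier R" "s \<in> carrier R"
      "\<And>Q. Q \<in> V \<Longrightarrow> s \<notin> Q \<and> \<xi> Q = frac_at R Q a s"
      using \<xi> P unfolding spec_secs_def by auto
    obtain k where k: "k \<in> carrier R" "P \<in> ?D k" "?D k \<subseteq> V" using zariski_basis[OF V(1,2)] by blast
    \<comment> \<open>A local expression a/s near \<open>P\<close> is expanded by \<open>k\<close>
      with D(k) inside \<open>V\<close>. As \<open>s\<close> vanishes nowhere on \<open>V\<close>,
      D(ks) = D(k), so \<open>k \<otimes> s\<close> serves as the required element of
      \<open>H\<close>.\<close>
    have "\<xi> Q = frac_at R Q (k \<otimes> a) (k \<otimes> s)" if Q: "Q \<in> ?D (k \<otimes> s)" for Q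
    proof -
      interpret Q: primeideal Q R using Q unfolding basic_open_def by blast
      have QV: "Q \<in> V" "k \<notin> Q" using Q k basic_open_mult[OF k(1) V(5)] unfolding basic_open_def by auto
      have "frac_at R Q a s = frac_at R Q (k \<otimes> a) (k \<otimes> s)"
        using frac_at_eq_iff[OF Q.primeideal, of a "k \<otimes> a" s "k \<otimes> s"] V(4,5) V(6)[OF QV(1)] k(1) QV
          Q.diff_mult_closed[of k s] Q.one_diff by (auto simp: m_ac intro!: bexI[of _ \<one>])
      then show ?thesis using V(6)[OF QV(1)] by simp
    qed
    moreover have "?D (k \<otimes> s) = ?D k"
      using basic_open_mult[OF k(1) V(5)] k(3) V(6) V(1) openin_subset[OF V(1)] topspace_zariski
      unfolding basic_open_def by blast
    ultimately have "k \<otimes> s \<in> H" "P \<in> ?D (k \<otimes> s)" unfolding H_def using k V(3-5) by auto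
    then show ?thesis by blast
  qed
  have "\<forall>h\<in>H. \<exists>a. a \<in> carrier R \<and> (\<forall>Q\<in>?D h. \<xi> Q = frac_at R Q a h)" unfolding H_def by blast
  from bchoice[OF this]
  obtain \<alpha> where "\<forall>h\<in>H. \<alpha> h \<in> carrier R \<and> (\<forall>Q\<in>?D h. \<xi> Q = frac_at R Q (\<alpha> h) h)" ..
  then have \<alpha>: "\<And>h. h \<in> H \<Longrightarrow> \<alpha> h \<in> carrier R"
    "\<And>h Q. h \<in> H \<Longrightarrow> Q \<in> ?D h \<Longrightarrow> \<xi> Q = frac_at R Q (\<alpha> h) h" by blast+
  have HR: "h \<in> carrier R" if "h \<in> H" for h using that unfolding H_def by blast
  have cov: "\<not> H \<subseteq> P" if P: "primeideal P R" "f \<notin> P" for P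
  proof -
    have "P \<in> ?D f" using P unfolding basic_open_def by simp
    then show ?thesis using H unfolding basic_open_def by blast
  qed
  have "H \<subseteq> carrier R" using HR by blast
  then obtain F where F: "finite F" "F \<subseteq> H" "\<And>P. primeideal P R \<Longrightarrow> f \<notin> P \<Longrightarrow> \<not> F \<subseteq> P"
    using basic_open_quasi_compact[OF f, of H] cov by metis
  \<comment> \<open>\<open>good x c P\<close> says that \<open>x\<close> times
    \<open>\<xi> P\<close> equals c/1 in the localization at \<open>P\<close>. It is phrased with
    representatives so that no computation inside the localization is needed.\<close>
  define good where "good x c P \<longleftrightarrow> (\<exists>b t u. b \<in> carrier R \<and> t \<in> carrier R - P \<and>
      \<xi> P = frac_at R P b t \<and> u \<in> carrier R - P \<and> u \<otimes> (x \<otimes> b) = u \<otimes> (t \<otimes> c))" for x c P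
  have goodI: "good x c P" if "b \<in> carrier R" "t \<in> carrier R - P" "\<xi> P = frac_at R P b t"
    "u \<in> carrier R - P" "u \<otimes> (x \<otimes> b) = u \<otimes> (t \<otimes> c)" for x c P b t u
    using that unfolding good_def by blast
  \<comment> \<open>The ideal of denominators: \<open>x\<close> belongs to it if \<open>x\<close>
    times \<open>\<xi>\<close> is a single ring element \<open>c\<close> over all of D(f). The goal
    is a power of \<open>f\<close> in \<open>J\<close>.\<close>
  define J where "J = {x \<in> carrier R. \<exists>c\<in>carrier R. \<forall>P\<in>?D f. good x c P}"
  have J_I: "x \<in> J" if "x \<in> carrier R" "c \<in> carrier R" "\<And>P. P \<in> ?D f \<Longrightarrow> good x c P" for x c
    using that unfolding J_def by blast
  have J_pow: "\<exists>n::nat. h [^] n \<in> J" if h: "h \<in> H" for h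
  proof -
    \<comment> \<open>The expressions for \<open>\<xi>\<close> on D(h) and on D(k) agree on D(hk),
      hence after multiplication by a power of \<open>h \<otimes> k\<close>. Since \<open>F\<close>
      is finite, one exponent \<open>N\<close> works for all \<open>k\<close> in
      \<open>F\<close>.\<close>
    have "\<exists>n::nat. \<forall>m\<ge>n. (h \<otimes> k) [^] m \<otimes> (k \<otimes> \<alpha> h) = (h \<otimes> k) [^] m \<otimes> (h \<otimes> \<alpha> k)" if k: "k \<in> F" for k
    proof -
      have kH: "k \<in> H" using k F by blast
      note c = HR[OF h] HR[OF kH] \<alpha>(1)[OF h] \<alpha>(1)[OF kH]
      have "\<exists>n::nat. (h \<otimes> k) [^] n \<otimes> (k \<otimes> \<alpha> h) = (h \<otimes> k) [^] n \<otimes> (h \<otimes> \<alpha> k)"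
      proof (rule frac_eq_on_basic_open)
        fix P assume "P \<in> ?D (h \<otimes> k)"
        then have P: "P \<in> ?D h" "P \<in> ?D k" using basic_open_mult c by auto
        then show "h \<notin> P \<and> k \<notin> P" unfolding basic_open_def by blast
        show "frac_at R P (\<alpha> h) h = frac_at R P (\<alpha> k) k"
          using \<alpha>(2)[OF h P(1)] \<alpha>(2)[OF kH P(2)] by simp
      qed (use c in auto)
      then obtain n :: nat where n: "(h \<otimes> k) [^] n \<otimes> (k \<otimes> \<alpha> h) = (h \<otimes> k) [^] n \<otimes> (h \<otimes> \<alpha> k)" ..
      have "(h \<otimes> k) [^] m \<otimes> (k \<otimes> \<alpha> h) = (h \<otimes> k) [^] m \<otimes> (h \<otimes> \<alpha> k)" if "m \<ge> n" for m
      proof -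
        have m: "(h \<otimes> k) [^] m = (h \<otimes> k) [^] (m - n) \<otimes> (h \<otimes> k) [^] n"
          using that c by (simp add: nat_pow_mult)
        show ?thesis unfolding m using n c by (simp add: m_assoc)
      qed
      then show ?thesis by blast
    qed
    note uniform = finite_uniform_exponent[OF F(1) this]
    obtain N :: nat where "\<And>k m. k \<in> F \<Longrightarrow> N \<le> m \<Longrightarrow> (h \<otimes> k) [^] m \<otimes> (k \<otimes> \<alpha> h) = (h \<otimes> k) [^] m \<otimes> (h \<otimes> \<alpha> k)"
      by (rule uniform, assumption) blast
    then have N: "\<And>k. k \<in> F \<Longrightarrow> (h \<otimes> k) [^] N \<otimes> (k \<otimes> \<alpha> h) = (h \<otimes> k) [^] N \<otimes> (h \<otimes> \<alpha> k)" by simp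
    \<comment> \<open>The numerator is \<open>h [^] N \<otimes> \<alpha> h\<close>: the factor
      \<open>h [^] N\<close> absorbs the \<open>h\<close>-part of the multiplier
      \<open>(h \<otimes> k) [^] N\<close>, and the remaining \<open>k [^] N\<close> lies outside
      \<open>P\<close>.\<close>
    have "h [^] Suc N \<in> J"
    proof (rule J_I)
      show "h [^] Suc N \<in> carrier R" "h [^] N \<otimes> \<alpha> h \<in> carrier R" using HR[OF h] \<alpha>(1)[OF h] by auto
      fix P assume P: "P \<in> ?D f"
      then interpret P: primeideal P R unfolding basic_open_def by blast
      obtain k where k: "k \<in> F" "k \<notin> P" using F(3)[OF P.primeideal] P unfolding basic_open_def by blast
      have kH: "k \<in> H" using k F by blast
      note c = HR[OF h] HR[OF kH] \<alpha>(1)[OF h] \<alpha>(1)[OF kH]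
      have \<xi>P: "\<xi> P = frac_at R P (\<alpha> k) k"
        using \<alpha>(2)[OF kH, of P] k(2) P.primeideal unfolding basic_open_def by simp
      have "k [^] N \<otimes> (h [^] Suc N \<otimes> \<alpha> k) = (h \<otimes> k) [^] N \<otimes> (h \<otimes> \<alpha> k)"
        using c by (simp add: nat_pow_distrib m_ac)
      also have "\<dots> = k [^] N \<otimes> (k \<otimes> (h [^] N \<otimes> \<alpha> h))"
        unfolding N[OF k(1), symmetric] using c by (simp add: nat_pow_distrib m_ac)
      finally have eq: "k [^] N \<otimes> (h [^] Suc N \<otimes> \<alpha> k) = k [^] N \<otimes> (k \<otimes> (h [^] N \<otimes> \<alpha> h))" .
      have "k \<in> carrier R - P" using k(2) c(2) by simp
      then show "good (h [^] Suc N) (h [^] N \<otimes> \<alpha> h) P"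
        using goodI[OF c(4) _ \<xi>P P.diff_pow_closed eq] by blast
    qed
    then show ?thesis by blast
  qed
  have "ideal J R"
  proof (intro idealI[OF ring_axioms] add.subgroupI)
    show "J \<subseteq> carrier R" unfolding J_def by blast
    have repr: "\<exists>b t. b \<in> carrier R \<and> t \<in> carrier R - P \<and> \<xi> P = frac_at R P b t" if P: "P \<in> ?D f" for P
    proof -
      obtain h where h: "h \<in> H" "P \<in> ?D h" using H[OF P] by blast
      then show ?thesis using \<alpha>(1)[OF h(1)] \<alpha>(2)[OF h] HR[OF h(1)]
        by (intro exI[of _ "\<alpha> h"] exI[of _ h]) (simp add: basic_open_def)
    qed
    have "\<zero> \<in> J"
    proof (rule J_I[of _ \<zero>])
      fix P assume P: "P \<in> ?D f"
      then interpret P: primeideal P R unfolding basic_open_def by blast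
      obtain b t where bt: "b \<in> carrier R" "t \<in> carrier R - P" "\<xi> P = frac_at R P b t" using repr[OF P] by blast
      show "good \<zero> \<zero> P" by (rule goodI[OF bt P.one_diff]) (use bt(1,2) in simp)
    qed auto
    then show "J \<noteq> {}" by blast
    have mult: "y \<otimes> x \<in> J" if x: "x \<in> J" and y: "y \<in> carrier R" for x y
    proof -
      obtain c where c: "x \<in> carrier R" "c \<in> carrier R" and c': "\<And>P. P \<in> ?D f \<Longrightarrow> good x c P"
        using x unfolding J_def by blast
      show ?thesis
      proof (rule J_I[of _ "y \<otimes> c"])
        fix P assume P: "P \<in> ?D f"
        then obtain b t u where bt: "b \<in> carrier R" "t \<in> carrier R - P" "\<xi> P = frac_at R P b t"
          "u \<in> carrier R - P" "u \<otimes> (x \<otimes> b) = u \<otimes> (t \<otimes> c)" using c'[OF P] unfolding good_def by blast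
        have "u \<otimes> (y \<otimes> x \<otimes> b) = y \<otimes> (u \<otimes> (x \<otimes> b))" using bt(1,2,4) c y by (simp add: m_ac)
        also have "\<dots> = u \<otimes> (t \<otimes> (y \<otimes> c))" unfolding bt(5) using bt(1,2,4) c y by (simp add: m_ac)
        finally show "good (y \<otimes> x) (y \<otimes> c) P" by (rule goodI[OF bt(1-4)])
      qed (use c y in auto)
    qed
    show "y \<otimes> x \<in> J" "x \<otimes> y \<in> J" if "x \<in> J" "y \<in> carrier R" for x y
      using mult[OF that] that m_comm[of x y] \<open>J \<subseteq> carrier R\<close> by auto
    show "\<ominus> x \<in> J" if "x \<in> J" for x
    proof -
      have "\<ominus> x = (\<ominus> \<one>) \<otimes> x" using that \<open>J \<subseteq> carrier R\<close> by (simp add: l_minus subset_iff)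
      then show ?thesis using mult[OF that, of "\<ominus> \<one>"] by simp
    qed
    show "x \<oplus> y \<in> J" if x: "x \<in> J" and y: "y \<in> J" for x y
    proof -
      obtain c where c: "x \<in> carrier R" "c \<in> carrier R" and c': "\<And>P. P \<in> ?D f \<Longrightarrow> good x c P"
        using x unfolding J_def by blast
      obtain d where d: "y \<in> carrier R" "d \<in> carrier R" and d': "\<And>P. P \<in> ?D f \<Longrightarrow> good y d P"
        using y unfolding J_def by blast
      have "x \<oplus> y \<in> J"
      proof (rule J_I[of _ "c \<oplus> d"])
        fix P assume P: "P \<in> ?D f"
        then interpret P: primeideal P R unfolding basic_open_def by blast
        obtain b t u where bt: "b \<in> carrier R" "t \<in> carrier R - P" "\<xi> P = frac_at R P b t"
          "u \<in> carrier R - P" "u \<otimes> (x \<otimes> b) = u \<otimes> (t \<otimes> c)" using c'[OF P] unfolding good_def by blast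
        obtain b' t' u' where bt': "b' \<in> carrier R" "t' \<in> carrier R - P" "\<xi> P = frac_at R P b' t'"
          "u' \<in> carrier R - P" "u' \<otimes> (y \<otimes> b') = u' \<otimes> (t' \<otimes> d)" using d'[OF P] unfolding good_def by blast
        obtain v where v: "v \<in> carrier R - P" "v \<otimes> (t' \<otimes> b) = v \<otimes> (t \<otimes> b')"
          using frac_at_eq_iff[OF P.primeideal bt(1) bt'(1) bt(2) bt'(2)] bt(3) bt'(3) by auto
        \<comment> \<open>\<open>u\<close> and \<open>u'\<close> are the multipliers of the two
          given relations, and \<open>v\<close> identifies the representatives b/t and b'/t' of
          \<open>\<xi> P\<close>. The factor \<open>t'\<close> is needed to replace the first
          representative by the second in the term with \<open>y\<close>.\<close>
        let ?w = "v \<otimes> u \<otimes> u' \<otimes> t'"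
        have "?w \<otimes> ((x \<oplus> y) \<otimes> b)
            = (v \<otimes> u' \<otimes> t') \<otimes> (u \<otimes> (x \<otimes> b)) \<oplus> (u \<otimes> u' \<otimes> y) \<otimes> (v \<otimes> (t' \<otimes> b))"
          using bt(1,2,4) bt'(1,2,4) v(1) c d by (simp add: m_ac l_distr r_distr)
        also have "\<dots> = (v \<otimes> u' \<otimes> t') \<otimes> (u \<otimes> (t \<otimes> c)) \<oplus> (u \<otimes> v \<otimes> t) \<otimes> (u' \<otimes> (y \<otimes> b'))"
          unfolding bt(5) v(2) using bt(1,2,4) bt'(1,2,4) v(1) c d by (simp add: m_ac)
        also have "\<dots> = ?w \<otimes> (t \<otimes> (c \<oplus> d))"
          unfolding bt'(5) using bt(1,2,4) bt'(1,2,4) v(1) c d by (simp add: m_ac l_distr r_distr)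
        finally have "?w \<otimes> ((x \<oplus> y) \<otimes> b) = ?w \<otimes> (t \<otimes> (c \<oplus> d))" .
        then show "good (x \<oplus> y) (c \<oplus> d) P"
          by (rule goodI[OF bt(1-3), rotated])
            (intro P.diff_mult_closed v(1) bt(4) bt'(2,4))
      qed (use c d in auto)
      then show ?thesis by simp
    qed
  qed
  moreover have "\<not> J \<subseteq> P" if P: "primeideal P R" "f \<notin> P" for P
  proof -
    obtain h where h: "h \<in> H" "h \<notin> P" using cov[OF P] by blast
    then show ?thesis using J_pow[OF h(1)] primeideal.diff_pow_closed[OF P(1)] HR by blast
  qed
  ultimately obtain n :: nat where "f [^] n \<in> J" using prime_cover_power_mem[OF _ f] by blast
  then obtain c where c: "c \<in> carrier R" and c': "\<And>P. P \<in> ?D f \<Longrightarrow> good (f [^] n) c P"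
    unfolding J_def by blast
  have "\<xi> P = frac_at R P c (f [^] n)" if P: "P \<in> ?D f" for P
  proof -
    interpret P: primeideal P R using P unfolding basic_open_def by blast
    have "f [^] n \<in> carrier R - P" using P f P.diff_pow_closed unfolding basic_open_def by blast
    moreover obtain b t u where bt: "b \<in> carrier R" "t \<in> carrier R - P" "\<xi> P = frac_at R P b t"
      "u \<in> carrier R - P" "u \<otimes> (f [^] n \<otimes> b) = u \<otimes> (t \<otimes> c)" using c'[OF P] unfolding good_def by blast
    ultimately show ?thesis using frac_at_eq_iff[OF P.primeideal bt(1) c bt(2)] by auto
  qed
  then show ?thesis using that c by blast
qed

end

section \<open>Sections of the structure sheaf given by one fraction\<close>

context spectrum
begin

definition frac_sec :: "'r set set \<Rightarrow> 'r \<Rightarrow> 'r \<Rightarrow> 'r set \<Rightarrow> ('r \<times> 'r) set" where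
  "frac_sec V a s = (\<lambda>P\<in>V. frac_at R P a s)"

lemma frac_sec_carrier:
  assumes V: "openin (zariski_topology R) V" and a: "a \<in> carrier R" "s \<in> carrier R"
    and s: "\<And>P. P \<in> V \<Longrightarrow> s \<notin> P"
  shows "frac_sec V a s \<in> carrier (spec_secs R V)"
proof -
  have "frac_at R P a s \<in> carrier (localization_at R P)" if "P \<in> V" for P
    using a s[OF that] unfolding localization_at_def by auto
  moreover have "\<exists>W b t. openin (zariski_topology R) W \<and> P \<in> W \<and> W \<subseteq> V \<and> b \<in> carrier R \<and> t \<in> carrier R \<and>
      (\<forall>Q\<in>W. t \<notin> Q \<and> frac_sec V a s Q = frac_at R Q b t)" if "P \<in> V" for P
    using V a s that by (intro exI[of _ V] exI[of _ a] exI[of _ s]) (simp add: frac_sec_def)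
  ultimately show ?thesis unfolding spec_secs_def by (simp add: frac_sec_def)
qed

lemma frac_sec_mult:
  assumes V: "openin (zariski_topology R) V"
    and c: "a \<in> carrier R" "b \<in> carrier R" "s \<in> carrier R" "t \<in> carrier R"
    and nz: "\<And>P. P \<in> V \<Longrightarrow> s \<notin> P" "\<And>P. P \<in> V \<Longrightarrow> t \<notin> P"
  shows "frac_sec V a s \<otimes>\<^bsub>spec_secs R V\<^esub> frac_sec V b t = frac_sec V (a \<otimes> b) (s \<otimes> t)"
proof -
  have "P \<in> V \<Longrightarrow> primeideal P R" for P using openin_subset[OF V] topspace_zariski by auto
  then show ?thesis unfolding spec_secs_def frac_sec_def
    using c nz localization_mult by (auto intro!: restrict_ext)
qed

lemma frac_sec_add:
  assumes V: "openin (zariski_topology R) V"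
    and c: "a \<in> carrier R" "b \<in> carrier R" "s \<in> carrier R" "t \<in> carrier R"
    and nz: "\<And>P. P \<in> V \<Longrightarrow> s \<notin> P" "\<And>P. P \<in> V \<Longrightarrow> t \<notin> P"
  shows "frac_sec V a s \<oplus>\<^bsub>spec_secs R V\<^esub> frac_sec V b t = frac_sec V (a \<otimes> t \<oplus> b \<otimes> s) (s \<otimes> t)"
proof -
  have "P \<in> V \<Longrightarrow> primeideal P R" for P using openin_subset[OF V] topspace_zariski by auto
  then show ?thesis unfolding spec_secs_def frac_sec_def
    using c nz localization_add by (auto intro!: restrict_ext)
qed

lemma frac_sec_one: "\<one>\<^bsub>spec_secs R V\<^esub> = frac_sec V \<one> \<one>"
  unfolding spec_secs_def frac_sec_def localization_at_def by simp

lemma frac_sec_cong: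
  assumes V: "openin (zariski_topology R) V"
    and c: "a \<in> carrier R" "b \<in> carrier R" "s \<in> carrier R" "t \<in> carrier R"
    and nz: "\<And>P. P \<in> V \<Longrightarrow> s \<notin> P" "\<And>P. P \<in> V \<Longrightarrow> t \<notin> P" and eq: "t \<otimes> a = s \<otimes> b"
  shows "frac_sec V a s = frac_sec V b t"
proof -
  have "frac_at R P a s = frac_at R P b t" if P: "P \<in> V" for P
  proof -
    have "primeideal P R" using P openin_subset[OF V] topspace_zariski by auto
    then show ?thesis using frac_at_eq_iff[of P a b s t] c nz[OF P] eq primeideal.one_diff by auto
  qed
  then show ?thesis unfolding frac_sec_def by (rule restrict_ext)
qed

lemma section_over_basic_open_eq_frac_sec:
  assumes "f \<in> carrier R" "\<xi> \<in> carrier (spec_secs R (basic_open R f))"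
  obtains a n where "a \<in> carrier R" "\<xi> = frac_sec (basic_open R f) a (f [^] (n::nat))"
proof -
  obtain a and n :: nat where an: "a \<in> carrier R"
    "\<And>P. P \<in> basic_open R f \<Longrightarrow> \<xi> P = frac_at R P a (f [^] n)"
    using section_over_basic_open[OF assms] by metis
  have "\<xi> \<in> extensional (basic_open R f)" using assms(2) unfolding spec_secs_def by (auto simp: PiE_def)
  then have "\<xi> = frac_sec (basic_open R f) a (f [^] n)"
    using an(2) unfolding frac_sec_def by (intro ext) (auto simp: extensional_def)
  then show ?thesis using that an(1) by blast
qed

text \<open>Injectivity of the localization at \<open>f\<close> into the sections over D(f):
  pointwise equality of fractions becomes equality up to one power of \<open>f\<close>.\<close>

lemma frac_sec_basic_open_eqD:
  assumes c: "f \<in> carrier R" "a \<in> carrier R" "b \<in> carrier R"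
    and eq: "frac_sec (basic_open R f) a \<one> = frac_sec (basic_open R f) b \<one>"
  shows "\<exists>n::nat. f [^] n \<otimes> a = f [^] n \<otimes> b"
proof -
  have "\<exists>n::nat. f [^] n \<otimes> (\<one> \<otimes> a) = f [^] n \<otimes> (\<one> \<otimes> b)"
  proof (rule frac_eq_on_basic_open)
    show "\<one> \<notin> P \<and> \<one> \<notin> P" if "P \<in> basic_open R f" for P
      using that primeideal.one_diff unfolding basic_open_def by blast
    show "frac_at R P a \<one> = frac_at R P b \<one>" if "P \<in> basic_open R f" for P
      using fun_cong[OF eq, of P] that unfolding frac_sec_def by simp
  qed (use c in auto)
  then show ?thesis using c by simp
qed

end

section \<open>Affine open sets\<close>

text \<open>The open sets \<open>D h\<close> of an affine open set play the role of the basic open sets; the axioms \<open>frac\<close>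
  and \<open>kill\<close> say that the sections over \<open>D h\<close> form the localization at \<open>h\<close>.\<close>

locale affine_chart = ringed_space Y for Y :: "('x, 'r) ringed_space" +
  fixes U :: "'x set" and D :: "'r \<Rightarrow> 'x set"
  assumes U_open: "openin (pts Y) U"
    and D_open: "h \<in> carrier (secs Y U) \<Longrightarrow> openin (pts Y) (D h)"
    and D_subset: "h \<in> carrier (secs Y U) \<Longrightarrow> D h \<subseteq> U"
    and D_mult: "\<lbrakk>h \<in> carrier (secs Y U); k \<in> carrier (secs Y U)\<rbrakk> \<Longrightarrow> D (h \<otimes>\<^bsub>secs Y U\<^esub> k) = D h \<inter> D k"
    and D_basis: "\<lbrakk>openin (pts Y) V; V \<subseteq> U; x \<in> V\<rbrakk> \<Longrightarrow> \<exists>h\<in>carrier (secs Y U). x \<in> D h \<and> D h \<subseteq> V"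
    and D_unit: "h \<in> carrier (secs Y U) \<Longrightarrow> restr Y U (D h) h \<in> Units (secs Y (D h))"
    and frac: "\<lbrakk>h \<in> carrier (secs Y U); s \<in> carrier (secs Y (D h))\<rbrakk> \<Longrightarrow>
      \<exists>(n::nat) a. a \<in> carrier (secs Y U) \<and>
        restr Y U (D h) (h [^]\<^bsub>secs Y U\<^esub> n) \<otimes>\<^bsub>secs Y (D h)\<^esub> s = restr Y U (D h) a"
    and kill: "\<lbrakk>h \<in> carrier (secs Y U); a \<in> carrier (secs Y U); restr Y U (D h) a = \<zero>\<^bsub>secs Y (D h)\<^esub>\<rbrakk>
      \<Longrightarrow> \<exists>n::nat. h [^]\<^bsub>secs Y U\<^esub> n \<otimes>\<^bsub>secs Y U\<^esub> a = \<zero>\<^bsub>secs Y U\<^esub>"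
    and quasi_compact: "\<lbrakk>H \<subseteq> carrier (secs Y U); \<And>x. x \<in> U \<Longrightarrow> \<exists>h\<in>H. x \<in> D h\<rbrakk> \<Longrightarrow>
      \<exists>F\<subseteq>H. finite F \<and> (\<forall>x\<in>U. \<exists>h\<in>F. x \<in> D h)"
    and no_common_zero: "\<lbrakk>ideal J (secs Y U); \<And>x. x \<in> U \<Longrightarrow> \<exists>h\<in>J. x \<in> D h\<rbrakk> \<Longrightarrow> J = carrier (secs Y U)"

text \<open>Everything is transported from \<open>Spec R\<close>. The ring \<open>R\<close> is
  recovered from its sheaf as the ring of global sections, so the sets \<open>D h\<close> can be
  indexed by sections over \<open>U\<close> and neither \<open>R\<close> nor the isomorphism is
  mentioned afterwards.\<close>

lemma (in ringed_space) affine_open_imp_affine_chart: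
  assumes "affine_open Y U"
  obtains D where "affine_chart Y U D"
proof -
  have U: "openin (pts Y) U" using assms unfolding affine_open_def by blast
  obtain R :: "'r ring" and g \<psi> where R: "cring R" and iso: "ringed_space_iso (open_subspace Y U) (Spec R) g \<psi>"
    using assms unfolding affine_open_def affine_scheme_def by blast
  interpret spectrum R using R by (simp add: spectrum_def)
  interpret O: cring "secs Y U" using secs_cring[OF U] .
  let ?Z = "zariski_topology R" and ?pre = "\<lambda>V. U \<inter> g -` V"
  let ?T = "topspace ?Z"
  have top: "topspace (subtopology (pts Y) U) = U" using openin_subset[OF U] by auto
  have sub: "pts (open_subspace Y U) = subtopology (pts Y) U" "secs (open_subspace Y U) = secs Y"
    "restr (open_subspace Y U) = restr Y" unfolding open_subspace_def by auto
  have Spec: "pts (Spec R) = ?Z" "secs (Spec R) = spec_secs R" "restr (Spec R) = (\<lambda>U V \<xi>. restrict \<xi> V)"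
    unfolding Spec_def by auto
  have homeo: "homeomorphic_map (subtopology (pts Y) U) ?Z g"
    using iso unfolding ringed_space_iso_def sub Spec by blast
  have \<psi>: "\<psi> V \<in> ring_iso (spec_secs R V) (secs Y (?pre V))" if "openin ?Z V" for V
    using iso that unfolding ringed_space_iso_def sub Spec top by blast
  have \<psi>_restr: "\<psi> W (restrict \<xi> W) = restr Y (?pre V) (?pre W) (\<psi> V \<xi>)"
    if "openin ?Z V" "openin ?Z W" "W \<subseteq> V" "\<xi> \<in> carrier (spec_secs R V)" for V W \<xi>
    using iso that unfolding ringed_space_iso_def sub Spec top by blast
  have img: "g ` U = ?T" using homeomorphic_imp_surjective_map[OF homeo] top by simp
  have pre_top: "?pre ?T = U" using img by blast
  have pre_open: "openin (pts Y) (?pre V)" if "openin ?Z V" for V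
  proof -
    have "openin (subtopology (pts Y) U) {x \<in> topspace (subtopology (pts Y) U). g x \<in> V}"
      using homeomorphic_imp_continuous_map[OF homeo] that unfolding continuous_map_def by blast
    moreover have "{x \<in> topspace (subtopology (pts Y) U). g x \<in> V} = ?pre V" unfolding top by blast
    ultimately show ?thesis using openin_open_subtopology[OF U] by simp
  qed
  have openT: "openin ?Z ?T" by simp
  have one_notin: "\<one>\<^bsub>R\<^esub> \<notin> P" if "P \<in> ?T" for P
    using that primeideal.one_diff topspace_zariski by blast
  have basic_top: "basic_open R \<one>\<^bsub>R\<^esub> = ?T" using basic_open_one topspace_zariski by simp
  have secT: "frac_sec ?T a \<one>\<^bsub>R\<^esub> \<in> carrier (spec_secs R ?T)" if "a \<in> carrier R" for a
    using frac_sec_carrier[OF openT that _ one_notin] by simp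
  \<comment> \<open>The identification of \<open>R\<close> with the sections over \<open>U\<close>:
    an element \<open>a\<close> goes to the transported fraction a/1. Its inverse is
    \<open>\<kappa>\<close> below.\<close>
  define \<iota> where "\<iota> a = \<psi> ?T (frac_sec ?T a \<one>\<^bsub>R\<^esub>)" for a
  have \<psi>T: "\<psi> ?T \<in> ring_iso (spec_secs R ?T) (secs Y U)" using \<psi>[OF openT] pre_top by simp
  have \<iota>_restr: "restr Y U (?pre W) (\<iota> a) = \<psi> W (frac_sec W a \<one>\<^bsub>R\<^esub>)"
    if "openin ?Z W" "a \<in> carrier R" for W a
  proof -
    have W: "W \<subseteq> ?T" using openin_subset[OF that(1)] .
    have "restrict (frac_sec ?T a \<one>\<^bsub>R\<^esub>) W = frac_sec W a \<one>\<^bsub>R\<^esub>"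
      unfolding frac_sec_def using W by (simp add: Int_absorb1)
    then show ?thesis using \<psi>_restr[OF openT that(1) W secT[OF that(2)]] pre_top unfolding \<iota>_def by simp
  qed
  have \<iota>: "\<iota> \<in> ring_iso R (secs Y U)"
  proof (rule ring_iso_memI)
    fix a b assume ab: "a \<in> carrier R" "b \<in> carrier R"
    show "\<iota> a \<in> carrier (secs Y U)" using ring_iso_memE(1)[OF \<psi>T secT[OF ab(1)]] unfolding \<iota>_def .
    show "\<iota> (a \<otimes>\<^bsub>R\<^esub> b) = \<iota> a \<otimes>\<^bsub>secs Y U\<^esub> \<iota> b"
      using ring_iso_memE(2)[OF \<psi>T secT[OF ab(1)] secT[OF ab(2)]]
        frac_sec_mult[OF openT ab one_closed one_closed one_notin one_notin] unfolding \<iota>_def by simp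
    show "\<iota> (a \<oplus>\<^bsub>R\<^esub> b) = \<iota> a \<oplus>\<^bsub>secs Y U\<^esub> \<iota> b"
      using ring_iso_memE(3)[OF \<psi>T secT[OF ab(1)] secT[OF ab(2)]] ab
        frac_sec_add[OF openT ab one_closed one_closed one_notin one_notin] unfolding \<iota>_def by simp
  next
    show "\<iota> \<one>\<^bsub>R\<^esub> = \<one>\<^bsub>secs Y U\<^esub>" using ring_iso_memE(4)[OF \<psi>T] frac_sec_one unfolding \<iota>_def by simp
    have bij: "bij_betw (\<psi> ?T) (carrier (spec_secs R ?T)) (carrier (secs Y U))" using ring_iso_memE(5)[OF \<psi>T] .
    show "bij_betw \<iota> (carrier R) (carrier (secs Y U))"
      unfolding bij_betw_def
    proof
      show "inj_on \<iota> (carrier R)"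
      proof (rule inj_onI)
        fix a b assume ab: "a \<in> carrier R" "b \<in> carrier R" "\<iota> a = \<iota> b"
        \<comment> \<open>Both injectivity and surjectivity of \<open>\<iota>\<close> are the
          results on D(f) for \<open>f = \<one>\<close>: D(1) is the whole spectrum and powers of 1
          are trivial as multipliers and denominators.\<close>
        have "frac_sec ?T a \<one>\<^bsub>R\<^esub> = frac_sec ?T b \<one>\<^bsub>R\<^esub>"
          using ab inj_onD[OF bij_betw_imp_inj_on[OF bij]] secT unfolding \<iota>_def by metis
        then show "a = b" using frac_sec_basic_open_eqD[of "\<one>\<^bsub>R\<^esub>" a b] ab basic_top by auto
      qed
      have "\<exists>a\<in>carrier R. y = \<iota> a" if y: "y \<in> carrier (secs Y U)" for y
      proof -
        obtain \<xi> where \<xi>: "\<xi> \<in> carrier (spec_secs R ?T)" "y = \<psi> ?T \<xi>"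
          using bij y unfolding bij_betw_def by blast
        then obtain a and n :: nat where "a \<in> carrier R" "\<xi> = frac_sec ?T a (\<one>\<^bsub>R\<^esub> [^]\<^bsub>R\<^esub> n)"
          using section_over_basic_open_eq_frac_sec[OF one_closed] unfolding basic_top by metis
        then show ?thesis using \<xi>(2) unfolding \<iota>_def by auto
      qed
      then show "\<iota> ` carrier R = carrier (secs Y U)"
        using ring_iso_memE(1)[OF \<psi>T secT] unfolding \<iota>_def by blast
    qed
  qed
  define \<kappa> where "\<kappa> = inv_into (carrier R) \<iota>"
  have bij\<iota>: "bij_betw \<iota> (carrier R) (carrier (secs Y U))" using ring_iso_memE(5)[OF \<iota>] .
  have \<kappa>_carrier: "\<kappa> h \<in> carrier R" and \<iota>\<kappa>: "\<iota> (\<kappa> h) = h" if "h \<in> carrier (secs Y U)" for h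
    using bij\<iota> that unfolding \<kappa>_def bij_betw_def by (auto simp: inv_into_into f_inv_into_f)
  have \<kappa>\<iota>: "\<kappa> (\<iota> a) = a" if "a \<in> carrier R" for a
    using bij\<iota> that unfolding \<kappa>_def bij_betw_def by simp
  have \<kappa>_mult: "\<kappa> (h \<otimes>\<^bsub>secs Y U\<^esub> k) = \<kappa> h \<otimes>\<^bsub>R\<^esub> \<kappa> k"
    if "h \<in> carrier (secs Y U)" "k \<in> carrier (secs Y U)" for h k
  proof -
    have "\<iota> (\<kappa> h \<otimes>\<^bsub>R\<^esub> \<kappa> k) = h \<otimes>\<^bsub>secs Y U\<^esub> k"
      using ring_iso_memE(2)[OF \<iota>, of "\<kappa> h" "\<kappa> k"] \<kappa>_carrier \<iota>\<kappa> that by simp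
    then show ?thesis using \<kappa>\<iota>[of "\<kappa> h \<otimes>\<^bsub>R\<^esub> \<kappa> k"] \<kappa>_carrier that by simp
  qed
  interpret \<iota>: ring_hom_ring R "secs Y U" \<iota>
    using ring_hom_ringI2[OF ring_axioms O.ring_axioms] \<iota> unfolding ring_iso_def by blast
  define D where "D h = ?pre (basic_open R (\<kappa> h))" for h
  have Wopen: "openin ?Z (basic_open R (\<kappa> h))" if "h \<in> carrier (secs Y U)" for h
    using openin_basic_open[OF \<kappa>_carrier[OF that]] .
  have W_notin: "\<kappa> h \<notin> P" "\<one>\<^bsub>R\<^esub> \<notin> P" "\<kappa> h [^]\<^bsub>R\<^esub> (n::nat) \<notin> P"
    if "h \<in> carrier (secs Y U)" "P \<in> basic_open R (\<kappa> h)" for h P n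
    using that \<kappa>_carrier[OF that(1)] primeideal.one_diff primeideal.diff_pow_closed[of P R "\<kappa> h" n]
    unfolding basic_open_def by auto
  have \<psi>W: "\<psi> (basic_open R (\<kappa> h)) \<in> ring_iso (spec_secs R (basic_open R (\<kappa> h))) (secs Y (D h))"
    if "h \<in> carrier (secs Y U)" for h
    using \<psi>[OF Wopen[OF that]] unfolding D_def .
  have \<iota>D: "restr Y U (D h) (\<iota> a) = \<psi> (basic_open R (\<kappa> h)) (frac_sec (basic_open R (\<kappa> h)) a \<one>\<^bsub>R\<^esub>)"
    if "h \<in> carrier (secs Y U)" "a \<in> carrier R" for h a
    using \<iota>_restr[OF Wopen[OF that(1)] that(2)] unfolding D_def .
  have primeg: "primeideal (g x) R" if "x \<in> U" for x using img that topspace_zariski by blast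
  have D_iff: "x \<in> D h \<longleftrightarrow> x \<in> U \<and> \<kappa> h \<notin> g x" for x h
    unfolding D_def basic_open_def using primeg by blast
  have "affine_chart Y U D"
  proof (intro affine_chart.intro affine_chart_axioms.intro ringed_space_axioms U)
    fix h assume h: "h \<in> carrier (secs Y U)"
    let ?W = "basic_open R (\<kappa> h)"
    note k = \<kappa>_carrier[OF h]
    show Dh: "openin (pts Y) (D h)" using pre_open[OF Wopen[OF h]] unfolding D_def .
    show DU: "D h \<subseteq> U" unfolding D_def by blast
    show "D (h \<otimes>\<^bsub>secs Y U\<^esub> l) = D h \<inter> D l" if "l \<in> carrier (secs Y U)" for l
      unfolding D_def \<kappa>_mult[OF h that] basic_open_mult[OF k \<kappa>_carrier[OF that]] by blast
    have car: "frac_sec ?W a s \<in> carrier (spec_secs R ?W)"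
      if "a \<in> carrier R" "s \<in> carrier R" "\<And>P. P \<in> ?W \<Longrightarrow> s \<notin> P" for a s
      using frac_sec_carrier[OF Wopen[OF h] that(1,2)] that(3) by blast
    interpret Oh: cring "secs Y (D h)" using secs_cring[OF Dh] .
    show "restr Y U (D h) h \<in> Units (secs Y (D h))"
    proof -
      have "frac_sec ?W (\<kappa> h) \<one>\<^bsub>R\<^esub> \<otimes>\<^bsub>spec_secs R ?W\<^esub> frac_sec ?W \<one>\<^bsub>R\<^esub> (\<kappa> h) = frac_sec ?W (\<kappa> h) (\<kappa> h)"
        using frac_sec_mult[OF Wopen[OF h] k one_closed one_closed k] W_notin[OF h] k by simp
      also have "\<dots> = \<one>\<^bsub>spec_secs R ?W\<^esub>"
        unfolding frac_sec_one using frac_sec_cong[OF Wopen[OF h] k one_closed k one_closed] W_notin[OF h] k by simp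
      finally have "\<psi> ?W (frac_sec ?W (\<kappa> h) \<one>\<^bsub>R\<^esub>) \<otimes>\<^bsub>secs Y (D h)\<^esub> \<psi> ?W (frac_sec ?W \<one>\<^bsub>R\<^esub> (\<kappa> h)) = \<one>\<^bsub>secs Y (D h)\<^esub>"
        using ring_iso_memE(2)[OF \<psi>W[OF h] car car, of "\<kappa> h" "\<one>\<^bsub>R\<^esub>" "\<one>\<^bsub>R\<^esub>" "\<kappa> h"] ring_iso_memE(4)[OF \<psi>W[OF h]]
          W_notin[OF h] k by simp
      moreover have "\<psi> ?W (frac_sec ?W (\<kappa> h) \<one>\<^bsub>R\<^esub>) = restr Y U (D h) h" using \<iota>D[OF h k] \<iota>\<kappa>[OF h] by simp
      moreover have "restr Y U (D h) h \<in> carrier (secs Y (D h))" using restr_closed[OF U Dh DU h] .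
      moreover have "\<psi> ?W (frac_sec ?W \<one>\<^bsub>R\<^esub> (\<kappa> h)) \<in> carrier (secs Y (D h))"
        using ring_iso_memE(1)[OF \<psi>W[OF h] car] W_notin(1)[OF h] k by simp
      ultimately show ?thesis using Oh.unit_factor Oh.Units_one_closed by metis
    qed
    show "\<exists>(n::nat) a. a \<in> carrier (secs Y U) \<and>
        restr Y U (D h) (h [^]\<^bsub>secs Y U\<^esub> n) \<otimes>\<^bsub>secs Y (D h)\<^esub> s = restr Y U (D h) a"
      if s: "s \<in> carrier (secs Y (D h))" for s
    proof -
      obtain \<xi> where \<xi>: "\<xi> \<in> carrier (spec_secs R ?W)" "s = \<psi> ?W \<xi>"
        using ring_iso_memE(5)[OF \<psi>W[OF h]] s unfolding bij_betw_def by blast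
      obtain a and n :: nat where a: "a \<in> carrier R" "\<xi> = frac_sec ?W a (\<kappa> h [^]\<^bsub>R\<^esub> n)"
        using section_over_basic_open_eq_frac_sec[OF k \<xi>(1)] by metis
      have kn: "\<kappa> h [^]\<^bsub>R\<^esub> n \<in> carrier R" using k by simp
      have "frac_sec ?W (\<kappa> h [^]\<^bsub>R\<^esub> n) \<one>\<^bsub>R\<^esub> \<otimes>\<^bsub>spec_secs R ?W\<^esub> \<xi> = frac_sec ?W (\<kappa> h [^]\<^bsub>R\<^esub> n \<otimes>\<^bsub>R\<^esub> a) (\<kappa> h [^]\<^bsub>R\<^esub> n)"
        unfolding a(2) using frac_sec_mult[OF Wopen[OF h] kn a(1) one_closed kn] W_notin[OF h] kn by simp
      also have "\<dots> = frac_sec ?W a \<one>\<^bsub>R\<^esub>"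
        using frac_sec_cong[OF Wopen[OF h], of "\<kappa> h [^]\<^bsub>R\<^esub> n \<otimes>\<^bsub>R\<^esub> a" a "\<kappa> h [^]\<^bsub>R\<^esub> n" "\<one>\<^bsub>R\<^esub>"]
          W_notin[OF h] kn a(1) by simp
      finally have "\<psi> ?W (frac_sec ?W (\<kappa> h [^]\<^bsub>R\<^esub> n) \<one>\<^bsub>R\<^esub>) \<otimes>\<^bsub>secs Y (D h)\<^esub> s = \<psi> ?W (frac_sec ?W a \<one>\<^bsub>R\<^esub>)"
        using ring_iso_memE(2)[OF \<psi>W[OF h] car \<xi>(1), of "\<kappa> h [^]\<^bsub>R\<^esub> n" "\<one>\<^bsub>R\<^esub>"] W_notin(2)[OF h] kn \<xi>(2) by simp
      then have "restr Y U (D h) (\<iota> (\<kappa> h [^]\<^bsub>R\<^esub> n)) \<otimes>\<^bsub>secs Y (D h)\<^esub> s = restr Y U (D h) (\<iota> a)"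
        using \<iota>D[OF h kn] \<iota>D[OF h a(1)] by simp
      then show ?thesis using \<iota>.hom_nat_pow[OF k, of n] \<iota>\<kappa>[OF h] \<iota>.hom_closed[OF a(1)] by auto
    qed
    show "\<exists>n::nat. h [^]\<^bsub>secs Y U\<^esub> n \<otimes>\<^bsub>secs Y U\<^esub> a = \<zero>\<^bsub>secs Y U\<^esub>"
      if a: "a \<in> carrier (secs Y U)" "restr Y U (D h) a = \<zero>\<^bsub>secs Y (D h)\<^esub>" for a
    proof -
      note ka = \<kappa>_carrier[OF a(1)]
      interpret r: ring_hom_ring "secs Y U" "secs Y (D h)" "restr Y U (D h)"
        using ring_hom_ringI2[OF O.ring_axioms Oh.ring_axioms restr_hom[OF U Dh DU]] .
      have "\<psi> ?W (frac_sec ?W (\<kappa> a) \<one>\<^bsub>R\<^esub>) = \<psi> ?W (frac_sec ?W \<zero>\<^bsub>R\<^esub> \<one>\<^bsub>R\<^esub>)"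
        using \<iota>D[OF h ka] \<iota>D[OF h zero_closed] \<iota>\<kappa>[OF a(1)] a(2) by simp
      then have "frac_sec ?W (\<kappa> a) \<one>\<^bsub>R\<^esub> = frac_sec ?W \<zero>\<^bsub>R\<^esub> \<one>\<^bsub>R\<^esub>"
        using inj_onD[OF bij_betw_imp_inj_on[OF ring_iso_memE(5)[OF \<psi>W[OF h]]] _ car car] W_notin(2)[OF h] ka by simp
      then obtain n :: nat where "\<kappa> h [^]\<^bsub>R\<^esub> n \<otimes>\<^bsub>R\<^esub> \<kappa> a = \<kappa> h [^]\<^bsub>R\<^esub> n \<otimes>\<^bsub>R\<^esub> \<zero>\<^bsub>R\<^esub>"
        using frac_sec_basic_open_eqD[OF k ka zero_closed] by blast
      then have "\<iota> (\<kappa> h [^]\<^bsub>R\<^esub> n \<otimes>\<^bsub>R\<^esub> \<kappa> a) = \<iota> \<zero>\<^bsub>R\<^esub>" using k by simp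
      then show ?thesis using \<iota>\<kappa>[OF h] \<iota>\<kappa>[OF a(1)] k ka by (auto simp: \<iota>.hom_nat_pow)
    qed
  next
    fix V x assume V: "openin (pts Y) V" "V \<subseteq> U" "x \<in> V"
    have "openin (subtopology (pts Y) U) V" using V openin_open_subtopology[OF U] by blast
    then have "openin ?Z (g ` V)" using homeomorphic_imp_open_map[OF homeo] unfolding open_map_def by blast
    then obtain a where a: "a \<in> carrier R" "g x \<in> basic_open R a" "basic_open R a \<subseteq> g ` V"
      using zariski_basis V(3) by blast
    have "D (\<iota> a) \<subseteq> V"
    proof
      fix y assume y: "y \<in> D (\<iota> a)"
      then have "y \<in> U" "g y \<in> g ` V" using a(3) unfolding D_def \<kappa>\<iota>[OF a(1)] by auto
      moreover have "inj_on g U" using homeomorphic_imp_injective_map[OF homeo] top by simp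
      ultimately show "y \<in> V" using V(2) by (auto dest: inj_onD)
    qed
    moreover have "x \<in> D (\<iota> a)" using a V unfolding D_def \<kappa>\<iota>[OF a(1)] by blast
    ultimately show "\<exists>h\<in>carrier (secs Y U). x \<in> D h \<and> D h \<subseteq> V" using \<iota>.hom_closed[OF a(1)] by blast
  next
    fix H assume H: "H \<subseteq> carrier (secs Y U)" and cov: "\<And>x. x \<in> U \<Longrightarrow> \<exists>h\<in>H. x \<in> D h"
    have "\<not> \<kappa> ` H \<subseteq> P" if P: "primeideal P R" for P
    proof -
      obtain x where "x \<in> U" "P = g x" using P img topspace_zariski by blast
      then show ?thesis using cov D_iff by blast
    qed
    moreover have "\<kappa> ` H \<subseteq> carrier R" using H \<kappa>_carrier by blast
    ultimately obtain F where F: "finite F" "F \<subseteq> \<kappa> ` H" "\<And>P. primeideal P R \<Longrightarrow> \<one>\<^bsub>R\<^esub> \<notin> P \<Longrightarrow> \<not> F \<subseteq> P"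
      using basic_open_quasi_compact[OF one_closed, of "\<kappa> ` H"] by metis
    obtain G where G: "G \<subseteq> H" "finite G" "F = \<kappa> ` G" using finite_subset_image[OF F(1,2)] by blast
    have "\<exists>h\<in>G. x \<in> D h" if x: "x \<in> U" for x
      using F(3)[OF primeg[OF x]] primeideal.one_diff[OF primeg[OF x]] x D_iff unfolding G(3) by blast
    then show "\<exists>F\<subseteq>H. finite F \<and> (\<forall>x\<in>U. \<exists>h\<in>F. x \<in> D h)" using G by blast
  next
    fix J assume J: "ideal J (secs Y U)" and cov: "\<And>x. x \<in> U \<Longrightarrow> \<exists>h\<in>J. x \<in> D h"
    interpret J: ideal J "secs Y U" by fact
    have J': "ideal {a \<in> carrier R. \<iota> a \<in> J} R" using \<iota>.ideal_vimage[OF J] .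
    have "\<not> {a \<in> carrier R. \<iota> a \<in> J} \<subseteq> P" if P: "primeideal P R" for P
    proof -
      obtain x where x: "x \<in> U" "P = g x" using P img topspace_zariski by blast
      obtain h where h: "h \<in> J" "\<kappa> h \<notin> P" using cov[OF x(1)] D_iff x(2) by blast
      then have "\<kappa> h \<in> {a \<in> carrier R. \<iota> a \<in> J}" using \<kappa>_carrier \<iota>\<kappa> J.Icarr by simp
      then show ?thesis using h(2) by blast
    qed
    \<comment> \<open>A power of 1 in the preimage of \<open>J\<close> is 1 itself, so
      \<open>J\<close> is the unit ideal.\<close>
    then obtain n :: nat where "\<one>\<^bsub>R\<^esub> [^]\<^bsub>R\<^esub> n \<in> {a \<in> carrier R. \<iota> a \<in> J}"
      using prime_cover_power_mem[OF J' one_closed] by metis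
    then show "J = carrier (secs Y U)" using J.one_imp_carrier by simp
  qed
  then show ?thesis using that by blast
qed

section \<open>Gluing, stalks and the invertibility of \<open>2\<close>\<close>

context sheaf
begin

text \<open>The open sets on which \<open>s\<close> and \<open>t\<close> agree cover
  \<open>U\<close>; both sections solve the same gluing problem, and its solution is unique.\<close>

lemma sections_eqI:
  assumes U: "openin T U" and st: "s \<in> S U" "t \<in> S U"
    and loc: "\<And>x. x \<in> U \<Longrightarrow> \<exists>V. openin T V \<and> x \<in> V \<and> V \<subseteq> U \<and> \<rho> U V s = \<rho> U V t"
  shows "s = t"
proof -
  define C where "C = {V. openin T V \<and> V \<subseteq> U \<and> \<rho> U V s = \<rho> U V t}"
  have CU: "\<Union>C = U" using loc unfolding C_def by blast
  have "\<exists>!u. u \<in> S (\<Union>C) \<and> (\<forall>V\<in>C. \<rho> (\<Union>C) V u = \<rho> U V s)"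
  proof (rule glue)
    show "openin T V" "\<rho> U V s \<in> S V" if "V \<in> C" for V
      using that U st restr_closed unfolding C_def by auto
    show "\<rho> V (V \<inter> W) (\<rho> U V s) = \<rho> W (V \<inter> W) (\<rho> U W s)" if "V \<in> C" "W \<in> C" for V W
    proof -
      have VW: "openin T V" "openin T W" "V \<subseteq> U" "W \<subseteq> U" using that unfolding C_def by auto
      then have "openin T (V \<inter> W)" by blast
      then show ?thesis
        using VW U st(1) restr_trans[of U V "V \<inter> W" s] restr_trans[of U W "V \<inter> W" s] by simp
    qed
  qed
  then have "\<exists>!u. u \<in> S U \<and> (\<forall>V\<in>C. \<rho> U V u = \<rho> U V s)" unfolding CU .
  moreover have "\<forall>V\<in>C. \<rho> U V t = \<rho> U V s" unfolding C_def by auto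
  ultimately show ?thesis using st by blast
qed

text \<open>Compatibility on overlaps is free when the local solutions of \<open>Q\<close> are
  unique and survive restriction. That \<open>Q\<close> holds for the glued section is not claimed,
  since \<open>Q\<close> need not be local; this has to be verified in each application. It produces
  both the inverse of 2 and the trace.\<close>

lemma glue_unique_local:
  assumes U: "openin T U"
    and ex: "\<And>x. x \<in> U \<Longrightarrow> \<exists>V s. openin T V \<and> x \<in> V \<and> V \<subseteq> U \<and> s \<in> S V \<and> Q V s"
    and res: "\<And>V W s. \<lbrakk>openin T V; openin T W; W \<subseteq> V; V \<subseteq> U; s \<in> S V; Q V s\<rbrakk> \<Longrightarrow> Q W (\<rho> V W s)"
    and uniq: "\<And>V s t. \<lbrakk>openin T V; V \<subseteq> U; s \<in> S V; t \<in> S V; Q V s; Q V t\<rbrakk> \<Longrightarrow> s = t"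
  obtains s where "s \<in> S U" "\<And>V t. \<lbrakk>openin T V; V \<subseteq> U; t \<in> S V; Q V t\<rbrakk> \<Longrightarrow> \<rho> U V s = t"
proof -
  define C where "C = {V. openin T V \<and> V \<subseteq> U \<and> (\<exists>s\<in>S V. Q V s)}"
  have CU: "\<Union>C = U" using ex unfolding C_def by blast
  define f where "f V = (SOME s. s \<in> S V \<and> Q V s)" for V
  have f: "f V \<in> S V" "Q V (f V)" if "V \<in> C" for V
  proof -
    have "\<exists>s. s \<in> S V \<and> Q V s" using that unfolding C_def by blast
    then show "f V \<in> S V" "Q V (f V)" unfolding f_def by (metis (mono_tags, lifting) someI_ex)+
  qed
  have C: "openin T V" "V \<subseteq> U" if "V \<in> C" for V using that unfolding C_def by auto
  have "\<exists>!s. s \<in> S (\<Union>C) \<and> (\<forall>V\<in>C. \<rho> (\<Union>C) V s = f V)"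
  proof (rule glue)
    fix V W assume VW: "V \<in> C" "W \<in> C"
    have o: "openin T (V \<inter> W)" using C VW by blast
    show "\<rho> V (V \<inter> W) (f V) = \<rho> W (V \<inter> W) (f W)"
      using C[OF VW(1)] C[OF VW(2)] f[OF VW(1)] f[OF VW(2)] o restr_closed res
      by (intro uniq[OF o]) auto
  qed (use C f in auto)
  then obtain s where s: "s \<in> S U" "\<forall>V\<in>C. \<rho> U V s = f V" unfolding CU by blast
  show ?thesis
  proof (rule that[OF s(1)])
    fix V t assume V: "openin T V" "V \<subseteq> U" "t \<in> S V" "Q V t"
    then have VC: "V \<in> C" unfolding C_def by blast
    show "\<rho> U V s = t" using s(2) VC f[OF VC] uniq[OF V(1,2) _ V(3) _ V(4)] by simp
  qed
qed

end

lemma ring_hom_Units: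
  assumes "cring R" "cring S" "f \<in> ring_hom R S" "x \<in> Units R"
  shows "f x \<in> Units S" "f (inv\<^bsub>R\<^esub> x) = inv\<^bsub>S\<^esub> (f x)"
proof -
  interpret R: cring R by fact
  interpret S: cring S by fact
  interpret ring_hom_ring R S f using ring_hom_ringI2[OF R.ring_axioms S.ring_axioms assms(3)] .
  have c: "f x \<in> carrier S" "f (inv\<^bsub>R\<^esub> x) \<in> carrier S" using assms(4) by auto
  have e: "f x \<otimes>\<^bsub>S\<^esub> f (inv\<^bsub>R\<^esub> x) = \<one>\<^bsub>S\<^esub>"
    using hom_mult[of x "inv\<^bsub>R\<^esub> x"] R.Units_r_inv[OF assms(4)]
      R.Units_closed[OF assms(4)] R.Units_inv_closed[OF assms(4)] by simp
  show "f x \<in> Units S" using S.unit_factor[of "f x" "f (inv\<^bsub>R\<^esub> x)"] e c by simp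
  show "f (inv\<^bsub>R\<^esub> x) = inv\<^bsub>S\<^esub> (f x)" using S.comm_inv_char[OF c e] by simp
qed

section \<open>Germs and the operations of a stalk\<close>

context ringed_space
begin

text \<open>A germ is the set of all its representatives, so this is the statement that agreement
  near \<open>x\<close> is an equivalence relation; transitivity restricts to the intersection of
  the two neighbourhoods.\<close>

lemma germ_eq_iff:
  assumes U: "openin (pts Y) U" "x \<in> U" "s \<in> carrier (secs Y U)"
    and V: "openin (pts Y) V" "x \<in> V" "t \<in> carrier (secs Y V)"
  shows "germ Y x U s = germ Y x V t \<longleftrightarrow>
    (\<exists>W. openin (pts Y) W \<and> x \<in> W \<and> W \<subseteq> U \<inter> V \<and> restr Y U W s = restr Y V W t)"
proof
  assume "germ Y x U s = germ Y x V t"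
  moreover have "(V, t) \<in> germ Y x V t" unfolding germ_def using V by auto
  ultimately have "(V, t) \<in> germ Y x U s" by simp
  then show "\<exists>W. openin (pts Y) W \<and> x \<in> W \<and> W \<subseteq> U \<inter> V \<and> restr Y U W s = restr Y V W t"
    unfolding germ_def by blast
next
  have sub: "germ Y x U s \<subseteq> germ Y x V t"
    if U: "openin (pts Y) U" "x \<in> U" "s \<in> carrier (secs Y U)"
    and V: "openin (pts Y) V" "x \<in> V" "t \<in> carrier (secs Y V)"
    and W: "openin (pts Y) W" "x \<in> W" "W \<subseteq> U \<inter> V" "restr Y U W s = restr Y V W t" for U V W s t
  proof
    fix z assume "z \<in> germ Y x U s"
    then obtain Z u W' where z: "z = (Z, u)" "openin (pts Y) Z" "x \<in> Z" "u \<in> carrier (secs Y Z)"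
      "openin (pts Y) W'" "x \<in> W'" "W' \<subseteq> U \<inter> Z" "restr Y U W' s = restr Y Z W' u"
      unfolding germ_def by blast
    let ?W = "W \<inter> W'"
    have o: "openin (pts Y) ?W" using W(1) z(5) by blast
    have "restr Y V ?W t = restr Y W ?W (restr Y U W s)"
      unfolding W(4) using restr_trans[OF V(1) W(1) o _ _ V(3)] W(3) by simp
    also have "\<dots> = restr Y W' ?W (restr Y U W' s)"
      using restr_trans[OF U(1) W(1) o _ _ U(3)] restr_trans[OF U(1) z(5) o _ _ U(3)] W(3) z(7) by simp
    also have "\<dots> = restr Y Z ?W u"
      unfolding z(8) using restr_trans[OF z(2,5) o _ _ z(4)] z(7) by simp
    finally have "openin (pts Y) ?W \<and> x \<in> ?W \<and> ?W \<subseteq> V \<inter> Z \<and> restr Y V ?W t = restr Y Z ?W u"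
      using o W z by blast
    then show "z \<in> germ Y x V t" unfolding germ_def z(1) using z(2-4) by blast
  qed
  assume "\<exists>W. openin (pts Y) W \<and> x \<in> W \<and> W \<subseteq> U \<inter> V \<and> restr Y U W s = restr Y V W t"
  then obtain W where W: "openin (pts Y) W" "x \<in> W" "W \<subseteq> U \<inter> V" "restr Y U W s = restr Y V W t" by blast
  show "germ Y x U s = germ Y x V t"
    using sub[OF U V W] sub[OF V U W(1,2) _ W(4)[symmetric]] W(3) by blast
qed

text \<open>Well-definedness of both stalk operations at once: \<open>opr\<close> is any family of
  binary operations that commutes with restriction.\<close>

lemma germ_binary:
  assumes opr: "\<And>V W a b. \<lbrakk>openin (pts Y) V; openin (pts Y) W; W \<subseteq> V; a \<in> carrier (secs Y V); b \<in> carrier (secs Y V)\<rbrakk>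
      \<Longrightarrow> opr V a b \<in> carrier (secs Y V) \<and> restr Y V W (opr V a b) = opr W (restr Y V W a) (restr Y V W b)"
    and U: "openin (pts Y) U" "x \<in> U" "s \<in> carrier (secs Y U)"
    and V: "openin (pts Y) V" "x \<in> V" "t \<in> carrier (secs Y V)"
  shows "(\<Union>(U, s)\<in>germ Y x U s. \<Union>(V, t)\<in>germ Y x V t.
        germ Y x (U \<inter> V) (opr (U \<inter> V) (restr Y U (U \<inter> V) s) (restr Y V (U \<inter> V) t))) =
      germ Y x (U \<inter> V) (opr (U \<inter> V) (restr Y U (U \<inter> V) s) (restr Y V (U \<inter> V) t))"
proof (rule UN_pairs_constant)
  show "germ Y x U s \<noteq> {}" "germ Y x V t \<noteq> {}" unfolding germ_def using U V by auto
  fix U' s' V' t' assume m: "(U', s') \<in> germ Y x U s" "(V', t') \<in> germ Y x V t"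
  obtain W1 where U': "openin (pts Y) U'" "x \<in> U'" "s' \<in> carrier (secs Y U')" and
    W1: "openin (pts Y) W1" "x \<in> W1" "W1 \<subseteq> U \<inter> U'" "restr Y U W1 s = restr Y U' W1 s'"
    using m(1) unfolding germ_def by blast
  obtain W2 where V': "openin (pts Y) V'" "x \<in> V'" "t' \<in> carrier (secs Y V')" and
    W2: "openin (pts Y) W2" "x \<in> W2" "W2 \<subseteq> V \<inter> V'" "restr Y V W2 t = restr Y V' W2 t'"
    using m(2) unfolding germ_def by blast
  let ?W = "W1 \<inter> W2"
  have o: "openin (pts Y) ?W" "openin (pts Y) (U \<inter> V)" "openin (pts Y) (U' \<inter> V')"
    using W1(1) W2(1) U V U' V' by blast+
  have sW: "restr Y U ?W s = restr Y U' ?W s'"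
    using restr_trans[OF U(1) W1(1) o(1) _ _ U(3)] restr_trans[OF U'(1) W1(1) o(1) _ _ U'(3)] W1(3,4) by simp
  have tW: "restr Y V ?W t = restr Y V' ?W t'"
    using restr_trans[OF V(1) W2(1) o(1) _ _ V(3)] restr_trans[OF V'(1) W2(1) o(1) _ _ V'(3)] W2(3,4) by simp
  have key: "restr Y (U \<inter> V) ?W (opr (U \<inter> V) (restr Y U (U \<inter> V) s) (restr Y V (U \<inter> V) t))
      = opr ?W (restr Y U ?W s) (restr Y V ?W t) \<and>
      opr (U \<inter> V) (restr Y U (U \<inter> V) s) (restr Y V (U \<inter> V) t) \<in> carrier (secs Y (U \<inter> V))"
    if "openin (pts Y) U" "openin (pts Y) V" "s \<in> carrier (secs Y U)" "t \<in> carrier (secs Y V)"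
      "?W \<subseteq> U \<inter> V" for U V s t
  proof -
    have oUV: "openin (pts Y) (U \<inter> V)" using that by blast
    show ?thesis
      using opr[OF oUV o(1) that(5) restr_closed[OF that(1) oUV _ that(3)] restr_closed[OF that(2) oUV _ that(4)]]
        restr_trans[OF that(1) oUV o(1) _ _ that(3)] restr_trans[OF that(2) oUV o(1) _ _ that(4)] that(5) by simp
  qed
  have sub: "?W \<subseteq> U \<inter> V" "?W \<subseteq> U' \<inter> V'" using W1(3) W2(3) by blast+
  show "germ Y x (U' \<inter> V') (opr (U' \<inter> V') (restr Y U' (U' \<inter> V') s') (restr Y V' (U' \<inter> V') t')) =
    germ Y x (U \<inter> V) (opr (U \<inter> V) (restr Y U (U \<inter> V) s) (restr Y V (U \<inter> V) t))"
    using key[OF U(1) V(1) U(3) V(3) sub(1)] key[OF U'(1) V'(1) U'(3) V'(3) sub(2)] sW tW o W1(2) W2(2) sub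
      U(2) V(2) U'(2) V'(2)
    by (subst germ_eq_iff) auto
qed

lemma stalk_mult:
  assumes U: "openin (pts Y) U" "x \<in> U" "s \<in> carrier (secs Y U)"
    and V: "openin (pts Y) V" "x \<in> V" "t \<in> carrier (secs Y V)"
  shows "germ Y x U s \<otimes>\<^bsub>stalk Y x\<^esub> germ Y x V t =
    germ Y x (U \<inter> V) (restr Y U (U \<inter> V) s \<otimes>\<^bsub>secs Y (U \<inter> V)\<^esub> restr Y V (U \<inter> V) t)"
proof -
  have "(a \<otimes>\<^bsub>secs Y V\<^esub> b) \<in> carrier (secs Y V) \<and>
      restr Y V W (a \<otimes>\<^bsub>secs Y V\<^esub> b) = restr Y V W a \<otimes>\<^bsub>secs Y W\<^esub> restr Y V W b"
    if "openin (pts Y) V" "openin (pts Y) W" "W \<subseteq> V" "a \<in> carrier (secs Y V)" "b \<in> carrier (secs Y V)" for V W a b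
    using that ring_hom_mult[OF restr_hom[OF that(1-3)]] cring.cring_simprules(5)[OF secs_cring[OF that(1)]] by blast
  from germ_binary[where opr = "\<lambda>V. (\<otimes>\<^bsub>secs Y V\<^esub>)", OF this U V] show ?thesis unfolding stalk_def by simp
qed

lemma stalk_add:
  assumes U: "openin (pts Y) U" "x \<in> U" "s \<in> carrier (secs Y U)"
    and V: "openin (pts Y) V" "x \<in> V" "t \<in> carrier (secs Y V)"
  shows "germ Y x U s \<oplus>\<^bsub>stalk Y x\<^esub> germ Y x V t =
    germ Y x (U \<inter> V) (restr Y U (U \<inter> V) s \<oplus>\<^bsub>secs Y (U \<inter> V)\<^esub> restr Y V (U \<inter> V) t)"
proof -
  have "(a \<oplus>\<^bsub>secs Y V\<^esub> b) \<in> carrier (secs Y V) \<and>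
      restr Y V W (a \<oplus>\<^bsub>secs Y V\<^esub> b) = restr Y V W a \<oplus>\<^bsub>secs Y W\<^esub> restr Y V W b"
    if "openin (pts Y) V" "openin (pts Y) W" "W \<subseteq> V" "a \<in> carrier (secs Y V)" "b \<in> carrier (secs Y V)" for V W a b
    using that ring_hom_add[OF restr_hom[OF that(1-3)]] cring.cring_simprules(1)[OF secs_cring[OF that(1)]] by blast
  from germ_binary[where opr = "\<lambda>V. (\<oplus>\<^bsub>secs Y V\<^esub>)", OF this U V] show ?thesis unfolding stalk_def by simp
qed

abbreviation two :: "'x set \<Rightarrow> 'r" where "two U \<equiv> \<one>\<^bsub>secs Y U\<^esub> \<oplus>\<^bsub>secs Y U\<^esub> \<one>\<^bsub>secs Y U\<^esub>"

end

text \<open>A unit of the residue field is nonzero there, so 2 lies outside the maximal ideal of the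
  stalk and is a unit of this local ring. A representative of the inverse germ satisfies the
  equation after shrinking its neighbourhood.\<close>

lemma (in locally_ringed_space) two_locally_invertible:
  assumes x: "x \<in> topspace (pts Y)"
    and res: "\<one>\<^bsub>residue_field Y x\<^esub> \<oplus>\<^bsub>residue_field Y x\<^esub> \<one>\<^bsub>residue_field Y x\<^esub> \<in> Units (residue_field Y x)"
  shows "\<exists>V s. openin (pts Y) V \<and> x \<in> V \<and> s \<in> carrier (secs Y V) \<and> two V \<otimes>\<^bsub>secs Y V\<^esub> s = \<one>\<^bsub>secs Y V\<^esub>"
proof -
  let ?S = "stalk Y x" and ?E = "topspace (pts Y)"
  define m where "m = (THE m. maximalideal m ?S)"
  have loc: "cring ?S" "\<exists>!m. maximalideal m ?S" using local_stalks[OF x] unfolding local_ring_def by auto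
  interpret S: cring ?S by fact
  have "maximalideal m ?S" unfolding m_def using loc(2) by (rule theI')
  then interpret m: maximalideal m ?S .
  let ?Q = "?S Quot m" and ?t = "\<one>\<^bsub>?S\<^esub> \<oplus>\<^bsub>?S\<^esub> \<one>\<^bsub>?S\<^esub>"
  interpret Q: field ?Q using m.quotient_is_field[OF loc(1)] .
  interpret q: ring_hom_ring ?S ?Q "(+>\<^bsub>?S\<^esub>) m" using m.rcos_ring_hom_ring .
  have "m +>\<^bsub>?S\<^esub> ?t \<in> Units ?Q" using res unfolding residue_field_def m_def[symmetric] by simp
  then have "m +>\<^bsub>?S\<^esub> ?t \<noteq> \<zero>\<^bsub>?Q\<^esub>" using Q.field_Units by blast
  moreover have "\<zero>\<^bsub>?Q\<^esub> = m" unfolding FactRing_def by simp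
  ultimately have "?t \<notin> m" using S.a_rcos_zero[OF m.is_ideal, of ?t] by metis
  have "?t \<in> Units ?S"
  \<comment> \<open>A nonunit lies in some maximal ideal, and the stalk has no maximal ideal besides
    \<open>m\<close>.\<close>
  proof (rule ccontr)
    assume "?t \<notin> Units ?S"
    then obtain P where "maximalideal P ?S" "?t \<in> P" using S.exists_maximalideal_nonunit[of ?t] by auto
    then show False using loc(2) m.is_maximalideal \<open>?t \<notin> m\<close> by blast
  qed
  then obtain g where g: "g \<in> carrier ?S" "?t \<otimes>\<^bsub>?S\<^esub> g = \<one>\<^bsub>?S\<^esub>" unfolding Units_def by blast
  obtain V s where V: "openin (pts Y) V" "x \<in> V" "s \<in> carrier (secs Y V)" and gV: "g = germ Y x V s"
    using g(1) unfolding stalk_def by auto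
  have E: "openin (pts Y) ?E" by simp
  interpret E: cring "secs Y ?E" using secs_cring[OF E] .
  have one: "\<one>\<^bsub>?S\<^esub> = germ Y x ?E \<one>\<^bsub>secs Y ?E\<^esub>" unfolding stalk_def by simp
  have t: "?t = germ Y x ?E (two ?E)"
    unfolding one using stalk_add[OF E x E.one_closed E x E.one_closed] restr_id[OF E E.one_closed] by simp
  have VE: "?E \<inter> V = V" using openin_subset[OF V(1)] by blast
  interpret V: cring "secs Y V" using secs_cring[OF V(1)] .
  have tc: "two ?E \<in> carrier (secs Y ?E)" by simp
  note h = restr_hom[OF E V(1) openin_subset[OF V(1)]]
  have rt: "restr Y ?E V (two ?E) = two V"
    using ring_hom_add[OF h E.one_closed E.one_closed] ring_hom_one[OF h] by simp
  have "germ Y x V (two V \<otimes>\<^bsub>secs Y V\<^esub> s) = germ Y x ?E \<one>\<^bsub>secs Y ?E\<^esub>"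
    using g(2)[unfolded gV t] stalk_mult[OF E x tc V] unfolding one VE rt restr_id[OF V(1,3)] by simp
  then obtain W where W: "openin (pts Y) W" "x \<in> W" "W \<subseteq> V \<inter> ?E"
    "restr Y V W (two V \<otimes>\<^bsub>secs Y V\<^esub> s) = restr Y ?E W \<one>\<^bsub>secs Y ?E\<^esub>"
    using germ_eq_iff[OF V(1,2) _ E x E.one_closed, of "two V \<otimes>\<^bsub>secs Y V\<^esub> s"] V(3) by auto
  have WV: "W \<subseteq> V" "W \<subseteq> ?E" using W(3) by auto
  note hV = restr_hom[OF V(1) W(1) WV(1)]
  have "two W \<otimes>\<^bsub>secs Y W\<^esub> restr Y V W s = \<one>\<^bsub>secs Y W\<^esub>"
    using W(4) V(3) ring_hom_one[OF restr_hom[OF E W(1) WV(2)]] ring_hom_one[OF hV]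
      ring_hom_mult[OF hV _ V(3), of "two V"] ring_hom_add[OF hV V.one_closed V.one_closed] by simp
  then show ?thesis using W(1,2) restr_closed[OF V(1) W(1) WV(1) V(3)] by blast
qed

text \<open>Inverses are unique and preserved by restriction, so the local inverses of 2
  glue.\<close>

lemma (in locally_ringed_space) two_unit:
  assumes res: "\<And>x. x \<in> topspace (pts Y) \<Longrightarrow>
      \<one>\<^bsub>residue_field Y x\<^esub> \<oplus>\<^bsub>residue_field Y x\<^esub> \<one>\<^bsub>residue_field Y x\<^esub> \<in> Units (residue_field Y x)"
    and U: "openin (pts Y) U"
  shows "two U \<in> Units (secs Y U)"
proof -
  have two_restr: "restr Y V W (two V) = two W" "restr Y V W \<one>\<^bsub>secs Y V\<^esub> = \<one>\<^bsub>secs Y W\<^esub>"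
    if "openin (pts Y) V" "openin (pts Y) W" "W \<subseteq> V" for V W
    using that ring_hom_add[OF restr_hom[OF that]] ring_hom_one[OF restr_hom[OF that]]
      cring.cring_simprules(6)[OF secs_cring[OF that(1)]] by auto
  have two_closed: "two V \<in> carrier (secs Y V)" if "openin (pts Y) V" for V
    using cring.cring_simprules(1,6)[OF secs_cring[OF that]] by blast
  obtain s where s: "s \<in> carrier (secs Y U)" and
    loc: "\<And>V t. \<lbrakk>openin (pts Y) V; V \<subseteq> U; t \<in> carrier (secs Y V); two V \<otimes>\<^bsub>secs Y V\<^esub> t = \<one>\<^bsub>secs Y V\<^esub>\<rbrakk>
      \<Longrightarrow> restr Y U V s = t"
  proof (rule glue_unique_local[OF U, of "\<lambda>V t. two V \<otimes>\<^bsub>secs Y V\<^esub> t = \<one>\<^bsub>secs Y V\<^esub>"])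
    have rs: "two W \<otimes>\<^bsub>secs Y W\<^esub> restr Y V W s = \<one>\<^bsub>secs Y W\<^esub>"
      if "openin (pts Y) V" "openin (pts Y) W" "W \<subseteq> V" "s \<in> carrier (secs Y V)"
        "two V \<otimes>\<^bsub>secs Y V\<^esub> s = \<one>\<^bsub>secs Y V\<^esub>" for V W s
      using ring_hom_mult[OF restr_hom[OF that(1-3)] two_closed[OF that(1)] that(4)] two_restr[OF that(1-3)] that(5)
      by simp
    show "two W \<otimes>\<^bsub>secs Y W\<^esub> restr Y V W s = \<one>\<^bsub>secs Y W\<^esub>"
      if "openin (pts Y) V" "openin (pts Y) W" "W \<subseteq> V" "V \<subseteq> U" "s \<in> carrier (secs Y V)"
        "two V \<otimes>\<^bsub>secs Y V\<^esub> s = \<one>\<^bsub>secs Y V\<^esub>" for V W s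
      using rs that by blast
    show "\<exists>V s. openin (pts Y) V \<and> x \<in> V \<and> V \<subseteq> U \<and> s \<in> carrier (secs Y V) \<and>
        two V \<otimes>\<^bsub>secs Y V\<^esub> s = \<one>\<^bsub>secs Y V\<^esub>" if x: "x \<in> U" for x
    proof -
      have xE: "x \<in> topspace (pts Y)" using x openin_subset[OF U] by blast
      obtain V s where V: "openin (pts Y) V" "x \<in> V" "s \<in> carrier (secs Y V)"
        "two V \<otimes>\<^bsub>secs Y V\<^esub> s = \<one>\<^bsub>secs Y V\<^esub>" using two_locally_invertible[OF xE res[OF xE]] by blast
      have VU: "openin (pts Y) (V \<inter> U)" using V U by blast
      show ?thesis using rs[OF V(1) VU _ V(3,4)] VU restr_closed[OF V(1) VU _ V(3)] x V(2) by blast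
    qed
    show "s = t" if "openin (pts Y) V" "s \<in> carrier (secs Y V)" "t \<in> carrier (secs Y V)"
      "two V \<otimes>\<^bsub>secs Y V\<^esub> s = \<one>\<^bsub>secs Y V\<^esub>" "two V \<otimes>\<^bsub>secs Y V\<^esub> t = \<one>\<^bsub>secs Y V\<^esub>" for V s t
    proof -
      interpret V: cring "secs Y V" using secs_cring[OF that(1)] .
      show ?thesis using that V.comm_inv_char[OF two_closed[OF that(1)]] by metis
    qed
  qed blast
  interpret U: cring "secs Y U" using secs_cring[OF U] .
  \<comment> \<open>Gluing only determines the restrictions of \<open>s\<close>; that
    \<open>s\<close> itself inverts 2 is checked locally.\<close>
  have "two U \<otimes>\<^bsub>secs Y U\<^esub> s = \<one>\<^bsub>secs Y U\<^esub>"
  proof (rule sections_eqI[OF U])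
    fix x assume x: "x \<in> U"
    have xE: "x \<in> topspace (pts Y)" using x openin_subset[OF U] by blast
    obtain V t where V: "openin (pts Y) V" "x \<in> V" "t \<in> carrier (secs Y V)"
      "two V \<otimes>\<^bsub>secs Y V\<^esub> t = \<one>\<^bsub>secs Y V\<^esub>" using two_locally_invertible[OF xE res[OF xE]] by blast
    let ?W = "V \<inter> U" and ?t = "restr Y V (V \<inter> U) t"
    have W: "openin (pts Y) ?W" "?W \<subseteq> U" "?W \<subseteq> V" using V U by auto
    have t: "?t \<in> carrier (secs Y ?W)" using restr_closed[OF V(1) W(1,3) V(3)] .
    have e: "two ?W \<otimes>\<^bsub>secs Y ?W\<^esub> ?t = \<one>\<^bsub>secs Y ?W\<^esub>"
      using ring_hom_mult[OF restr_hom[OF V(1) W(1,3)] two_closed[OF V(1)] V(3)] two_restr[OF V(1) W(1,3)] V(4)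
      by simp
    have "restr Y U ?W (two U \<otimes>\<^bsub>secs Y U\<^esub> s) = restr Y U ?W \<one>\<^bsub>secs Y U\<^esub>"
      using ring_hom_mult[OF restr_hom[OF U W(1,2)] two_closed[OF U] s] two_restr[OF U W(1,2)] e loc[OF W(1,2) t e]
      by simp
    then show "\<exists>V. openin (pts Y) V \<and> x \<in> V \<and> V \<subseteq> U \<and>
      restr Y U V (two U \<otimes>\<^bsub>secs Y U\<^esub> s) = restr Y U V \<one>\<^bsub>secs Y U\<^esub>" using W x V(2) by blast
  qed (use s two_closed[OF U] in auto)
  then show ?thesis using U.unit_factor[OF _ two_closed[OF U] s] by simp
qed

section \<open>Traces and dual bases\<close>

text \<open>The dual basis of a finitely generated projective module: linear coordinates and the
  expansion of each element, without demanding that \<open>p i (b j)\<close> is a Kronecker delta.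
  This is what the comparison of traces and the Cayley--Hamilton computation consume.\<close>

definition dual_basis :: "('r, 'k) ring_scheme \<Rightarrow> ('r, 'a, 'l) module_scheme \<Rightarrow> nat \<Rightarrow> (nat \<Rightarrow> 'a) \<Rightarrow> (nat \<Rightarrow> 'a \<Rightarrow> 'r) \<Rightarrow> bool"
  where "dual_basis R M n b p \<longleftrightarrow>
    (\<forall>j<n. b j \<in> carrier M) \<and>
    (\<forall>j<n. \<forall>x\<in>carrier M. p j x \<in> carrier R) \<and>
    (\<forall>j<n. \<forall>x\<in>carrier M. \<forall>y\<in>carrier M. p j (x \<oplus>\<^bsub>M\<^esub> y) = p j x \<oplus>\<^bsub>R\<^esub> p j y) \<and>
    (\<forall>j<n. \<forall>k\<in>carrier R. \<forall>x\<in>carrier M. p j (k \<odot>\<^bsub>M\<^esub> x) = k \<otimes>\<^bsub>R\<^esub> p j x) \<and>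
    (\<forall>x\<in>carrier M. x = (\<Oplus>\<^bsub>M\<^esub>j\<in>{..<n}. p j x \<odot>\<^bsub>M\<^esub> b j))"

lemma (in abelian_monoid) finsum_swap:
  assumes "finite I" "finite J" "\<And>i j. i \<in> I \<Longrightarrow> j \<in> J \<Longrightarrow> f i j \<in> carrier G"
  shows "(\<Oplus>i\<in>I. \<Oplus>j\<in>J. f i j) = (\<Oplus>j\<in>J. \<Oplus>i\<in>I. f i j)"
  using assms(1,3)
proof (induction I rule: finite_induct)
  case empty then show ?case by simp
next
  case (insert i I)
  have "(\<Oplus>j\<in>J. \<Oplus>i\<in>insert i I. f i j) = (\<Oplus>j\<in>J. f i j \<oplus> (\<Oplus>i\<in>I. f i j))"
    using insert by (intro finsum_cong') (auto intro!: finsum_insert finsum_closed)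
  also have "\<dots> = (\<Oplus>j\<in>J. f i j) \<oplus> (\<Oplus>j\<in>J. \<Oplus>i\<in>I. f i j)"
    using insert by (intro finsum_addf) (auto intro!: finsum_closed)
  also have "\<dots> = (\<Oplus>i\<in>insert i I. \<Oplus>j\<in>J. f i j)"
    using insert by (subst finsum_insert) (auto intro!: finsum_closed)
  finally show ?case ..
qed

lemma (in abelian_monoid) finsum_two:
  assumes "f 0 \<in> carrier G" "f 1 \<in> carrier G"
  shows "(\<Oplus>j\<in>{..<2::nat}. f j) = f 0 \<oplus> f 1"
proof -
  have "{..<2::nat} = {0, 1}" by auto
  then show ?thesis using assms by simp
qed

lemma (in ring) semiring: "semiring R" ..

context module
begin

lemma linear_finsum:
  assumes p: "\<And>x. x \<in> carrier M \<Longrightarrow> p x \<in> carrier R"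
    and add: "\<And>x y. x \<in> carrier M \<Longrightarrow> y \<in> carrier M \<Longrightarrow> p (x \<oplus>\<^bsub>M\<^esub> y) = p x \<oplus> p y"
    and smult: "\<And>k x. k \<in> carrier R \<Longrightarrow> x \<in> carrier M \<Longrightarrow> p (k \<odot>\<^bsub>M\<^esub> x) = k \<otimes> p x"
    and I: "finite I" "\<And>i. i \<in> I \<Longrightarrow> c i \<in> carrier R" "\<And>i. i \<in> I \<Longrightarrow> f i \<in> carrier M"
  shows "p (\<Oplus>\<^bsub>M\<^esub>i\<in>I. c i \<odot>\<^bsub>M\<^esub> f i) = (\<Oplus>i\<in>I. c i \<otimes> p (f i))"
  using I
proof (induction I rule: finite_induct)
  case empty
  have "p (\<zero>\<^bsub>M\<^esub>) = p (\<zero> \<odot>\<^bsub>M\<^esub> \<zero>\<^bsub>M\<^esub>)" by simp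
  also have "\<dots> = \<zero>" unfolding smult[OF R.zero_closed M.zero_closed] using p by simp
  finally show ?case by simp
next
  case (insert i I)
  have "p (\<Oplus>\<^bsub>M\<^esub>i\<in>insert i I. c i \<odot>\<^bsub>M\<^esub> f i) = p (c i \<odot>\<^bsub>M\<^esub> f i \<oplus>\<^bsub>M\<^esub> (\<Oplus>\<^bsub>M\<^esub>i\<in>I. c i \<odot>\<^bsub>M\<^esub> f i))"
    using insert by (subst M.finsum_insert) auto
  also have "\<dots> = c i \<otimes> p (f i) \<oplus> (\<Oplus>i\<in>I. c i \<otimes> p (f i))"
    using insert by (subst add) (auto simp: smult intro!: M.finsum_closed)
  also have "\<dots> = (\<Oplus>i\<in>insert i I. c i \<otimes> p (f i))"
    using insert p by (subst R.finsum_insert) auto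
  finally show ?case .
qed

lemma dual_basisD:
  assumes "dual_basis R M n b p" "j < n"
  shows "b j \<in> carrier M" "x \<in> carrier M \<Longrightarrow> p j x \<in> carrier R"
    "\<lbrakk>x \<in> carrier M; y \<in> carrier M\<rbrakk> \<Longrightarrow> p j (x \<oplus>\<^bsub>M\<^esub> y) = p j x \<oplus> p j y"
    "\<lbrakk>k \<in> carrier R; x \<in> carrier M\<rbrakk> \<Longrightarrow> p j (k \<odot>\<^bsub>M\<^esub> x) = k \<otimes> p j x"
  using assms unfolding dual_basis_def by auto

lemma dual_basis_expand:
  assumes "dual_basis R M n b p" "x \<in> carrier M"
  shows "x = (\<Oplus>\<^bsub>M\<^esub>j\<in>{..<n}. p j x \<odot>\<^bsub>M\<^esub> b j)"
  using assms unfolding dual_basis_def by auto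

lemma dual_basis_finsum:
  assumes "dual_basis R M n b p" "j < n"
    and "finite I" "\<And>i. i \<in> I \<Longrightarrow> c i \<in> carrier R" "\<And>i. i \<in> I \<Longrightarrow> f i \<in> carrier M"
  shows "p j (\<Oplus>\<^bsub>M\<^esub>i\<in>I. c i \<odot>\<^bsub>M\<^esub> f i) = (\<Oplus>i\<in>I. c i \<otimes> p j (f i))"
  by (rule linear_finsum) (use assms dual_basisD[OF assms(1,2)] in auto)

end

context algebra
begin

lemma M_m_comm: "\<lbrakk>x \<in> carrier M; y \<in> carrier M\<rbrakk> \<Longrightarrow> x \<otimes>\<^bsub>M\<^esub> y = y \<otimes>\<^bsub>M\<^esub> x"
  using M_cring by (rule cring.cring_simprules)

lemma M_r_distr: "\<lbrakk>x \<in> carrier M; y \<in> carrier M; z \<in> carrier M\<rbrakk>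
    \<Longrightarrow> z \<otimes>\<^bsub>M\<^esub> (x \<oplus>\<^bsub>M\<^esub> y) = z \<otimes>\<^bsub>M\<^esub> x \<oplus>\<^bsub>M\<^esub> z \<otimes>\<^bsub>M\<^esub> y"
  using M_cring by (rule cring.cring_simprules)

lemma smult_assoc3:
  "\<lbrakk>k \<in> carrier R; x \<in> carrier M; y \<in> carrier M\<rbrakk> \<Longrightarrow> x \<otimes>\<^bsub>M\<^esub> (k \<odot>\<^bsub>M\<^esub> y) = k \<odot>\<^bsub>M\<^esub> (x \<otimes>\<^bsub>M\<^esub> y)"
  using smult_assoc2[of k y x] M_m_comm[of x "k \<odot>\<^bsub>M\<^esub> y"] M_m_comm[of x y] by simp

lemma mult_finsum_smult:
  assumes a: "a \<in> carrier M"
    and I: "finite I" "\<And>i. i \<in> I \<Longrightarrow> c i \<in> carrier R" "\<And>i. i \<in> I \<Longrightarrow> f i \<in> carrier M"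
  shows "a \<otimes>\<^bsub>M\<^esub> (\<Oplus>\<^bsub>M\<^esub>i\<in>I. c i \<odot>\<^bsub>M\<^esub> f i) = (\<Oplus>\<^bsub>M\<^esub>i\<in>I. c i \<odot>\<^bsub>M\<^esub> (a \<otimes>\<^bsub>M\<^esub> f i))"
proof -
  have "a \<otimes>\<^bsub>M\<^esub> (\<Oplus>\<^bsub>M\<^esub>i\<in>I. c i \<odot>\<^bsub>M\<^esub> f i) = (\<Oplus>\<^bsub>M\<^esub>i\<in>I. a \<otimes>\<^bsub>M\<^esub> (c i \<odot>\<^bsub>M\<^esub> f i))"
    using assms by (intro semiring.finsum_rdistr[OF ring.semiring[OF cring.axioms(1)[OF M_cring]]]) auto
  also have "\<dots> = (\<Oplus>\<^bsub>M\<^esub>i\<in>I. c i \<odot>\<^bsub>M\<^esub> (a \<otimes>\<^bsub>M\<^esub> f i))"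
  proof (rule M.finsum_cong')
    show "a \<otimes>\<^bsub>M\<^esub> (c i \<odot>\<^bsub>M\<^esub> f i) = c i \<odot>\<^bsub>M\<^esub> (a \<otimes>\<^bsub>M\<^esub> f i)" if "i \<in> I" for i
      using that a I smult_assoc3 by auto
  qed (use assms in auto)
  finally show ?thesis .
qed

text \<open>This is \<open>tr (P Q) = tr (Q P)\<close> for the two rectangular transition matrices; the ranks need not agree.\<close>

lemma trace_dual_basis_unique:
  assumes D: "dual_basis R M n b p" and D': "dual_basis R M m b' q" and a: "a \<in> carrier M"
  shows "(\<Oplus>j\<in>{..<n}. p j (a \<otimes>\<^bsub>M\<^esub> b j)) = (\<Oplus>k\<in>{..<m}. q k (a \<otimes>\<^bsub>M\<^esub> b' k))"
proof -
  note d = dual_basisD[OF D] and d' = dual_basisD[OF D']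
  have c: "a \<otimes>\<^bsub>M\<^esub> b j \<in> carrier M" if "j < n" for j using a d(1)[OF that] by simp
  have c': "a \<otimes>\<^bsub>M\<^esub> b' k \<in> carrier M" if "k < m" for k using a d'(1)[OF that] by simp
  \<comment> \<open>Both traces become the double sum with terms \<open>q k (a b j)\<close> times
    \<open>p j (b' k)\<close>: here the product of \<open>a\<close> and \<open>b j\<close> is
    expanded along \<open>b'\<close>, in \<open>2\<close> the element \<open>b' k\<close> is
    expanded along \<open>b\<close>.\<close>
  have 1: "p j (a \<otimes>\<^bsub>M\<^esub> b j) = (\<Oplus>k\<in>{..<m}. q k (a \<otimes>\<^bsub>M\<^esub> b j) \<otimes> p j (b' k))" if j: "j < n" for j
    using arg_cong[OF dual_basis_expand[OF D' c[OF j]], of "p j"]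
      dual_basis_finsum[OF D j, of "{..<m}" "\<lambda>k. q k (a \<otimes>\<^bsub>M\<^esub> b j)" b'] d'(1,2) c[OF j] by simp
  have 2: "q k (a \<otimes>\<^bsub>M\<^esub> b' k) = (\<Oplus>j\<in>{..<n}. q k (a \<otimes>\<^bsub>M\<^esub> b j) \<otimes> p j (b' k))" if k: "k < m" for k
  proof -
    have "a \<otimes>\<^bsub>M\<^esub> b' k = a \<otimes>\<^bsub>M\<^esub> (\<Oplus>\<^bsub>M\<^esub>j\<in>{..<n}. p j (b' k) \<odot>\<^bsub>M\<^esub> b j)"
      using dual_basis_expand[OF D d'(1)[OF k]] by simp
    also have "\<dots> = (\<Oplus>\<^bsub>M\<^esub>j\<in>{..<n}. p j (b' k) \<odot>\<^bsub>M\<^esub> (a \<otimes>\<^bsub>M\<^esub> b j))"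
      using d(1,2) d'(1)[OF k] a by (intro mult_finsum_smult) auto
    finally have "q k (a \<otimes>\<^bsub>M\<^esub> b' k) = (\<Oplus>j\<in>{..<n}. p j (b' k) \<otimes> q k (a \<otimes>\<^bsub>M\<^esub> b j))"
      using dual_basis_finsum[OF D' k, of "{..<n}" "\<lambda>j. p j (b' k)" "\<lambda>j. a \<otimes>\<^bsub>M\<^esub> b j"] d(2) d'(1)[OF k] c by simp
    also have "\<dots> = (\<Oplus>j\<in>{..<n}. q k (a \<otimes>\<^bsub>M\<^esub> b j) \<otimes> p j (b' k))"
      using d(2) d'(1)[OF k] d'(2)[OF k] c by (intro R.finsum_cong') (auto intro: R.m_comm)
    finally show ?thesis .
  qed
  have "(\<Oplus>j\<in>{..<n}. p j (a \<otimes>\<^bsub>M\<^esub> b j)) = (\<Oplus>j\<in>{..<n}. \<Oplus>k\<in>{..<m}. q k (a \<otimes>\<^bsub>M\<^esub> b j) \<otimes> p j (b' k))"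
    using 1 d d' c by (intro R.finsum_cong') (auto intro!: R.finsum_closed)
  also have "\<dots> = (\<Oplus>k\<in>{..<m}. \<Oplus>j\<in>{..<n}. q k (a \<otimes>\<^bsub>M\<^esub> b j) \<otimes> p j (b' k))"
    using d d' c by (intro R.finsum_swap) auto
  also have "\<dots> = (\<Oplus>k\<in>{..<m}. q k (a \<otimes>\<^bsub>M\<^esub> b' k))"
    using 2 d d' c c' by (intro R.finsum_cong') auto
  finally show ?thesis .
qed

text \<open>Cayley--Hamilton for the multiplication by \<open>l\<close>.\<close>

lemma rank_two_traceless_square:
  assumes D: "dual_basis R M 2 b p" and l: "l \<in> carrier M"
    and tr: "(\<Oplus>j\<in>{..<2}. p j (l \<otimes>\<^bsub>M\<^esub> b j)) = \<zero>"
  obtains d where "d \<in> carrier R" "l \<otimes>\<^bsub>M\<^esub> l = d \<odot>\<^bsub>M\<^esub> \<one>\<^bsub>M\<^esub>"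
proof -
  let ?b0 = "b 0" and ?b1 = "b 1"
  note d = dual_basisD[OF D]
  have b: "?b0 \<in> carrier M" "?b1 \<in> carrier M" using d(1)[of 0] d(1)[of 1] by auto
  define \<alpha> where "\<alpha> i j = p i (l \<otimes>\<^bsub>M\<^esub> b j)" for i j
  have \<alpha>: "\<alpha> i j \<in> carrier R" if "i < 2" "j < 2" for i j using d(1,2) that l unfolding \<alpha>_def by auto
  note \<alpha>s = \<alpha>[of 0 0, simplified] \<alpha>[of 0 1, simplified] \<alpha>[of 1 0, simplified] \<alpha>[of 1 1, simplified]
  have ex: "x = p 0 x \<odot>\<^bsub>M\<^esub> ?b0 \<oplus>\<^bsub>M\<^esub> p 1 x \<odot>\<^bsub>M\<^esub> ?b1" if x: "x \<in> carrier M" for x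
    using dual_basis_expand[OF D x] M.finsum_two[of "\<lambda>j. p j x \<odot>\<^bsub>M\<^esub> b j"] b d(2)[of 0 x] d(2)[of 1 x] x by simp
  have lb: "l \<otimes>\<^bsub>M\<^esub> ?b0 = \<alpha> 0 0 \<odot>\<^bsub>M\<^esub> ?b0 \<oplus>\<^bsub>M\<^esub> \<alpha> 1 0 \<odot>\<^bsub>M\<^esub> ?b1"
    "l \<otimes>\<^bsub>M\<^esub> ?b1 = \<alpha> 0 1 \<odot>\<^bsub>M\<^esub> ?b0 \<oplus>\<^bsub>M\<^esub> \<alpha> 1 1 \<odot>\<^bsub>M\<^esub> ?b1"
    using ex[of "l \<otimes>\<^bsub>M\<^esub> ?b0"] ex[of "l \<otimes>\<^bsub>M\<^esub> ?b1"] l b unfolding \<alpha>_def by auto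
  have t: "\<alpha> 0 0 \<oplus> \<alpha> 1 1 = \<zero>"
    using tr R.finsum_two[of "\<lambda>j. \<alpha> j j"] \<alpha>s unfolding \<alpha>_def by simp
  have \<alpha>11: "\<alpha> 1 1 = \<ominus> \<alpha> 0 0" using t \<alpha>s R.minus_equality[of "\<alpha> 1 1" "\<alpha> 0 0"] R.a_comm by simp
  \<comment> \<open>Minus the determinant of the matrix \<open>\<alpha>\<close>, rewritten by means
    of \<open>\<alpha>11\<close>. For trace zero, Cayley--Hamilton says that the square of the
    matrix is the scalar \<open>e\<close>.\<close>
  define e where "e = \<alpha> 0 0 \<otimes> \<alpha> 0 0 \<oplus> \<alpha> 0 1 \<otimes> \<alpha> 1 0"
  have e: "e \<in> carrier R" unfolding e_def using \<alpha>s by simp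
  have lin: "l \<otimes>\<^bsub>M\<^esub> (r \<odot>\<^bsub>M\<^esub> ?b0 \<oplus>\<^bsub>M\<^esub> s \<odot>\<^bsub>M\<^esub> ?b1)
      = (r \<otimes> \<alpha> 0 0 \<oplus> s \<otimes> \<alpha> 0 1) \<odot>\<^bsub>M\<^esub> ?b0 \<oplus>\<^bsub>M\<^esub> (r \<otimes> \<alpha> 1 0 \<oplus> s \<otimes> \<alpha> 1 1) \<odot>\<^bsub>M\<^esub> ?b1"
    if rs: "r \<in> carrier R" "s \<in> carrier R" for r s
  proof -
    have "l \<otimes>\<^bsub>M\<^esub> (r \<odot>\<^bsub>M\<^esub> ?b0) = r \<odot>\<^bsub>M\<^esub> (l \<otimes>\<^bsub>M\<^esub> ?b0)" "l \<otimes>\<^bsub>M\<^esub> (s \<odot>\<^bsub>M\<^esub> ?b1) = s \<odot>\<^bsub>M\<^esub> (l \<otimes>\<^bsub>M\<^esub> ?b1)"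
      using smult_assoc3 rs b l by auto
    then have "l \<otimes>\<^bsub>M\<^esub> (r \<odot>\<^bsub>M\<^esub> ?b0 \<oplus>\<^bsub>M\<^esub> s \<odot>\<^bsub>M\<^esub> ?b1)
        = r \<odot>\<^bsub>M\<^esub> (\<alpha> 0 0 \<odot>\<^bsub>M\<^esub> ?b0 \<oplus>\<^bsub>M\<^esub> \<alpha> 1 0 \<odot>\<^bsub>M\<^esub> ?b1) \<oplus>\<^bsub>M\<^esub> s \<odot>\<^bsub>M\<^esub> (\<alpha> 0 1 \<odot>\<^bsub>M\<^esub> ?b0 \<oplus>\<^bsub>M\<^esub> \<alpha> 1 1 \<odot>\<^bsub>M\<^esub> ?b1)"
      using rs b l lb by (simp add: M_r_distr)
    also have "\<dots> = (r \<otimes> \<alpha> 0 0 \<oplus> s \<otimes> \<alpha> 0 1) \<odot>\<^bsub>M\<^esub> ?b0 \<oplus>\<^bsub>M\<^esub> (r \<otimes> \<alpha> 1 0 \<oplus> s \<otimes> \<alpha> 1 1) \<odot>\<^bsub>M\<^esub> ?b1"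
      using rs b \<alpha>s by (simp add: smult_r_distr smult_l_distr smult_assoc1 M.a_ac)
    finally show ?thesis .
  qed
  have sq: "l \<otimes>\<^bsub>M\<^esub> (l \<otimes>\<^bsub>M\<^esub> ?b0) = e \<odot>\<^bsub>M\<^esub> ?b0" "l \<otimes>\<^bsub>M\<^esub> (l \<otimes>\<^bsub>M\<^esub> ?b1) = e \<odot>\<^bsub>M\<^esub> ?b1"
  proof -
    have "\<alpha> 0 0 \<otimes> \<alpha> 1 0 \<oplus> \<alpha> 1 0 \<otimes> \<alpha> 1 1 = \<zero>" "\<alpha> 0 1 \<otimes> \<alpha> 0 0 \<oplus> \<alpha> 1 1 \<otimes> \<alpha> 0 1 = \<zero>"
      "\<alpha> 0 0 \<otimes> \<alpha> 0 0 \<oplus> \<alpha> 1 0 \<otimes> \<alpha> 0 1 = e" "\<alpha> 0 1 \<otimes> \<alpha> 1 0 \<oplus> \<alpha> 1 1 \<otimes> \<alpha> 1 1 = e"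
      unfolding e_def \<alpha>11 using \<alpha>s(1-3) by (simp_all add: R.m_comm R.r_minus R.l_minus R.r_neg R.a_comm)
    then show "l \<otimes>\<^bsub>M\<^esub> (l \<otimes>\<^bsub>M\<^esub> ?b0) = e \<odot>\<^bsub>M\<^esub> ?b0" "l \<otimes>\<^bsub>M\<^esub> (l \<otimes>\<^bsub>M\<^esub> ?b1) = e \<odot>\<^bsub>M\<^esub> ?b1"
      unfolding lb using lin \<alpha>s b e by simp_all
  qed
  have "l \<otimes>\<^bsub>M\<^esub> (l \<otimes>\<^bsub>M\<^esub> x) = e \<odot>\<^bsub>M\<^esub> x" if x: "x \<in> carrier M" for x
  proof -
    have p: "p 0 x \<in> carrier R" "p 1 x \<in> carrier R" using d(2)[of 0 x] d(2)[of 1 x] x by auto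
    have "l \<otimes>\<^bsub>M\<^esub> (l \<otimes>\<^bsub>M\<^esub> (p 0 x \<odot>\<^bsub>M\<^esub> ?b0 \<oplus>\<^bsub>M\<^esub> p 1 x \<odot>\<^bsub>M\<^esub> ?b1)) = p 0 x \<odot>\<^bsub>M\<^esub> (e \<odot>\<^bsub>M\<^esub> ?b0) \<oplus>\<^bsub>M\<^esub> p 1 x \<odot>\<^bsub>M\<^esub> (e \<odot>\<^bsub>M\<^esub> ?b1)"
      using p b l by (simp add: M_r_distr smult_assoc3 sq sq[unfolded One_nat_def])
    also have "\<dots> = e \<odot>\<^bsub>M\<^esub> (p 0 x \<odot>\<^bsub>M\<^esub> ?b0 \<oplus>\<^bsub>M\<^esub> p 1 x \<odot>\<^bsub>M\<^esub> ?b1)"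
      using p b e by (simp add: smult_r_distr R.m_comm flip: smult_assoc1)
    finally show ?thesis unfolding ex[OF x, symmetric] .
  qed
  \<comment> \<open>So far multiplying twice by \<open>l\<close> is multiplication by
    \<open>e\<close>; evaluating at 1 gives the square of \<open>l\<close> itself.\<close>
  from this[of "\<one>\<^bsub>M\<^esub>"] show ?thesis using that e l by simp
qed

end

context algebra_sheaf
begin

lemma mrestr_ring_hom_ring:
  assumes "openin (pts Y) U" "openin (pts Y) V" "V \<subseteq> U"
  shows "ring_hom_ring (msecs A U) (msecs A V) (mrestr A U V)"
  using ring_hom_ringI2[OF _ _ mrestr_hom[OF assms]]
    cring.axioms(1)[OF algebra.M_cring[OF msecs_algebra[OF assms(1)]]]
    cring.axioms(1)[OF algebra.M_cring[OF msecs_algebra[OF assms(2)]]] by blast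

lemma restr_ring_hom_ring:
  assumes "openin (pts Y) U" "openin (pts Y) V" "V \<subseteq> U"
  shows "ring_hom_ring (secs Y U) (secs Y V) (restr Y U V)"
  using ring_hom_ringI2[OF _ _ restr_hom[OF assms]]
    cring.axioms(1)[OF secs_cring[OF assms(1)]] cring.axioms(1)[OF secs_cring[OF assms(2)]] by blast

end

section \<open>Trivializations and the local trace\<close>

locale trivialized_sheaf = algebra_sheaf Y A
  for Y :: "('x, 'r) ringed_space" and A :: "('x, 'r, 'a) module_sheaf" +
  fixes n :: nat and V :: "'x set" and \<phi> :: "'x set \<Rightarrow> (nat \<Rightarrow> 'r) \<Rightarrow> 'a"
  assumes triv: "trivialization Y A n V \<phi>"
begin

definition basis_sec :: "'x set \<Rightarrow> nat \<Rightarrow> 'a" where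
  "basis_sec W j = \<phi> W (\<lambda>i\<in>{..<n}. if i = j then \<one>\<^bsub>secs Y W\<^esub> else \<zero>\<^bsub>secs Y W\<^esub>)"

definition coord :: "'x set \<Rightarrow> nat \<Rightarrow> 'a \<Rightarrow> 'r" where
  "coord W j x = inv_into ({..<n} \<rightarrow>\<^sub>E carrier (secs Y W)) (\<phi> W) x j"

abbreviation vecs :: "'x set \<Rightarrow> (nat \<Rightarrow> 'r) set" where
  "vecs W \<equiv> {..<n} \<rightarrow>\<^sub>E carrier (secs Y W)"

lemma V_open: "openin (pts Y) V"
  using triv unfolding trivialization_def by blast

lemma sub_iso: "module_sheaf_iso (open_subspace Y V) (free_sheaf (open_subspace Y V) n) A \<phi>"
  using triv unfolding trivialization_def by blast

lemma open_sub: "openin (pts (open_subspace Y V)) W \<longleftrightarrow> openin (pts Y) W \<and> W \<subseteq> V"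
  unfolding open_subspace_def using openin_open_subtopology[OF V_open] by simp

lemma secs_sub: "secs (open_subspace Y V) = secs Y" "restr (open_subspace Y V) = restr Y"
  unfolding open_subspace_def by auto

lemma free_carrier: "carrier (msecs (free_sheaf (open_subspace Y V) n) W) = vecs W"
  unfolding free_sheaf_def by (simp add: secs_sub)

text \<open>Restricting the space only shrinks its topology, so the very same family
  \<open>\<phi>\<close> trivializes over a smaller open set.\<close>

lemma trivialization_subset:
  assumes W: "openin (pts Y) W" "W \<subseteq> V"
  shows "trivialization Y A n W \<phi>"
proof -
  have "openin (pts (open_subspace Y W)) Z \<longleftrightarrow> openin (pts Y) Z \<and> Z \<subseteq> W" for Z
    unfolding open_subspace_def using openin_open_subtopology[OF W(1)] by simp
  moreover have "secs (open_subspace Y W) = secs (open_subspace Y V)"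
    "free_sheaf (open_subspace Y W) n = free_sheaf (open_subspace Y V) n"
    unfolding open_subspace_def free_sheaf_def by auto
  ultimately show ?thesis
    using W sub_iso unfolding trivialization_def module_sheaf_iso_def module_sheaf_hom_def
    by (simp add: open_sub subset_trans[OF _ W(2)])
qed

lemma \<phi>_bij:
  assumes W: "openin (pts Y) W" "W \<subseteq> V"
  shows "bij_betw (\<phi> W) (vecs W) (carrier (msecs A W))"
  using sub_iso W unfolding module_sheaf_iso_def open_sub free_carrier by blast

lemma \<phi>_linear:
  assumes W: "openin (pts Y) W" "W \<subseteq> V"
  shows "\<phi> W \<in> linear_maps (secs Y W) (msecs (free_sheaf (open_subspace Y V) n) W) (msecs A W)"
  using sub_iso W unfolding module_sheaf_iso_def module_sheaf_hom_def open_sub secs_sub by blast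

lemma \<phi>_closed:
  assumes W: "openin (pts Y) W" "W \<subseteq> V" and "c \<in> vecs W"
  shows "\<phi> W c \<in> carrier (msecs A W)"
  using bij_betwE[OF \<phi>_bij[OF W]] assms(3) by blast

lemma \<phi>_add:
  assumes W: "openin (pts Y) W" "W \<subseteq> V" and cd: "c \<in> vecs W" "d \<in> vecs W"
  shows "\<phi> W (\<lambda>i\<in>{..<n}. c i \<oplus>\<^bsub>secs Y W\<^esub> d i) = \<phi> W c \<oplus>\<^bsub>msecs A W\<^esub> \<phi> W d"
proof -
  have "\<phi> W \<in> hom (add_monoid (msecs (free_sheaf (open_subspace Y V) n) W)) (add_monoid (msecs A W))"
    using \<phi>_linear[OF W] unfolding linear_maps_def by blast
  from hom_mult[OF this, of c d] show ?thesis
    using cd free_carrier[of W] by (simp add: free_sheaf_def secs_sub)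
qed

lemma \<phi>_smult:
  assumes W: "openin (pts Y) W" "W \<subseteq> V" and c: "k \<in> carrier (secs Y W)" "c \<in> vecs W"
  shows "\<phi> W (\<lambda>i\<in>{..<n}. k \<otimes>\<^bsub>secs Y W\<^esub> c i) = k \<odot>\<^bsub>msecs A W\<^esub> \<phi> W c"
proof -
  have "\<phi> W (k \<odot>\<^bsub>msecs (free_sheaf (open_subspace Y V) n) W\<^esub> c) = k \<odot>\<^bsub>msecs A W\<^esub> \<phi> W c"
    using \<phi>_linear[OF W] c unfolding linear_maps_def free_carrier by blast
  then show ?thesis by (simp add: free_sheaf_def secs_sub)
qed

lemma \<phi>_restr:
  assumes W: "openin (pts Y) W" "W \<subseteq> V" and Z: "openin (pts Y) Z" "Z \<subseteq> W" and c: "c \<in> vecs W"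
  shows "\<phi> Z (\<lambda>i\<in>{..<n}. restr Y W Z (c i)) = mrestr A W Z (\<phi> W c)"
proof -
  have "\<phi> Z (mrestr (free_sheaf (open_subspace Y V) n) W Z c) = mrestr A W Z (\<phi> W c)"
    using sub_iso[unfolded module_sheaf_iso_def module_sheaf_hom_def open_sub free_carrier,
        THEN conjunct1, THEN conjunct2, rule_format, of W Z c] W Z c by simp
  then show ?thesis by (simp add: free_sheaf_def secs_sub)
qed

lemma coord_\<phi>:
  assumes W: "openin (pts Y) W" "W \<subseteq> V" and c: "c \<in> vecs W"
  shows "coord W j (\<phi> W c) = c j"
  unfolding coord_def using inv_into_f_f[OF bij_betw_imp_inj_on[OF \<phi>_bij[OF W]] c] by simp

lemma coord_vec:
  assumes W: "openin (pts Y) W" "W \<subseteq> V" and x: "x \<in> carrier (msecs A W)"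
  shows "(\<lambda>i\<in>{..<n}. coord W i x) \<in> vecs W" "\<phi> W (\<lambda>i\<in>{..<n}. coord W i x) = x"
proof -
  have "x \<in> \<phi> W ` vecs W" using \<phi>_bij[OF W] x unfolding bij_betw_def by simp
  then obtain c where c: "x = \<phi> W c" "c \<in> vecs W" by (rule imageE)
  have "(\<lambda>i\<in>{..<n}. coord W i x) = restrict c {..<n}"
    unfolding c(1) by (intro restrict_ext coord_\<phi>[OF W c(2)])
  also have "\<dots> = c" using c(2) by (rule PiE_restrict)
  finally have "(\<lambda>i\<in>{..<n}. coord W i x) = c" .
  then show "(\<lambda>i\<in>{..<n}. coord W i x) \<in> vecs W" "\<phi> W (\<lambda>i\<in>{..<n}. coord W i x) = x"
    using c by simp_all
qed

lemma coord_closed: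
  assumes "openin (pts Y) W" "W \<subseteq> V" "x \<in> carrier (msecs A W)" "j < n"
  shows "coord W j x \<in> carrier (secs Y W)"
  using coord_vec(1)[OF assms(1-3)] assms(4) by (auto simp: PiE_iff)

lemma coord_ext:
  assumes W: "openin (pts Y) W" "W \<subseteq> V" and xy: "x \<in> carrier (msecs A W)" "y \<in> carrier (msecs A W)"
    and eq: "\<And>j. j < n \<Longrightarrow> coord W j x = coord W j y"
  shows "x = y"
proof -
  have "(\<lambda>i\<in>{..<n}. coord W i x) = (\<lambda>i\<in>{..<n}. coord W i y)" using eq by (intro restrict_ext) auto
  then show ?thesis using coord_vec(2)[OF W xy(1)] coord_vec(2)[OF W xy(2)] by metis
qed

lemma unit_vec:
  assumes "openin (pts Y) W"
  shows "(\<lambda>i\<in>{..<n}. if i = j then \<one>\<^bsub>secs Y W\<^esub> else \<zero>\<^bsub>secs Y W\<^esub>) \<in> vecs W"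
  using cring.cring_simprules(2,6)[OF secs_cring[OF assms]] by auto

lemma basis_sec_closed:
  assumes W: "openin (pts Y) W" "W \<subseteq> V"
  shows "basis_sec W j \<in> carrier (msecs A W)"
  unfolding basis_sec_def using \<phi>_closed[OF W unit_vec[OF W(1)]] .

lemma coord_basis_sec:
  assumes W: "openin (pts Y) W" "W \<subseteq> V" and "i < n"
  shows "coord W i (basis_sec W j) = (if i = j then \<one>\<^bsub>secs Y W\<^esub> else \<zero>\<^bsub>secs Y W\<^esub>)"
  unfolding basis_sec_def using coord_\<phi>[OF W unit_vec[OF W(1)]] assms(3) by simp

lemma coord_add:
  assumes W: "openin (pts Y) W" "W \<subseteq> V" and xy: "x \<in> carrier (msecs A W)" "y \<in> carrier (msecs A W)" and j: "j < n"
  shows "coord W j (x \<oplus>\<^bsub>msecs A W\<^esub> y) = coord W j x \<oplus>\<^bsub>secs Y W\<^esub> coord W j y"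
proof -
  let ?c = "\<lambda>x. \<lambda>i\<in>{..<n}. coord W i x"
  have "(\<lambda>i\<in>{..<n}. ?c x i \<oplus>\<^bsub>secs Y W\<^esub> ?c y i) \<in> vecs W"
    using coord_closed[OF W xy(1)] coord_closed[OF W xy(2)] cring.cring_simprules(1)[OF secs_cring[OF W(1)]] by auto
  from coord_\<phi>[OF W this, of j] show ?thesis
    using \<phi>_add[OF W coord_vec(1)[OF W xy(1)] coord_vec(1)[OF W xy(2)]] coord_vec(2)[OF W xy(1)]
      coord_vec(2)[OF W xy(2)] j by simp
qed

lemma coord_smult:
  assumes W: "openin (pts Y) W" "W \<subseteq> V" and k: "k \<in> carrier (secs Y W)" and x: "x \<in> carrier (msecs A W)" and j: "j < n"
  shows "coord W j (k \<odot>\<^bsub>msecs A W\<^esub> x) = k \<otimes>\<^bsub>secs Y W\<^esub> coord W j x"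
proof -
  let ?c = "\<lambda>x. \<lambda>i\<in>{..<n}. coord W i x"
  have "(\<lambda>i\<in>{..<n}. k \<otimes>\<^bsub>secs Y W\<^esub> ?c x i) \<in> vecs W"
    using coord_closed[OF W x] k cring.cring_simprules(5)[OF secs_cring[OF W(1)]] by auto
  from coord_\<phi>[OF W this, of j] show ?thesis
    using \<phi>_smult[OF W k coord_vec(1)[OF W x]] coord_vec(2)[OF W x] j by simp
qed

lemma coord_restr:
  assumes W: "openin (pts Y) W" "W \<subseteq> V" and Z: "openin (pts Y) Z" "Z \<subseteq> W"
    and x: "x \<in> carrier (msecs A W)" and j: "j < n"
  shows "coord Z j (mrestr A W Z x) = restr Y W Z (coord W j x)"
proof -
  let ?c = "\<lambda>i\<in>{..<n}. coord W i x"
  have ZV: "Z \<subseteq> V" using W Z by blast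
  have "(\<lambda>i\<in>{..<n}. restr Y W Z (?c i)) \<in> vecs Z"
    using coord_closed[OF W x] restr_closed[OF W(1) Z] by auto
  from coord_\<phi>[OF Z(1) ZV this, of j] show ?thesis
    using \<phi>_restr[OF W Z coord_vec(1)[OF W x]] coord_vec(2)[OF W x] j by simp
qed

lemma basis_sec_restr:
  assumes W: "openin (pts Y) W" "W \<subseteq> V" and Z: "openin (pts Y) Z" "Z \<subseteq> W"
  shows "mrestr A W Z (basis_sec W j) = basis_sec Z j"
proof -
  interpret r: ring_hom_ring "secs Y W" "secs Y Z" "restr Y W Z"
    using restr_ring_hom_ring[OF W(1) Z] .
  have "(\<lambda>i\<in>{..<n}. restr Y W Z ((\<lambda>i\<in>{..<n}. if i = j then \<one>\<^bsub>secs Y W\<^esub> else \<zero>\<^bsub>secs Y W\<^esub>) i))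
      = (\<lambda>i\<in>{..<n}. if i = j then \<one>\<^bsub>secs Y Z\<^esub> else \<zero>\<^bsub>secs Y Z\<^esub>)"
    by (intro restrict_ext) auto
  then show ?thesis unfolding basis_sec_def using \<phi>_restr[OF W Z unit_vec[OF W(1)], of j] by simp
qed

lemma dual_basis_triv:
  assumes W: "openin (pts Y) W" "W \<subseteq> V"
  shows "dual_basis (secs Y W) (msecs A W) n (basis_sec W) (coord W)"
proof -
  interpret a: algebra "secs Y W" "msecs A W" using msecs_algebra[OF W(1)] .
  let ?O = "secs Y W" and ?M = "msecs A W"
  have expand: "x = (\<Oplus>\<^bsub>?M\<^esub>j\<in>{..<n}. coord W j x \<odot>\<^bsub>?M\<^esub> basis_sec W j)" if x: "x \<in> carrier ?M" for x
  proof -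
    have c: "coord W j x \<in> carrier ?O" if "j < n" for j using coord_closed[OF W x that] .
    \<comment> \<open>The coordinate vector of \<open>x\<close> cut off after its first
      \<open>m\<close> entries. Additivity of \<open>\<phi> W\<close> is then used one coordinate at
      a time, by induction on \<open>m\<close>.\<close>
    define tr where "tr m = (\<lambda>i\<in>{..<n}. if i < m then coord W i x else \<zero>\<^bsub>?O\<^esub>)" for m
    have tr: "tr m \<in> vecs W" for m unfolding tr_def using c by auto
    have "\<phi> W (tr m) = (\<Oplus>\<^bsub>?M\<^esub>j\<in>{..<m}. coord W j x \<odot>\<^bsub>?M\<^esub> basis_sec W j)" if "m \<le> n" for m
      using that
    proof (induction m)
      case 0
      \<comment> \<open>The zero vector is zero times itself, so homogeneity of
        \<open>\<phi> W\<close> sends it to zero.\<close>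
      have "tr 0 = (\<lambda>i\<in>{..<n}. \<zero>\<^bsub>?O\<^esub> \<otimes>\<^bsub>?O\<^esub> tr 0 i)" unfolding tr_def by (intro restrict_ext) auto
      then have "\<phi> W (tr 0) = \<zero>\<^bsub>?O\<^esub> \<odot>\<^bsub>?M\<^esub> \<phi> W (tr 0)" using \<phi>_smult[OF W a.R.zero_closed tr, of 0] by simp
      also have "\<dots> = \<zero>\<^bsub>?M\<^esub>" using \<phi>_closed[OF W tr] by simp
      finally show ?case by simp
    next
      case (Suc m)
      let ?u = "\<lambda>i\<in>{..<n}. if i = m then \<one>\<^bsub>?O\<^esub> else \<zero>\<^bsub>?O\<^esub>"
      let ?cu = "\<lambda>i\<in>{..<n}. coord W m x \<otimes>\<^bsub>?O\<^esub> ?u i"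
      have m: "m < n" using Suc.prems by simp
      have cu: "?cu \<in> vecs W" using c[OF m] by auto
      have "tr (Suc m) = (\<lambda>i\<in>{..<n}. tr m i \<oplus>\<^bsub>?O\<^esub> ?cu i)"
        unfolding tr_def using c[OF m] c by (intro restrict_ext) (auto simp: less_Suc_eq)
      then have "\<phi> W (tr (Suc m)) = \<phi> W (tr m) \<oplus>\<^bsub>?M\<^esub> coord W m x \<odot>\<^bsub>?M\<^esub> basis_sec W m"
        using \<phi>_add[OF W tr cu, of m] \<phi>_smult[OF W c[OF m] unit_vec[OF W(1)], of m] unfolding basis_sec_def by simp
      also have "\<dots> = (\<Oplus>\<^bsub>?M\<^esub>j\<in>{..<Suc m}. coord W j x \<odot>\<^bsub>?M\<^esub> basis_sec W j)"
        unfolding lessThan_Suc using Suc c basis_sec_closed[OF W]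
        by (subst a.M.finsum_insert) (auto intro!: a.M.finsum_closed a.M.a_comm)
      finally show ?case .
    qed
    from this[of n] have "\<phi> W (tr n) = (\<Oplus>\<^bsub>?M\<^esub>j\<in>{..<n}. coord W j x \<odot>\<^bsub>?M\<^esub> basis_sec W j)" by simp
    moreover have "tr n = (\<lambda>i\<in>{..<n}. coord W i x)" unfolding tr_def by (intro restrict_ext) auto
    ultimately show ?thesis using coord_vec(2)[OF W x] by simp
  qed
  show ?thesis unfolding dual_basis_def
    by (intro conjI allI impI ballI;
        (rule basis_sec_closed[OF W] coord_closed[OF W] coord_add[OF W] coord_smult[OF W] expand);
        assumption)
qed

lemma local_trace_eq:
  "local_trace Y A n W \<phi> a = (\<Oplus>\<^bsub>secs Y W\<^esub>j\<in>{..<n}. coord W j (a \<otimes>\<^bsub>msecs A W\<^esub> basis_sec W j))"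
  unfolding local_trace_def coord_def basis_sec_def ..

lemma local_trace_closed:
  assumes W: "openin (pts Y) W" "W \<subseteq> V" and a: "a \<in> carrier (msecs A W)"
  shows "local_trace Y A n W \<phi> a \<in> carrier (secs Y W)"
proof -
  interpret a: algebra "secs Y W" "msecs A W" using msecs_algebra[OF W(1)] .
  show ?thesis unfolding local_trace_eq
    using coord_closed[OF W] basis_sec_closed[OF W] a by (intro a.R.finsum_closed) auto
qed

text \<open>Coordinates and basis sections of a trivialization both commute with restriction, hence
  so does the trace of the multiplication matrix.\<close>

lemma local_trace_restr:
  assumes W: "openin (pts Y) W" "W \<subseteq> V" and Z: "openin (pts Y) Z" "Z \<subseteq> W" and a: "a \<in> carrier (msecs A W)"
  shows "restr Y W Z (local_trace Y A n W \<phi> a) = local_trace Y A n Z \<phi> (mrestr A W Z a)"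
proof -
  interpret a: algebra "secs Y W" "msecs A W" using msecs_algebra[OF W(1)] .
  interpret z: algebra "secs Y Z" "msecs A Z" using msecs_algebra[OF Z(1)] .
  interpret r: ring_hom_ring "secs Y W" "secs Y Z" "restr Y W Z" using restr_ring_hom_ring[OF W(1) Z] .
  interpret rc: ring_hom_cring "secs Y W" "secs Y Z" "restr Y W Z"
    using r.homh a.R_cring z.R_cring by (intro ring_hom_cringI) (auto intro: r.ring_hom_ring_axioms)
  have ab: "a \<otimes>\<^bsub>msecs A W\<^esub> basis_sec W j \<in> carrier (msecs A W)" for j using a basis_sec_closed[OF W] by simp
  have "restr Y W Z (local_trace Y A n W \<phi> a) =
      (\<Oplus>\<^bsub>secs Y Z\<^esub>j\<in>{..<n}. restr Y W Z (coord W j (a \<otimes>\<^bsub>msecs A W\<^esub> basis_sec W j)))"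
    unfolding local_trace_eq using coord_closed[OF W ab] by (subst rc.hom_finsum) (auto simp: comp_def)
  also have "\<dots> = local_trace Y A n Z \<phi> (mrestr A W Z a)"
    unfolding local_trace_eq
  proof (rule z.R.finsum_cong')
    have ZV: "Z \<subseteq> V" using W Z by blast
    show "(\<lambda>j. coord Z j (mrestr A W Z a \<otimes>\<^bsub>msecs A Z\<^esub> basis_sec Z j)) \<in> {..<n} \<rightarrow> carrier (secs Y Z)"
      using coord_closed[OF Z(1) ZV] basis_sec_closed[OF Z(1) ZV] A.restr_closed[OF W(1) Z a] by auto
    show "restr Y W Z (coord W j (a \<otimes>\<^bsub>msecs A W\<^esub> basis_sec W j)) =
        coord Z j (mrestr A W Z a \<otimes>\<^bsub>msecs A Z\<^esub> basis_sec Z j)" if "j \<in> {..<n}" for j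
      using coord_restr[OF W Z ab, of j] that ring_hom_mult[OF mrestr_hom[OF W(1) Z] a basis_sec_closed[OF W]]
        basis_sec_restr[OF W Z] by simp
  qed auto
  finally show ?thesis .
qed

lemma local_trace_add:
  assumes a: "a \<in> carrier (msecs A V)" "b \<in> carrier (msecs A V)"
  shows "local_trace Y A n V \<phi> (a \<oplus>\<^bsub>msecs A V\<^esub> b)
    = local_trace Y A n V \<phi> a \<oplus>\<^bsub>secs Y V\<^esub> local_trace Y A n V \<phi> b"
proof -
  note W = V_open subset_refl[of V]
  interpret a: algebra "secs Y V" "msecs A V" using msecs_algebra[OF V_open] .
  have "(a \<oplus>\<^bsub>msecs A V\<^esub> b) \<otimes>\<^bsub>msecs A V\<^esub> x = a \<otimes>\<^bsub>msecs A V\<^esub> x \<oplus>\<^bsub>msecs A V\<^esub> b \<otimes>\<^bsub>msecs A V\<^esub> x"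
    if "x \<in> carrier (msecs A V)" for x
    using cring.cring_simprules(13)[OF a.M_cring] a that by blast
  then have "local_trace Y A n V \<phi> (a \<oplus>\<^bsub>msecs A V\<^esub> b) = (\<Oplus>\<^bsub>secs Y V\<^esub>j\<in>{..<n}.
      coord V j (a \<otimes>\<^bsub>msecs A V\<^esub> basis_sec V j) \<oplus>\<^bsub>secs Y V\<^esub> coord V j (b \<otimes>\<^bsub>msecs A V\<^esub> basis_sec V j))"
    unfolding local_trace_eq using a basis_sec_closed[OF W] coord_closed[OF W]
    by (intro a.R.finsum_cong') (auto simp: coord_add[OF W])
  also have "\<dots> = local_trace Y A n V \<phi> a \<oplus>\<^bsub>secs Y V\<^esub> local_trace Y A n V \<phi> b"
    unfolding local_trace_eq using a basis_sec_closed[OF W] coord_closed[OF W]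
    by (intro a.R.finsum_addf) auto
  finally show ?thesis .
qed

lemma local_trace_smult:
  assumes k: "k \<in> carrier (secs Y V)" and a: "a \<in> carrier (msecs A V)"
  shows "local_trace Y A n V \<phi> (k \<odot>\<^bsub>msecs A V\<^esub> a) = k \<otimes>\<^bsub>secs Y V\<^esub> local_trace Y A n V \<phi> a"
proof -
  note W = V_open subset_refl[of V]
  interpret a: algebra "secs Y V" "msecs A V" using msecs_algebra[OF V_open] .
  have "local_trace Y A n V \<phi> (k \<odot>\<^bsub>msecs A V\<^esub> a) = (\<Oplus>\<^bsub>secs Y V\<^esub>j\<in>{..<n}.
      k \<otimes>\<^bsub>secs Y V\<^esub> coord V j (a \<otimes>\<^bsub>msecs A V\<^esub> basis_sec V j))"
    unfolding local_trace_eq using a k basis_sec_closed[OF W] coord_closed[OF W]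
    by (intro a.R.finsum_cong') (auto simp: coord_smult[OF W] a.smult_assoc2)
  also have "\<dots> = k \<otimes>\<^bsub>secs Y V\<^esub> local_trace Y A n V \<phi> a"
    unfolding local_trace_eq using a k basis_sec_closed[OF W] coord_closed[OF W]
    by (intro semiring.finsum_rdistr[OF ring.semiring[OF cring.axioms(1)[OF a.R_cring]], symmetric]) auto
  finally show ?thesis .
qed

end

section \<open>Extending and killing sections on trivial pieces\<close>

lemma (in cring) Units_l_cancel_zero:
  assumes "u \<in> Units R" "x \<in> carrier R" "u \<otimes> x = \<zero>"
  shows "x = \<zero>"
  using Units_l_cancel[OF assms(1,2) zero_closed] assms(3) r_null[OF Units_closed[OF assms(1)]] by simp

context affine_chart
begin

lemma D_product:
  assumes "k \<in> carrier (secs Y U)" "h \<in> carrier (secs Y U)"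
  shows "openin (pts Y) (D (k \<otimes>\<^bsub>secs Y U\<^esub> h))" "D (k \<otimes>\<^bsub>secs Y U\<^esub> h) \<subseteq> D k" "D (k \<otimes>\<^bsub>secs Y U\<^esub> h) \<subseteq> U"
  using D_mult[OF assms] D_subset[OF assms(1)] D_open[OF cring.cring_simprules(5)[OF secs_cring[OF U_open] assms]]
  by auto

lemma restr_D_hom:
  assumes "openin (pts Y) W" "W \<subseteq> U"
  shows "ring_hom_ring (secs Y U) (secs Y W) (restr Y U W)"
  using ring_hom_ringI2[OF _ _ restr_hom[OF U_open assms]]
    cring.axioms(1)[OF secs_cring[OF U_open]] cring.axioms(1)[OF secs_cring[OF assms(1)]] by blast

text \<open>Clear the denominator of \<open>c\<close> by a power of \<open>k\<close>. The resulting
  section over \<open>U\<close> vanishes on D(kh), so a power of \<open>k \<otimes> h\<close> kills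
  it; over \<open>D k\<close> the powers of \<open>k\<close> are units and can be cancelled.\<close>

lemma kill_on_basic:
  assumes k: "k \<in> carrier (secs Y U)" and h: "h \<in> carrier (secs Y U)" and c: "c \<in> carrier (secs Y (D k))"
    and z: "restr Y (D k) (D (k \<otimes>\<^bsub>secs Y U\<^esub> h)) c = \<zero>\<^bsub>secs Y (D (k \<otimes>\<^bsub>secs Y U\<^esub> h))\<^esub>"
  shows "\<exists>m0::nat. \<forall>m\<ge>m0. restr Y U (D k) (h [^]\<^bsub>secs Y U\<^esub> m) \<otimes>\<^bsub>secs Y (D k)\<^esub> c = \<zero>\<^bsub>secs Y (D k)\<^esub>"
proof -
  let ?O = "secs Y U" and ?K = "secs Y (D k)" and ?r = "restr Y U (D k)" and ?kh = "k \<otimes>\<^bsub>secs Y U\<^esub> h"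
  note kh = D_product[OF k h] and Dk = D_open[OF k] D_subset[OF k]
  interpret O: cring ?O using secs_cring[OF U_open] .
  interpret K: cring ?K using secs_cring[OF Dk(1)] .
  interpret r: ring_hom_ring ?O ?K ?r using restr_D_hom[OF Dk] .
  interpret q: ring_hom_ring ?K "secs Y (D ?kh)" "restr Y (D k) (D ?kh)"
    using ring_hom_ringI2[OF K.ring_axioms _ restr_hom[OF Dk(1) kh(1,2)]] cring.axioms(1)[OF secs_cring[OF kh(1)]] by blast
  have khc: "?kh \<in> carrier ?O" using k h by simp
  obtain N :: nat and a where a: "a \<in> carrier ?O" "?r (k [^]\<^bsub>?O\<^esub> N) \<otimes>\<^bsub>?K\<^esub> c = ?r a"
    using frac[OF k c] by blast
  have "restr Y U (D ?kh) a = restr Y (D k) (D ?kh) (?r a)"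
    using restr_trans[OF U_open Dk(1) kh(1) kh(2) Dk(2) a(1)] by simp
  also have "\<dots> = \<zero>\<^bsub>secs Y (D ?kh)\<^esub>" unfolding a(2)[symmetric] using c k z by simp
  finally obtain m0 :: nat where m0: "?kh [^]\<^bsub>?O\<^esub> m0 \<otimes>\<^bsub>?O\<^esub> a = \<zero>\<^bsub>?O\<^esub>" using kill[OF khc a(1)] by blast
  have u: "?r (k [^]\<^bsub>?O\<^esub> (i::nat)) \<in> Units ?K" for i
    using K.Units_pow_closed[OF D_unit[OF k]] r.hom_nat_pow[OF k] by simp
  have "?r (h [^]\<^bsub>?O\<^esub> m) \<otimes>\<^bsub>?K\<^esub> c = \<zero>\<^bsub>?K\<^esub>" if m: "m \<ge> m0" for m
  proof -
    have rc: "?r (h [^]\<^bsub>?O\<^esub> (i::nat)) \<in> carrier ?K" "?r (k [^]\<^bsub>?O\<^esub> i) \<in> carrier ?K" for i using h k by auto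
    have "?r (k [^]\<^bsub>?O\<^esub> m0) \<otimes>\<^bsub>?K\<^esub> (?r (k [^]\<^bsub>?O\<^esub> N) \<otimes>\<^bsub>?K\<^esub> (?r (h [^]\<^bsub>?O\<^esub> m0) \<otimes>\<^bsub>?K\<^esub> c))
        = ?r (k [^]\<^bsub>?O\<^esub> m0) \<otimes>\<^bsub>?K\<^esub> ?r (h [^]\<^bsub>?O\<^esub> m0) \<otimes>\<^bsub>?K\<^esub> (?r (k [^]\<^bsub>?O\<^esub> N) \<otimes>\<^bsub>?K\<^esub> c)"
      using rc c by (simp only: K.m_ac K.m_closed)
    also have "\<dots> = ?r (?kh [^]\<^bsub>?O\<^esub> m0 \<otimes>\<^bsub>?O\<^esub> a)"
      unfolding a(2) using h k a(1) by (simp add: O.nat_pow_distrib)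
    also have "\<dots> = \<zero>\<^bsub>?K\<^esub>" unfolding m0 by simp
    finally have "?r (k [^]\<^bsub>?O\<^esub> m0) \<otimes>\<^bsub>?K\<^esub> (?r (k [^]\<^bsub>?O\<^esub> N) \<otimes>\<^bsub>?K\<^esub> (?r (h [^]\<^bsub>?O\<^esub> m0) \<otimes>\<^bsub>?K\<^esub> c)) = \<zero>\<^bsub>?K\<^esub>" .
    note cancel = K.Units_l_cancel_zero[OF u K.m_closed[OF rc(2) K.m_closed[OF rc(1) c]] this]
    have "?r (h [^]\<^bsub>?O\<^esub> m0) \<otimes>\<^bsub>?K\<^esub> c = \<zero>\<^bsub>?K\<^esub>"
      by (rule K.Units_l_cancel_zero[OF u K.m_closed[OF rc(1) c] cancel])
    moreover have "?r (h [^]\<^bsub>?O\<^esub> m) = ?r (h [^]\<^bsub>?O\<^esub> (m - m0)) \<otimes>\<^bsub>?K\<^esub> ?r (h [^]\<^bsub>?O\<^esub> m0)"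
      using h m O.nat_pow_mult[OF h, of "m - m0" m0] by (simp flip: r.hom_mult)
    ultimately show ?thesis using rc c by (simp add: K.m_assoc)
  qed
  then show ?thesis by blast
qed

text \<open>A power of \<open>k \<otimes> h\<close> turns \<open>c\<close> into the restriction of a
  section \<open>a\<close> over \<open>U\<close>. Over \<open>D k\<close> the power of
  \<open>k\<close> can be divided out again, which leaves only the power of
  \<open>h\<close>.\<close>

lemma extend_to_basic:
  assumes k: "k \<in> carrier (secs Y U)" and h: "h \<in> carrier (secs Y U)"
    and c: "c \<in> carrier (secs Y (D (k \<otimes>\<^bsub>secs Y U\<^esub> h)))"
  shows "\<exists>m0::nat. \<forall>m\<ge>m0. \<exists>d\<in>carrier (secs Y (D k)). restr Y (D k) (D (k \<otimes>\<^bsub>secs Y U\<^esub> h)) d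
    = restr Y U (D (k \<otimes>\<^bsub>secs Y U\<^esub> h)) (h [^]\<^bsub>secs Y U\<^esub> m) \<otimes>\<^bsub>secs Y (D (k \<otimes>\<^bsub>secs Y U\<^esub> h))\<^esub> c"
proof -
  let ?O = "secs Y U" and ?K = "secs Y (D k)" and ?r = "restr Y U (D k)" and ?kh = "k \<otimes>\<^bsub>secs Y U\<^esub> h"
  let ?Q = "secs Y (D ?kh)" and ?q = "restr Y (D k) (D ?kh)" and ?p = "restr Y U (D ?kh)"
  note kh = D_product[OF k h] and Dk = D_open[OF k] D_subset[OF k]
  interpret O: cring ?O using secs_cring[OF U_open] .
  interpret K: cring ?K using secs_cring[OF Dk(1)] .
  interpret Q: cring ?Q using secs_cring[OF kh(1)] .
  interpret r: ring_hom_ring ?O ?K ?r using restr_D_hom[OF Dk] .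
  interpret p: ring_hom_ring ?O ?Q ?p using restr_D_hom[OF kh(1,3)] .
  interpret q: ring_hom_ring ?K ?Q ?q
    using ring_hom_ringI2[OF K.ring_axioms Q.ring_axioms restr_hom[OF Dk(1) kh(1,2)]] .
  have qr: "?q (?r a) = ?p a" if "a \<in> carrier ?O" for a
    using restr_trans[OF U_open Dk(1) kh(1) kh(2) Dk(2) that] .
  have khc: "?kh \<in> carrier ?O" using k h by simp
  obtain N :: nat and a where a: "a \<in> carrier ?O" "?p (?kh [^]\<^bsub>?O\<^esub> N) \<otimes>\<^bsub>?Q\<^esub> c = ?p a"
    using frac[OF khc c] by blast
  have u: "?r (k [^]\<^bsub>?O\<^esub> N) \<in> Units ?K"
    using K.Units_pow_closed[OF D_unit[OF k]] r.hom_nat_pow[OF k] by simp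
  define v where "v = inv\<^bsub>?K\<^esub> (?r (k [^]\<^bsub>?O\<^esub> N))"
  have v: "v \<in> carrier ?K" "v \<otimes>\<^bsub>?K\<^esub> ?r (k [^]\<^bsub>?O\<^esub> N) = \<one>\<^bsub>?K\<^esub>"
    unfolding v_def using u by (auto intro: K.Units_l_inv)
  have qv: "?q v \<otimes>\<^bsub>?Q\<^esub> ?p (k [^]\<^bsub>?O\<^esub> N) = \<one>\<^bsub>?Q\<^esub>"
    using arg_cong[OF v(2), of ?q] v(1) k qr[of "k [^]\<^bsub>?O\<^esub> N"] by simp
  have "\<exists>d\<in>carrier ?K. ?q d = ?p (h [^]\<^bsub>?O\<^esub> m) \<otimes>\<^bsub>?Q\<^esub> c" if m: "m \<ge> N" for m
  proof
    \<comment> \<open>\<open>v\<close> inverts the \<open>N\<close>-th power of \<open>k\<close>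
      over \<open>D k\<close>; the surplus power of \<open>h\<close> covers every exponent
      \<open>m \<ge> N\<close>.\<close>
    let ?d = "?r (h [^]\<^bsub>?O\<^esub> (m - N)) \<otimes>\<^bsub>?K\<^esub> (v \<otimes>\<^bsub>?K\<^esub> ?r a)"
    show "?d \<in> carrier ?K" using v a h by simp
    have pc: "?p (h [^]\<^bsub>?O\<^esub> (i::nat)) \<in> carrier ?Q" "?p (k [^]\<^bsub>?O\<^esub> i) \<in> carrier ?Q" "?q v \<in> carrier ?Q" for i
      using h k v by auto
    have "?q ?d = ?p (h [^]\<^bsub>?O\<^esub> (m - N)) \<otimes>\<^bsub>?Q\<^esub> (?q v \<otimes>\<^bsub>?Q\<^esub> ?p a)"
      using v(1) a(1) h qr[OF a(1)] qr[of "h [^]\<^bsub>?O\<^esub> (m - N)"] by simp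
    also have "\<dots> = ?p (h [^]\<^bsub>?O\<^esub> (m - N)) \<otimes>\<^bsub>?Q\<^esub> (?q v \<otimes>\<^bsub>?Q\<^esub> (?p (k [^]\<^bsub>?O\<^esub> N) \<otimes>\<^bsub>?Q\<^esub> ?p (h [^]\<^bsub>?O\<^esub> N) \<otimes>\<^bsub>?Q\<^esub> c))"
      unfolding a(2)[symmetric] using h k by (simp add: O.nat_pow_distrib)
    also have "\<dots> = (?q v \<otimes>\<^bsub>?Q\<^esub> ?p (k [^]\<^bsub>?O\<^esub> N)) \<otimes>\<^bsub>?Q\<^esub> (?p (h [^]\<^bsub>?O\<^esub> (m - N)) \<otimes>\<^bsub>?Q\<^esub> ?p (h [^]\<^bsub>?O\<^esub> N)) \<otimes>\<^bsub>?Q\<^esub> c"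
      using pc c by (simp only: Q.m_ac Q.m_closed)
    also have "\<dots> = ?p (h [^]\<^bsub>?O\<^esub> m) \<otimes>\<^bsub>?Q\<^esub> c"
      unfolding qv using h m c O.nat_pow_mult[OF h, of "m - N" N] by (simp flip: p.hom_mult)
    finally show "?q ?d = ?p (h [^]\<^bsub>?O\<^esub> m) \<otimes>\<^bsub>?Q\<^esub> c" .
  qed
  then show ?thesis by blast
qed

end

locale trivialized_affine = trivialized_sheaf Y A n V \<phi> + affine_chart Y U D
  for Y :: "('x, 'r) ringed_space" and A :: "('x, 'r, 'a) module_sheaf" and n V \<phi> U D
begin

text \<open>On a trivial piece the claim is the one for the structure sheaf, applied to the
  \<open>n\<close> coordinates with a common exponent.\<close>

lemma kill_on_basic_trivial:
  assumes k: "k \<in> carrier (secs Y U)" "D k \<subseteq> V" and h: "h \<in> carrier (secs Y U)"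
    and s: "s \<in> carrier (msecs A (D k))"
    and z: "mrestr A (D k) (D (k \<otimes>\<^bsub>secs Y U\<^esub> h)) s = \<zero>\<^bsub>msecs A (D (k \<otimes>\<^bsub>secs Y U\<^esub> h))\<^esub>"
  shows "\<exists>m0::nat. \<forall>m\<ge>m0. restr Y U (D k) (h [^]\<^bsub>secs Y U\<^esub> m) \<odot>\<^bsub>msecs A (D k)\<^esub> s = \<zero>\<^bsub>msecs A (D k)\<^esub>"
proof -
  let ?kh = "k \<otimes>\<^bsub>secs Y U\<^esub> h"
  note kh = D_product[OF k(1) h] and Dk = D_open[OF k(1)] D_subset[OF k(1)]
  note W = Dk(1) k(2)
  have Z: "openin (pts Y) (D ?kh)" "D ?kh \<subseteq> V" using kh k(2) by auto
  interpret a: algebra "secs Y (D k)" "msecs A (D k)" using msecs_algebra[OF Dk(1)] .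
  interpret z: algebra "secs Y (D ?kh)" "msecs A (D ?kh)" using msecs_algebra[OF kh(1)] .
  interpret r: ring_hom_ring "secs Y U" "secs Y (D k)" "restr Y U (D k)" using restr_D_hom[OF Dk] .
  have zero_coord: "coord W j \<zero>\<^bsub>msecs A W\<^esub> = \<zero>\<^bsub>secs Y W\<^esub>"
    if "openin (pts Y) W" "W \<subseteq> V" "j < n" for W j
  proof -
    interpret w: algebra "secs Y W" "msecs A W" using msecs_algebra[OF that(1)] .
    note c = coord_closed[OF that(1,2) w.M.zero_closed that(3)]
    have "coord W j (\<zero>\<^bsub>secs Y W\<^esub> \<odot>\<^bsub>msecs A W\<^esub> \<zero>\<^bsub>msecs A W\<^esub>) = \<zero>\<^bsub>secs Y W\<^esub>"
      unfolding coord_smult[OF that(1,2) w.R.zero_closed w.M.zero_closed that(3)] using c by simp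
    then show ?thesis by simp
  qed
  have ex: "\<exists>m0::nat. \<forall>m\<ge>m0. restr Y U (D k) (h [^]\<^bsub>secs Y U\<^esub> m) \<otimes>\<^bsub>secs Y (D k)\<^esub> coord (D k) j s = \<zero>\<^bsub>secs Y (D k)\<^esub>"
    if "j \<in> {..<n}" for j
  proof (rule kill_on_basic[OF k(1) h coord_closed[OF W s]])
    show "j < n" using that by simp
    then show "restr Y (D k) (D ?kh) (coord (D k) j s) = \<zero>\<^bsub>secs Y (D ?kh)\<^esub>"
      using coord_restr[OF W kh(1,2) s, of j] z zero_coord[OF Z] by simp
  qed
  obtain m0 :: nat where m0: "\<And>j m. j \<in> {..<n} \<Longrightarrow> m0 \<le> m \<Longrightarrow>
      restr Y U (D k) (h [^]\<^bsub>secs Y U\<^esub> m) \<otimes>\<^bsub>secs Y (D k)\<^esub> coord (D k) j s = \<zero>\<^bsub>secs Y (D k)\<^esub>"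
    by (rule finite_uniform_exponent[OF finite_lessThan ex], assumption) blast
  have "restr Y U (D k) (h [^]\<^bsub>secs Y U\<^esub> m) \<odot>\<^bsub>msecs A (D k)\<^esub> s = \<zero>\<^bsub>msecs A (D k)\<^esub>" if m: "m \<ge> m0" for m
  proof (rule coord_ext[OF W])
    have rc: "restr Y U (D k) (h [^]\<^bsub>secs Y U\<^esub> m) \<in> carrier (secs Y (D k))" using h by simp
    show "restr Y U (D k) (h [^]\<^bsub>secs Y U\<^esub> m) \<odot>\<^bsub>msecs A (D k)\<^esub> s \<in> carrier (msecs A (D k))" using rc s by simp
    show "coord (D k) j (restr Y U (D k) (h [^]\<^bsub>secs Y U\<^esub> m) \<odot>\<^bsub>msecs A (D k)\<^esub> s)
        = coord (D k) j \<zero>\<^bsub>msecs A (D k)\<^esub>" if "j < n" for j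
      using coord_smult[OF W rc s that] m0[OF _ m, of j] zero_coord[OF W that] that by simp
  qed simp
  then show ?thesis by blast
qed

text \<open>The coordinates are extended separately, with a common exponent, and reassembled by
  \<open>\<phi>\<close>.\<close>

lemma extend_to_basic_trivial:
  assumes k: "k \<in> carrier (secs Y U)" "D k \<subseteq> V" and h: "h \<in> carrier (secs Y U)"
    and t: "t \<in> carrier (msecs A (D (k \<otimes>\<^bsub>secs Y U\<^esub> h)))"
  shows "\<exists>m0::nat. \<forall>m\<ge>m0. \<exists>s\<in>carrier (msecs A (D k)). mrestr A (D k) (D (k \<otimes>\<^bsub>secs Y U\<^esub> h)) s
    = restr Y U (D (k \<otimes>\<^bsub>secs Y U\<^esub> h)) (h [^]\<^bsub>secs Y U\<^esub> m) \<odot>\<^bsub>msecs A (D (k \<otimes>\<^bsub>secs Y U\<^esub> h))\<^esub> t"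
proof -
  let ?kh = "k \<otimes>\<^bsub>secs Y U\<^esub> h"
  let ?p = "restr Y U (D ?kh)" and ?q = "restr Y (D k) (D ?kh)"
  note kh = D_product[OF k(1) h] and Dk = D_open[OF k(1)] D_subset[OF k(1)]
  note W = Dk(1) k(2)
  have Z: "openin (pts Y) (D ?kh)" "D ?kh \<subseteq> V" using kh k(2) by auto
  interpret z: algebra "secs Y (D ?kh)" "msecs A (D ?kh)" using msecs_algebra[OF kh(1)] .
  interpret p: ring_hom_ring "secs Y U" "secs Y (D ?kh)" ?p using restr_D_hom[OF kh(1,3)] .
  have ex: "\<exists>m0::nat. \<forall>m\<ge>m0. \<exists>d\<in>carrier (secs Y (D k)). ?q d = ?p (h [^]\<^bsub>secs Y U\<^esub> m) \<otimes>\<^bsub>secs Y (D ?kh)\<^esub> coord (D ?kh) j t"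
    if "j \<in> {..<n}" for j
    using extend_to_basic[OF k(1) h coord_closed[OF Z t]] that by simp
  obtain m0 :: nat where m0: "\<And>j m. j \<in> {..<n} \<Longrightarrow> m0 \<le> m \<Longrightarrow>
      \<exists>d\<in>carrier (secs Y (D k)). ?q d = ?p (h [^]\<^bsub>secs Y U\<^esub> m) \<otimes>\<^bsub>secs Y (D ?kh)\<^esub> coord (D ?kh) j t"
    by (rule finite_uniform_exponent[OF finite_lessThan ex], assumption) blast
  have "\<exists>s\<in>carrier (msecs A (D k)). mrestr A (D k) (D ?kh) s = ?p (h [^]\<^bsub>secs Y U\<^esub> m) \<odot>\<^bsub>msecs A (D ?kh)\<^esub> t"
    if m: "m \<ge> m0" for m
  proof -
    have "\<forall>j\<in>{..<n}. \<exists>d. d \<in> carrier (secs Y (D k)) \<and> ?q d = ?p (h [^]\<^bsub>secs Y U\<^esub> m) \<otimes>\<^bsub>secs Y (D ?kh)\<^esub> coord (D ?kh) j t"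
      using m0[OF _ m] by blast
    from bchoice[OF this] obtain d where d: "\<And>j. j < n \<Longrightarrow> d j \<in> carrier (secs Y (D k))"
      "\<And>j. j < n \<Longrightarrow> ?q (d j) = ?p (h [^]\<^bsub>secs Y U\<^esub> m) \<otimes>\<^bsub>secs Y (D ?kh)\<^esub> coord (D ?kh) j t" by auto
    let ?d = "\<lambda>i\<in>{..<n}. d i"
    have dv: "?d \<in> vecs (D k)" using d(1) by auto
    have pc: "?p (h [^]\<^bsub>secs Y U\<^esub> m) \<in> carrier (secs Y (D ?kh))" using h by simp
    have "mrestr A (D k) (D ?kh) (\<phi> (D k) ?d) = \<phi> (D ?kh) (\<lambda>i\<in>{..<n}. ?q (?d i))"
      using \<phi>_restr[OF W kh(1,2) dv] by simp
    also have "(\<lambda>i\<in>{..<n}. ?q (?d i)) = (\<lambda>i\<in>{..<n}. ?p (h [^]\<^bsub>secs Y U\<^esub> m) \<otimes>\<^bsub>secs Y (D ?kh)\<^esub>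
        (\<lambda>i\<in>{..<n}. coord (D ?kh) i t) i)" using d(2) by (intro restrict_ext) simp
    also have "\<phi> (D ?kh) \<dots> = ?p (h [^]\<^bsub>secs Y U\<^esub> m) \<odot>\<^bsub>msecs A (D ?kh)\<^esub> t"
      using \<phi>_smult[OF Z pc coord_vec(1)[OF Z t]] coord_vec(2)[OF Z t] by simp
    finally show ?thesis using \<phi>_closed[OF W dv] by blast
  qed
  then show ?thesis by blast
qed

end

section \<open>The trace of a rank two algebra\<close>

locale rank_two_algebra_sheaf = algebra_sheaf Y A
  for Y :: "('x, 'r) ringed_space" and A :: "('x, 'r, 'a) module_sheaf" +
  assumes rank_two: "locally_free Y A 2"
    and two_Units: "openin (pts Y) U \<Longrightarrow> two U \<in> Units (secs Y U)"
begin

abbreviation tr :: "'x set \<Rightarrow> 'a \<Rightarrow> 'r" where "tr \<equiv> sheaf_trace Y A"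

abbreviation half :: "'x set \<Rightarrow> 'r" where "half U \<equiv> inv\<^bsub>secs Y U\<^esub> (two U)"

lemma trivializedI: "trivialization Y A n V \<phi> \<Longrightarrow> trivialized_sheaf Y A n V \<phi>"
  using algebra_sheaf_axioms by (intro trivialized_sheaf.intro trivialized_sheaf_axioms.intro)

lemma trivialization_open: "trivialization Y A n V \<phi> \<Longrightarrow> openin (pts Y) V"
  unfolding trivialization_def by blast

lemma trivialization_restrict:
  "\<lbrakk>trivialization Y A n V \<phi>; openin (pts Y) W; W \<subseteq> V\<rbrakk> \<Longrightarrow> trivialization Y A n W \<phi>"
  using trivialized_sheaf.trivialization_subset[OF trivializedI] .

lemma trivialization_at:
  assumes "openin (pts Y) U" "x \<in> U"
  shows "\<exists>V \<phi>. x \<in> V \<and> V \<subseteq> U \<and> trivialization Y A 2 V \<phi>"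
proof -
  have "x \<in> topspace (pts Y)" using assms openin_subset by blast
  then obtain V \<phi> where V: "x \<in> V" "trivialization Y A 2 V \<phi>" using rank_two unfolding locally_free_def by blast
  then have "openin (pts Y) (V \<inter> U)" using assms(1) trivialization_open by blast
  then have "trivialization Y A 2 (V \<inter> U) \<phi>" using trivialization_restrict[OF V(2)] by blast
  then show ?thesis using V(1) assms(2) by blast
qed

text \<open>The ranks may differ because \<open>sheaf_trace\<close> quantifies over trivializations
  of every rank, and over a zero ring free modules of all ranks are isomorphic. Over the empty set
  this really happens.\<close>

lemma local_trace_unique:
  assumes V: "trivialization Y A n V \<phi>" "trivialization Y A m V \<phi>'" and a: "a \<in> carrier (msecs A V)"
  shows "local_trace Y A n V \<phi> a = local_trace Y A m V \<phi>' a"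
proof -
  interpret t: trivialized_sheaf Y A n V \<phi> using trivializedI[OF V(1)] .
  interpret t': trivialized_sheaf Y A m V \<phi>' using trivializedI[OF V(2)] .
  interpret a: algebra "secs Y V" "msecs A V" using msecs_algebra[OF t.V_open] .
  show ?thesis unfolding t.local_trace_eq t'.local_trace_eq
    using a.trace_dual_basis_unique[OF t.dual_basis_triv[OF t.V_open subset_refl]
        t'.dual_basis_triv[OF t.V_open subset_refl] a] .
qed

lemma secs_eqI:
  assumes U: "openin (pts Y) U" and st: "s \<in> carrier (secs Y U)" "t \<in> carrier (secs Y U)"
    and eq: "\<And>V \<phi>. \<lbrakk>openin (pts Y) V; V \<subseteq> U; trivialization Y A 2 V \<phi>\<rbrakk> \<Longrightarrow> restr Y U V s = restr Y U V t"
  shows "s = t"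
proof (rule sections_eqI[OF U st])
  fix x assume "x \<in> U"
  then obtain V \<phi> where V: "x \<in> V" "V \<subseteq> U" "trivialization Y A 2 V \<phi>" using trivialization_at[OF U] by blast
  show "\<exists>V. openin (pts Y) V \<and> x \<in> V \<and> V \<subseteq> U \<and> restr Y U V s = restr Y U V t"
    using eq[OF trivialization_open[OF V(3)] V(2,3)] V(1,2) trivialization_open[OF V(3)] by blast
qed

lemma msecs_eqI:
  assumes U: "openin (pts Y) U" and st: "s \<in> carrier (msecs A U)" "t \<in> carrier (msecs A U)"
    and eq: "\<And>V \<phi>. \<lbrakk>openin (pts Y) V; V \<subseteq> U; trivialization Y A 2 V \<phi>\<rbrakk> \<Longrightarrow> mrestr A U V s = mrestr A U V t"
  shows "s = t"
proof (rule A.sections_eqI[OF U st])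
  fix x assume "x \<in> U"
  then obtain V \<phi> where V: "x \<in> V" "V \<subseteq> U" "trivialization Y A 2 V \<phi>" using trivialization_at[OF U] by blast
  show "\<exists>V. openin (pts Y) V \<and> x \<in> V \<and> V \<subseteq> U \<and> mrestr A U V s = mrestr A U V t"
    using eq[OF trivialization_open[OF V(3)] V(2,3)] V(1,2) trivialization_open[OF V(3)] by blast
qed

text \<open>The definite description defining the trace denotes: local traces do not depend on the
  trivialization and commute with restriction, so they glue to one section.\<close>

lemma sheaf_trace_char:
  assumes U: "openin (pts Y) U" and a: "a \<in> carrier (msecs A U)"
  shows "tr U a \<in> carrier (secs Y U)"
    and "\<And>V n \<phi>. \<lbrakk>V \<subseteq> U; trivialization Y A n V \<phi>\<rbrakk> \<Longrightarrow> restr Y U V (tr U a) = local_trace Y A n V \<phi> (mrestr A U V a)"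
proof -
  \<comment> \<open>\<open>Q V t\<close> is the defining property of the trace over
    \<open>V\<close>, with the section always restricted from the fixed \<open>U\<close>.
    Trivializing sets cover \<open>V\<close>, so \<open>Q\<close> determines
    \<open>t\<close>.\<close>
  define Q where "Q V t \<longleftrightarrow> (\<forall>W n \<phi>. W \<subseteq> V \<and> trivialization Y A n W \<phi> \<longrightarrow>
      restr Y V W t = local_trace Y A n W \<phi> (mrestr A U W a))" for V t
  have aV: "mrestr A U V a \<in> carrier (msecs A V)" if "openin (pts Y) V" "V \<subseteq> U" for V
    using A.restr_closed[OF U that a] .
  have uniq: "s = t" if V: "openin (pts Y) V" "V \<subseteq> U" and st: "s \<in> carrier (secs Y V)" "t \<in> carrier (secs Y V)"
    and Q: "Q V s" "Q V t" for V s t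
  proof (rule secs_eqI[OF V(1) st])
    fix W \<phi> assume W: "W \<subseteq> V" "trivialization Y A 2 W \<phi>"
    then show "restr Y V W s = restr Y V W t" using Q unfolding Q_def by metis
  qed
  have Q_triv: "Q V (local_trace Y A n V \<phi> (mrestr A U V a))"
    "local_trace Y A n V \<phi> (mrestr A U V a) \<in> carrier (secs Y V)"
    if V: "V \<subseteq> U" "trivialization Y A n V \<phi>" for V n \<phi>
  proof -
    interpret t: trivialized_sheaf Y A n V \<phi> using trivializedI[OF V(2)] .
    show "local_trace Y A n V \<phi> (mrestr A U V a) \<in> carrier (secs Y V)"
      using t.local_trace_closed[OF t.V_open subset_refl aV[OF t.V_open V(1)]] .
    show "Q V (local_trace Y A n V \<phi> (mrestr A U V a))"
      unfolding Q_def
    proof (intro allI impI, elim conjE)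
      fix W m \<phi>' assume W: "W \<subseteq> V" "trivialization Y A m W \<phi>'"
      note oW = trivialization_open[OF W(2)]
      have WU: "W \<subseteq> U" using W(1) V(1) by blast
      have "restr Y V W (local_trace Y A n V \<phi> (mrestr A U V a)) = local_trace Y A n W \<phi> (mrestr A U W a)"
        using t.local_trace_restr[OF t.V_open subset_refl oW W(1) aV[OF t.V_open V(1)]]
          A.restr_trans[OF U t.V_open oW W(1) V(1) a] by simp
      also have "\<dots> = local_trace Y A m W \<phi>' (mrestr A U W a)"
        using local_trace_unique[OF trivialization_restrict[OF V(2) oW W(1)] W(2) aV[OF oW WU]] .
      finally show "restr Y V W (local_trace Y A n V \<phi> (mrestr A U V a)) = local_trace Y A m W \<phi>' (mrestr A U W a)" .
    qed
  qed
  obtain s where s: "s \<in> carrier (secs Y U)"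
    "\<And>V t. \<lbrakk>openin (pts Y) V; V \<subseteq> U; t \<in> carrier (secs Y V); Q V t\<rbrakk> \<Longrightarrow> restr Y U V s = t"
  proof (rule glue_unique_local[OF U, of Q])
    fix x assume "x \<in> U"
    then obtain V \<phi> where V: "x \<in> V" "V \<subseteq> U" "trivialization Y A 2 V \<phi>" using trivialization_at[OF U] by blast
    then show "\<exists>V s. openin (pts Y) V \<and> x \<in> V \<and> V \<subseteq> U \<and> s \<in> carrier (secs Y V) \<and> Q V s"
      using Q_triv[OF V(2,3)] trivialization_open[OF V(3)] by blast
  next
    fix V W s assume VW: "openin (pts Y) V" "openin (pts Y) W" "W \<subseteq> V" "s \<in> carrier (secs Y V)" "Q V s"
    show "Q W (restr Y V W s)" unfolding Q_def
    proof (intro allI impI, elim conjE)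
      fix Z n \<phi> assume Z: "Z \<subseteq> W" "trivialization Y A n Z \<phi>"
      have "restr Y W Z (restr Y V W s) = restr Y V Z s"
        using restr_trans[OF VW(1,2) trivialization_open[OF Z(2)] Z(1) VW(3,4)] .
      moreover have "Z \<subseteq> V" using Z(1) VW(3) by blast
      ultimately show "restr Y W Z (restr Y V W s) = local_trace Y A n Z \<phi> (mrestr A U Z a)"
        using VW(5) Z(2) unfolding Q_def by simp
    qed
  qed (use uniq in blast)+
  have char: "restr Y U V s = local_trace Y A n V \<phi> (mrestr A U V a)" if V: "V \<subseteq> U" "trivialization Y A n V \<phi>" for V n \<phi>
    using s(2)[OF trivialization_open[OF V(2)] V(1) Q_triv(2)[OF V] Q_triv(1)[OF V]] .
  have "tr U a = s"
    unfolding sheaf_trace_def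
  proof (rule the_equality)
    show "s \<in> carrier (secs Y U) \<and> (\<forall>V n \<phi>. V \<subseteq> U \<and> trivialization Y A n V \<phi> \<longrightarrow>
        restr Y U V s = local_trace Y A n V \<phi> (mrestr A U V a))" using s(1) char by blast
    then have "Q U s" unfolding Q_def by (rule conjunct2)
    then show "t = s" if "t \<in> carrier (secs Y U) \<and> (\<forall>V n \<phi>. V \<subseteq> U \<and> trivialization Y A n V \<phi> \<longrightarrow>
        restr Y U V t = local_trace Y A n V \<phi> (mrestr A U V a))" for t
      using uniq[OF U subset_refl _ s(1), of t] that unfolding Q_def by simp
  qed
  then show "tr U a \<in> carrier (secs Y U)"
    "\<And>V n \<phi>. \<lbrakk>V \<subseteq> U; trivialization Y A n V \<phi>\<rbrakk> \<Longrightarrow> restr Y U V (tr U a) = local_trace Y A n V \<phi> (mrestr A U V a)"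
    using s(1) char by auto
qed

lemma sheaf_trace_restr:
  assumes U: "openin (pts Y) U" and V: "openin (pts Y) V" "V \<subseteq> U" and a: "a \<in> carrier (msecs A U)"
  shows "restr Y U V (tr U a) = tr V (mrestr A U V a)"
proof (rule secs_eqI[OF V(1)])
  note aV = A.restr_closed[OF U V a]
  show "restr Y U V (tr U a) \<in> carrier (secs Y V)" using restr_closed[OF U V sheaf_trace_char(1)[OF U a]] .
  show "tr V (mrestr A U V a) \<in> carrier (secs Y V)" using sheaf_trace_char(1)[OF V(1) aV] .
  fix W \<phi> assume W: "openin (pts Y) W" "W \<subseteq> V" "trivialization Y A 2 W \<phi>"
  have WU: "W \<subseteq> U" using W(2) V(2) by blast
  show "restr Y V W (restr Y U V (tr U a)) = restr Y V W (tr V (mrestr A U V a))"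
    unfolding restr_trans[OF U V(1) W(1,2) V(2) sheaf_trace_char(1)[OF U a]]
      sheaf_trace_char(2)[OF U a WU W(3)] sheaf_trace_char(2)[OF V(1) aV W(2,3)]
      A.restr_trans[OF U V(1) W(1,2) V(2) a] ..
qed

lemma sheaf_trace_trivial:
  assumes V: "trivialization Y A n V \<phi>" and a: "a \<in> carrier (msecs A V)"
  shows "tr V a = local_trace Y A n V \<phi> a"
  using sheaf_trace_char(2)[OF trivialization_open[OF V] a subset_refl V]
    restr_id[OF trivialization_open[OF V] sheaf_trace_char(1)[OF trivialization_open[OF V] a]]
    A.restr_id[OF trivialization_open[OF V] a] by simp

lemma sheaf_trace_add:
  assumes U: "openin (pts Y) U" and a: "a \<in> carrier (msecs A U)" "b \<in> carrier (msecs A U)"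
  shows "tr U (a \<oplus>\<^bsub>msecs A U\<^esub> b) = tr U a \<oplus>\<^bsub>secs Y U\<^esub> tr U b"
proof (rule secs_eqI[OF U])
  interpret u: algebra "secs Y U" "msecs A U" using msecs_algebra[OF U] .
  note c = sheaf_trace_char(1)[OF U a(1)] sheaf_trace_char(1)[OF U a(2)]
  have ab: "a \<oplus>\<^bsub>msecs A U\<^esub> b \<in> carrier (msecs A U)" using a by simp
  show "tr U (a \<oplus>\<^bsub>msecs A U\<^esub> b) \<in> carrier (secs Y U)" using sheaf_trace_char(1)[OF U ab] .
  show "tr U a \<oplus>\<^bsub>secs Y U\<^esub> tr U b \<in> carrier (secs Y U)" using c by simp
  fix V \<phi> assume V: "openin (pts Y) V" "V \<subseteq> U" "trivialization Y A 2 V \<phi>"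
  interpret t: trivialized_sheaf Y A 2 V \<phi> using trivializedI[OF V(3)] .
  show "restr Y U V (tr U (a \<oplus>\<^bsub>msecs A U\<^esub> b)) = restr Y U V (tr U a \<oplus>\<^bsub>secs Y U\<^esub> tr U b)"
    unfolding ring_hom_add[OF restr_hom[OF U V(1,2)] c] sheaf_trace_char(2)[OF U ab V(2,3)]
      sheaf_trace_char(2)[OF U a(1) V(2,3)] sheaf_trace_char(2)[OF U a(2) V(2,3)]
      ring_hom_add[OF mrestr_hom[OF U V(1,2)] a]
    using t.local_trace_add[OF A.restr_closed[OF U V(1,2) a(1)] A.restr_closed[OF U V(1,2) a(2)]] .
qed

lemma sheaf_trace_smult:
  assumes U: "openin (pts Y) U" and k: "k \<in> carrier (secs Y U)" and a: "a \<in> carrier (msecs A U)"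
  shows "tr U (k \<odot>\<^bsub>msecs A U\<^esub> a) = k \<otimes>\<^bsub>secs Y U\<^esub> tr U a"
proof (rule secs_eqI[OF U])
  interpret u: algebra "secs Y U" "msecs A U" using msecs_algebra[OF U] .
  note c = sheaf_trace_char(1)[OF U a]
  have ab: "k \<odot>\<^bsub>msecs A U\<^esub> a \<in> carrier (msecs A U)" using a k by simp
  show "tr U (k \<odot>\<^bsub>msecs A U\<^esub> a) \<in> carrier (secs Y U)" using sheaf_trace_char(1)[OF U ab] .
  show "k \<otimes>\<^bsub>secs Y U\<^esub> tr U a \<in> carrier (secs Y U)" using c k by simp
  fix V \<phi> assume V: "openin (pts Y) V" "V \<subseteq> U" "trivialization Y A 2 V \<phi>"
  interpret t: trivialized_sheaf Y A 2 V \<phi> using trivializedI[OF V(3)] .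
  show "restr Y U V (tr U (k \<odot>\<^bsub>msecs A U\<^esub> a)) = restr Y U V (k \<otimes>\<^bsub>secs Y U\<^esub> tr U a)"
    unfolding ring_hom_mult[OF restr_hom[OF U V(1,2)] k c] sheaf_trace_char(2)[OF U ab V(2,3)]
      sheaf_trace_char(2)[OF U a V(2,3)] mrestr_smult[OF U V(1,2) k a]
    using t.local_trace_smult[OF restr_closed[OF U V(1,2) k] A.restr_closed[OF U V(1,2) a]] .
qed

text \<open>The multiplication by 1 has the identity matrix, and the rank is 2.\<close>

lemma sheaf_trace_one:
  assumes U: "openin (pts Y) U"
  shows "tr U \<one>\<^bsub>msecs A U\<^esub> = two U"
proof (rule secs_eqI[OF U])
  interpret uM: cring "msecs A U" using algebra.M_cring[OF msecs_algebra[OF U]] .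
  interpret uR: cring "secs Y U" using secs_cring[OF U] .
  show "tr U \<one>\<^bsub>msecs A U\<^esub> \<in> carrier (secs Y U)" using sheaf_trace_char(1)[OF U uM.one_closed] .
  show "two U \<in> carrier (secs Y U)" by simp
  fix V \<phi> assume V: "openin (pts Y) V" "V \<subseteq> U" "trivialization Y A 2 V \<phi>"
  interpret t: trivialized_sheaf Y A 2 V \<phi> using trivializedI[OF V(3)] .
  interpret vR: cring "secs Y V" using secs_cring[OF V(1)] .
  interpret vM: cring "msecs A V" using algebra.M_cring[OF msecs_algebra[OF V(1)]] .
  note b = t.basis_sec_closed[OF V(1) subset_refl] and cb = t.coord_basis_sec[OF V(1) subset_refl]
  have "restr Y U V (tr U \<one>\<^bsub>msecs A U\<^esub>) = local_trace Y A 2 V \<phi> \<one>\<^bsub>msecs A V\<^esub>"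
    unfolding sheaf_trace_char(2)[OF U uM.one_closed V(2,3)] ring_hom_one[OF mrestr_hom[OF U V(1,2)]] ..
  also have "\<dots> = two V"
    unfolding t.local_trace_eq
    by (subst vR.finsum_two) (simp_all add: b cb)
  also have "\<dots> = restr Y U V (two U)"
    using ring_hom_add[OF restr_hom[OF U V(1,2)] uR.one_closed uR.one_closed] ring_hom_one[OF restr_hom[OF U V(1,2)]]
    by simp
  finally show "restr Y U V (tr U \<one>\<^bsub>msecs A U\<^esub>) = restr Y U V (two U)" .
qed

lemma half_closed:
  assumes U: "openin (pts Y) U"
  shows "half U \<in> carrier (secs Y U)" "half U \<otimes>\<^bsub>secs Y U\<^esub> two U = \<one>\<^bsub>secs Y U\<^esub>"
proof -
  interpret uR: cring "secs Y U" using secs_cring[OF U] .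
  show "half U \<in> carrier (secs Y U)" "half U \<otimes>\<^bsub>secs Y U\<^esub> two U = \<one>\<^bsub>secs Y U\<^esub>"
    using two_Units[OF U] uR.Units_l_inv by auto
qed

lemma half_restr:
  assumes U: "openin (pts Y) U" and V: "openin (pts Y) V" "V \<subseteq> U"
  shows "restr Y U V (half U) = half V"
proof -
  interpret uR: cring "secs Y U" using secs_cring[OF U] .
  have "restr Y U V (two U) = two V"
    using ring_hom_add[OF restr_hom[OF U V] uR.one_closed uR.one_closed] ring_hom_one[OF restr_hom[OF U V]] by simp
  then show ?thesis using ring_hom_Units(2)[OF secs_cring[OF U] secs_cring[OF V(1)] restr_hom[OF U V] two_Units[OF U]]
    by simp
qed

text \<open>Half the trace reads a scalar \<open>k\<close> off the section that it defines. Scalars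
  found locally are thereby given by a global formula, and a scalar section of trace zero has scalar
  zero.\<close>

lemma sheaf_trace_scalar:
  assumes U: "openin (pts Y) U" and k: "k \<in> carrier (secs Y U)"
  shows "half U \<otimes>\<^bsub>secs Y U\<^esub> tr U (k \<odot>\<^bsub>msecs A U\<^esub> \<one>\<^bsub>msecs A U\<^esub>) = k"
proof -
  interpret uR: cring "secs Y U" using secs_cring[OF U] .
  interpret uM: cring "msecs A U" using algebra.M_cring[OF msecs_algebra[OF U]] .
  note h = half_closed[OF U]
  have t: "two U \<in> carrier (secs Y U)" by simp
  have "half U \<otimes>\<^bsub>secs Y U\<^esub> (k \<otimes>\<^bsub>secs Y U\<^esub> two U) = k \<otimes>\<^bsub>secs Y U\<^esub> (half U \<otimes>\<^bsub>secs Y U\<^esub> two U)"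
    using h(1) k t by (simp only: uR.m_ac)
  then show ?thesis unfolding sheaf_trace_smult[OF U k uM.one_closed] sheaf_trace_one[OF U] h(2) using k by simp
qed

text \<open>Polarization: 2lm is the square of l + m minus the squares of l and m. All three are
  scalars, because l + m is traceless too, and 2 is invertible.\<close>

lemma traceless_mult_local:
  assumes triv: "trivialization Y A 2 V \<phi>" and l: "l \<in> carrier (msecs A V)" "tr V l = \<zero>\<^bsub>secs Y V\<^esub>"
    and m: "m \<in> carrier (msecs A V)" "tr V m = \<zero>\<^bsub>secs Y V\<^esub>"
  shows "\<exists>c\<in>carrier (secs Y V). l \<otimes>\<^bsub>msecs A V\<^esub> m = c \<odot>\<^bsub>msecs A V\<^esub> \<one>\<^bsub>msecs A V\<^esub>"
proof -
  note V = trivialization_open[OF triv]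
  let ?O = "secs Y V" and ?M = "msecs A V"
  interpret t: trivialized_sheaf Y A 2 V \<phi> using trivializedI[OF triv] .
  interpret R: cring ?O using secs_cring[OF V] .
  interpret M: cring ?M using algebra.M_cring[OF msecs_algebra[OF V]] .
  interpret a: algebra ?O ?M using msecs_algebra[OF V] .
  have sq: "\<exists>d\<in>carrier ?O. x \<otimes>\<^bsub>?M\<^esub> x = d \<odot>\<^bsub>?M\<^esub> \<one>\<^bsub>?M\<^esub>"
    if x: "x \<in> carrier ?M" "tr V x = \<zero>\<^bsub>?O\<^esub>" for x
    using a.rank_two_traceless_square[OF t.dual_basis_triv[OF V subset_refl] x(1)] x(2)
    unfolding sheaf_trace_trivial[OF triv x(1)] t.local_trace_eq by blast
  obtain d1 where d1: "d1 \<in> carrier ?O" "l \<otimes>\<^bsub>?M\<^esub> l = d1 \<odot>\<^bsub>?M\<^esub> \<one>\<^bsub>?M\<^esub>" using sq[OF l] by blast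
  obtain d2 where d2: "d2 \<in> carrier ?O" "m \<otimes>\<^bsub>?M\<^esub> m = d2 \<odot>\<^bsub>?M\<^esub> \<one>\<^bsub>?M\<^esub>" using sq[OF m] by blast
  have lm: "l \<oplus>\<^bsub>?M\<^esub> m \<in> carrier ?M" "tr V (l \<oplus>\<^bsub>?M\<^esub> m) = \<zero>\<^bsub>?O\<^esub>"
    using l m sheaf_trace_add[OF V l(1) m(1)] by auto
  obtain d3 where d3: "d3 \<in> carrier ?O" "(l \<oplus>\<^bsub>?M\<^esub> m) \<otimes>\<^bsub>?M\<^esub> (l \<oplus>\<^bsub>?M\<^esub> m) = d3 \<odot>\<^bsub>?M\<^esub> \<one>\<^bsub>?M\<^esub>" using sq[OF lm] by blast
  let ?p = "l \<otimes>\<^bsub>?M\<^esub> m" and ?s = "(d1 \<oplus>\<^bsub>?O\<^esub> d2) \<odot>\<^bsub>?M\<^esub> \<one>\<^bsub>?M\<^esub>"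
  have p: "?p \<in> carrier ?M" and s: "?s \<in> carrier ?M" using l m d1 d2 by auto
  have "d3 \<odot>\<^bsub>?M\<^esub> \<one>\<^bsub>?M\<^esub> = (l \<otimes>\<^bsub>?M\<^esub> l \<oplus>\<^bsub>?M\<^esub> m \<otimes>\<^bsub>?M\<^esub> m) \<oplus>\<^bsub>?M\<^esub> (?p \<oplus>\<^bsub>?M\<^esub> ?p)"
    unfolding d3(2)[symmetric] using l(1) m(1) by (simp add: M.l_distr M.r_distr M.m_comm[of m l] M.a_ac)
  also have "l \<otimes>\<^bsub>?M\<^esub> l \<oplus>\<^bsub>?M\<^esub> m \<otimes>\<^bsub>?M\<^esub> m = ?s" unfolding d1(2) d2(2) using d1(1) d2(1) by (simp add: a.smult_l_distr)
  finally have "d3 \<odot>\<^bsub>?M\<^esub> \<one>\<^bsub>?M\<^esub> \<oplus>\<^bsub>?M\<^esub> (\<ominus>\<^bsub>?M\<^esub> ?s) = ?p \<oplus>\<^bsub>?M\<^esub> ?p"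
    using p s by (simp add: M.a_ac M.r_neg1 M.r_neg2 M.r_neg)
  moreover have "\<ominus>\<^bsub>?M\<^esub> ?s = (\<ominus>\<^bsub>?O\<^esub> (d1 \<oplus>\<^bsub>?O\<^esub> d2)) \<odot>\<^bsub>?M\<^esub> \<one>\<^bsub>?M\<^esub>"
    using a.smult_l_minus[of "d1 \<oplus>\<^bsub>?O\<^esub> d2" "\<one>\<^bsub>?M\<^esub>"] d1(1) d2(1) by simp
  \<comment> \<open>The scalar that equals 2lm: \<open>d1\<close>, \<open>d2\<close>,
    \<open>d3\<close> are the squares of \<open>l\<close>, \<open>m\<close> and their sum.\<close>
  moreover define e where "e = d3 \<oplus>\<^bsub>?O\<^esub> (\<ominus>\<^bsub>?O\<^esub> (d1 \<oplus>\<^bsub>?O\<^esub> d2))"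
  moreover have "?p \<oplus>\<^bsub>?M\<^esub> ?p = two V \<odot>\<^bsub>?M\<^esub> ?p" using p by (simp add: a.smult_l_distr)
  ultimately have e: "two V \<odot>\<^bsub>?M\<^esub> ?p = e \<odot>\<^bsub>?M\<^esub> \<one>\<^bsub>?M\<^esub>"
    using d1(1) d2(1) d3(1) a.smult_l_distr[of d3 "\<ominus>\<^bsub>?O\<^esub> (d1 \<oplus>\<^bsub>?O\<^esub> d2)" "\<one>\<^bsub>?M\<^esub>"] by simp
  have ec: "e \<in> carrier ?O" unfolding e_def using d1 d2 d3 by simp
  have tc: "two V \<in> carrier ?O" by simp
  note h = half_closed[OF V]
  have "?p = (half V \<otimes>\<^bsub>?O\<^esub> two V) \<odot>\<^bsub>?M\<^esub> ?p" unfolding h(2) using p by simp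
  also have "\<dots> = (half V \<otimes>\<^bsub>?O\<^esub> e) \<odot>\<^bsub>?M\<^esub> \<one>\<^bsub>?M\<^esub>"
    unfolding a.smult_assoc1[OF h(1) tc p] e using h(1) ec by (simp add: a.smult_assoc1)
  finally show ?thesis using h(1) ec by blast
qed

text \<open>Over a trivializing set the product is some scalar, which must be half the trace of the
  product. Since that expression makes sense over \<open>U\<close>, the identity is checked locally
  and no scalars have to be glued.\<close>

lemma traceless_mult:
  assumes U: "openin (pts Y) U" and l: "l \<in> carrier (msecs A U)" "tr U l = \<zero>\<^bsub>secs Y U\<^esub>"
    and m: "m \<in> carrier (msecs A U)" "tr U m = \<zero>\<^bsub>secs Y U\<^esub>"
  shows "l \<otimes>\<^bsub>msecs A U\<^esub> m = (half U \<otimes>\<^bsub>secs Y U\<^esub> tr U (l \<otimes>\<^bsub>msecs A U\<^esub> m)) \<odot>\<^bsub>msecs A U\<^esub> \<one>\<^bsub>msecs A U\<^esub>"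
proof (rule msecs_eqI[OF U])
  interpret R: cring "secs Y U" using secs_cring[OF U] .
  interpret M: cring "msecs A U" using algebra.M_cring[OF msecs_algebra[OF U]] .
  interpret a: algebra "secs Y U" "msecs A U" using msecs_algebra[OF U] .
  let ?p = "l \<otimes>\<^bsub>msecs A U\<^esub> m"
  have p: "?p \<in> carrier (msecs A U)" using l m by simp
  then show "?p \<in> carrier (msecs A U)" .
  note c = half_closed(1)[OF U] sheaf_trace_char(1)[OF U p]
  have k: "half U \<otimes>\<^bsub>secs Y U\<^esub> tr U ?p \<in> carrier (secs Y U)" using c by simp
  then show "(half U \<otimes>\<^bsub>secs Y U\<^esub> tr U ?p) \<odot>\<^bsub>msecs A U\<^esub> \<one>\<^bsub>msecs A U\<^esub> \<in> carrier (msecs A U)" by simp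
  fix V \<phi> assume V: "openin (pts Y) V" "V \<subseteq> U" "trivialization Y A 2 V \<phi>"
  interpret r: ring_hom_ring "secs Y U" "secs Y V" "restr Y U V" using restr_ring_hom_ring[OF U V(1,2)] .
  let ?l = "mrestr A U V l" and ?m = "mrestr A U V m"
  have t: "tr V ?l = \<zero>\<^bsub>secs Y V\<^esub>" "tr V ?m = \<zero>\<^bsub>secs Y V\<^esub>"
    unfolding sheaf_trace_restr[OF U V(1,2) l(1), symmetric] sheaf_trace_restr[OF U V(1,2) m(1), symmetric] l(2) m(2)
    by simp_all
  obtain e where e: "e \<in> carrier (secs Y V)" "?l \<otimes>\<^bsub>msecs A V\<^esub> ?m = e \<odot>\<^bsub>msecs A V\<^esub> \<one>\<^bsub>msecs A V\<^esub>"
    using traceless_mult_local[OF V(3) A.restr_closed[OF U V(1,2) l(1)] t(1) A.restr_closed[OF U V(1,2) m(1)] t(2)] by blast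
  have pm: "mrestr A U V ?p = ?l \<otimes>\<^bsub>msecs A V\<^esub> ?m" using ring_hom_mult[OF mrestr_hom[OF U V(1,2)] l(1) m(1)] .
  have "restr Y U V (half U \<otimes>\<^bsub>secs Y U\<^esub> tr U ?p) = half V \<otimes>\<^bsub>secs Y V\<^esub> tr V (mrestr A U V ?p)"
    unfolding ring_hom_mult[OF restr_hom[OF U V(1,2)] c] half_restr[OF U V(1,2)] sheaf_trace_restr[OF U V(1,2) p] ..
  also have "\<dots> = e" unfolding pm e(2) using sheaf_trace_scalar[OF V(1) e(1)] .
  finally show "mrestr A U V ?p = mrestr A U V ((half U \<otimes>\<^bsub>secs Y U\<^esub> tr U ?p) \<odot>\<^bsub>msecs A U\<^esub> \<one>\<^bsub>msecs A U\<^esub>)"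
    unfolding mrestr_smult[OF U V(1,2) k M.one_closed] ring_hom_one[OF mrestr_hom[OF U V(1,2)]] pm e(2) by simp
qed

end

section \<open>Spans of sections\<close>

definition lin_span :: "('r, 'k) ring_scheme \<Rightarrow> ('r, 'a, 'l) module_scheme \<Rightarrow> 'i set \<Rightarrow> ('i \<Rightarrow> 'a) \<Rightarrow> 'a set" where
  "lin_span R M I f = {\<Oplus>\<^bsub>M\<^esub>i\<in>I. c i \<odot>\<^bsub>M\<^esub> f i | c. c \<in> I \<rightarrow> carrier R}"

context module
begin

lemma lin_span_closed:
  assumes I: "finite I" "\<And>i. i \<in> I \<Longrightarrow> f i \<in> carrier M"
  shows "x \<in> lin_span R M I f \<Longrightarrow> x \<in> carrier M"
    and "\<lbrakk>x \<in> lin_span R M I f; y \<in> lin_span R M I f\<rbrakk> \<Longrightarrow> x \<oplus>\<^bsub>M\<^esub> y \<in> lin_span R M I f"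
    and "\<lbrakk>k \<in> carrier R; x \<in> lin_span R M I f\<rbrakk> \<Longrightarrow> k \<odot>\<^bsub>M\<^esub> x \<in> lin_span R M I f"
    and "i \<in> I \<Longrightarrow> f i \<in> lin_span R M I f"
    and "\<zero>\<^bsub>M\<^esub> \<in> lin_span R M I f"
proof -
  show cl: "x \<in> carrier M" if "x \<in> lin_span R M I f" for x
    using that I unfolding lin_span_def by (auto intro!: M.finsum_closed)
  show "x \<oplus>\<^bsub>M\<^esub> y \<in> lin_span R M I f" if xy: "x \<in> lin_span R M I f" "y \<in> lin_span R M I f" for x y
  proof -
    obtain c where c: "c \<in> I \<rightarrow> carrier R" "x = (\<Oplus>\<^bsub>M\<^esub>i\<in>I. c i \<odot>\<^bsub>M\<^esub> f i)" using xy(1) unfolding lin_span_def by blast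
    obtain d where d: "d \<in> I \<rightarrow> carrier R" "y = (\<Oplus>\<^bsub>M\<^esub>i\<in>I. d i \<odot>\<^bsub>M\<^esub> f i)" using xy(2) unfolding lin_span_def by blast
    have "x \<oplus>\<^bsub>M\<^esub> y = (\<Oplus>\<^bsub>M\<^esub>i\<in>I. c i \<odot>\<^bsub>M\<^esub> f i \<oplus>\<^bsub>M\<^esub> d i \<odot>\<^bsub>M\<^esub> f i)"
      unfolding c(2) d(2) using c(1) d(1) I by (intro M.finsum_addf[symmetric]) auto
    also have "\<dots> = (\<Oplus>\<^bsub>M\<^esub>i\<in>I. (c i \<oplus> d i) \<odot>\<^bsub>M\<^esub> f i)"
      using c(1) d(1) I by (intro M.finsum_cong') (auto simp: smult_l_distr Pi_iff)
    finally show ?thesis unfolding lin_span_def using c(1) d(1) by (intro CollectI exI[of _ "\<lambda>i. c i \<oplus> d i"]) auto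
  qed
  show sm: "k \<odot>\<^bsub>M\<^esub> x \<in> lin_span R M I f" if k: "k \<in> carrier R" "x \<in> lin_span R M I f" for k x
  proof -
    obtain c where c: "c \<in> I \<rightarrow> carrier R" "x = (\<Oplus>\<^bsub>M\<^esub>i\<in>I. c i \<odot>\<^bsub>M\<^esub> f i)" using k(2) unfolding lin_span_def by blast
    have "k \<odot>\<^bsub>M\<^esub> x = (\<Oplus>\<^bsub>M\<^esub>i\<in>I. k \<odot>\<^bsub>M\<^esub> (c i \<odot>\<^bsub>M\<^esub> f i))"
      unfolding c(2) using c(1) I k(1) by (intro finsum_smult_ldistr) auto
    also have "\<dots> = (\<Oplus>\<^bsub>M\<^esub>i\<in>I. (k \<otimes> c i) \<odot>\<^bsub>M\<^esub> f i)"
      using c(1) k(1) I by (intro M.finsum_cong') (auto simp: smult_assoc1 Pi_iff)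
    finally show ?thesis unfolding lin_span_def using c(1) k(1) by (intro CollectI exI[of _ "\<lambda>i. k \<otimes> c i"]) auto
  qed
  show f: "f i \<in> lin_span R M I f" if i: "i \<in> I" for i
  proof -
    have "(\<Oplus>\<^bsub>M\<^esub>j\<in>I. (if i = j then \<one> else \<zero>) \<odot>\<^bsub>M\<^esub> f j) = (\<Oplus>\<^bsub>M\<^esub>j\<in>I. if i = j then f j else \<zero>\<^bsub>M\<^esub>)"
      using I by (intro M.finsum_cong') auto
    also have "\<dots> = f i" using i I by (intro M.finsum_singleton) auto
    finally show ?thesis unfolding lin_span_def
      by (intro CollectI exI[of _ "\<lambda>j. if i = j then \<one> else \<zero>"]) auto
  qed
  have "(\<Oplus>\<^bsub>M\<^esub>i\<in>I. \<zero> \<odot>\<^bsub>M\<^esub> f i) = (\<Oplus>\<^bsub>M\<^esub>i\<in>I. \<zero>\<^bsub>M\<^esub>)" using I by (intro M.finsum_cong') auto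
  then show "\<zero>\<^bsub>M\<^esub> \<in> lin_span R M I f" unfolding lin_span_def
    by (intro CollectI exI[of _ "\<lambda>_. \<zero>"]) auto
qed

text \<open>Finite sums are formed relative to the carrier of the structure, so a sum in the kernel
  of the trace and the same sum in the whole algebra are different terms and have to be
  compared.\<close>

lemma submodule_finsum:
  assumes H: "submodule H R M" and I: "finite I" "\<And>i. i \<in> I \<Longrightarrow> f i \<in> H"
  shows "(\<Oplus>\<^bsub>M\<lparr>carrier := H\<rparr>\<^esub>i\<in>I. f i) = (\<Oplus>\<^bsub>M\<^esub>i\<in>I. f i)" "(\<Oplus>\<^bsub>M\<^esub>i\<in>I. f i) \<in> H"
proof -
  interpret H: module R "M\<lparr>carrier := H\<rparr>" using submodule.submodule_is_module[OF H module_axioms] .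
  have HM: "H \<subseteq> carrier M" using submoduleE(1)[OF H] .
  have eq: "(\<Oplus>\<^bsub>M\<lparr>carrier := H\<rparr>\<^esub>i\<in>I. f i) = (\<Oplus>\<^bsub>M\<^esub>i\<in>I. f i)"
    using I
  proof (induction I rule: finite_induct)
    case empty
    show ?case using H.M.finsum_empty M.finsum_empty by simp
  next
    case (insert i I)
    have f: "f \<in> I \<rightarrow> carrier (M\<lparr>carrier := H\<rparr>)" "f i \<in> carrier (M\<lparr>carrier := H\<rparr>)"
      "f \<in> I \<rightarrow> carrier M" "f i \<in> carrier M" using insert.prems HM by auto
    show ?case
      using H.M.finsum_insert[OF insert.hyps f(1,2)] M.finsum_insert[OF insert.hyps f(3,4)] insert by simp
  qed
  then show "(\<Oplus>\<^bsub>M\<lparr>carrier := H\<rparr>\<^esub>i\<in>I. f i) = (\<Oplus>\<^bsub>M\<^esub>i\<in>I. f i)" .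
  have "f \<in> I \<rightarrow> carrier (M\<lparr>carrier := H\<rparr>)" using I by auto
  then show "(\<Oplus>\<^bsub>M\<^esub>i\<in>I. f i) \<in> H" using H.M.finsum_closed[of f I] unfolding eq by simp
qed

end

lemma (in algebra_sheaf) mrestr_lin_comb:
  assumes UV: "openin (pts Y) U" "openin (pts Y) V" "V \<subseteq> U"
    and I: "finite I" "\<And>i. i \<in> I \<Longrightarrow> c i \<in> carrier (secs Y U)" "\<And>i. i \<in> I \<Longrightarrow> f i \<in> carrier (msecs A U)"
  shows "mrestr A U V (\<Oplus>\<^bsub>msecs A U\<^esub>i\<in>I. c i \<odot>\<^bsub>msecs A U\<^esub> f i)
    = (\<Oplus>\<^bsub>msecs A V\<^esub>i\<in>I. restr Y U V (c i) \<odot>\<^bsub>msecs A V\<^esub> mrestr A U V (f i))"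
proof -
  interpret u: algebra "secs Y U" "msecs A U" using msecs_algebra[OF UV(1)] .
  interpret v: algebra "secs Y V" "msecs A V" using msecs_algebra[OF UV(2)] .
  interpret q: ring_hom_ring "msecs A U" "msecs A V" "mrestr A U V" using mrestr_ring_hom_ring[OF UV] .
  interpret qc: ring_hom_cring "msecs A U" "msecs A V" "mrestr A U V"
    using q.homh u.M_cring v.M_cring by (intro ring_hom_cringI) (auto intro: q.ring_hom_ring_axioms)
  have "mrestr A U V (\<Oplus>\<^bsub>msecs A U\<^esub>i\<in>I. c i \<odot>\<^bsub>msecs A U\<^esub> f i)
      = (\<Oplus>\<^bsub>msecs A V\<^esub>i\<in>I. mrestr A U V (c i \<odot>\<^bsub>msecs A U\<^esub> f i))"
    using I by (subst qc.hom_finsum) (auto simp: comp_def)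
  also have "\<dots> = (\<Oplus>\<^bsub>msecs A V\<^esub>i\<in>I. restr Y U V (c i) \<odot>\<^bsub>msecs A V\<^esub> mrestr A U V (f i))"
    using I restr_closed[OF UV] A.restr_closed[OF UV] by (intro v.M.finsum_cong') (auto simp: mrestr_smult[OF UV])
  finally show ?thesis .
qed

context affine_chart
begin

text \<open>Each point of \<open>U\<close> lies in some \<open>D h\<close>, and since
  \<open>h\<close> is 1 times \<open>h\<close>, that set is contained in
  \<open>D \<one>\<close>.\<close>

lemma D_one: "D \<one>\<^bsub>secs Y U\<^esub> = U"
proof -
  interpret O: cring "secs Y U" using secs_cring[OF U_open] .
  have "x \<in> D \<one>\<^bsub>secs Y U\<^esub>" if x: "x \<in> U" for x
  proof -
    obtain h where "h \<in> carrier (secs Y U)" "x \<in> D h" using D_basis[OF U_open subset_refl x] by blast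
    then show ?thesis using D_mult[OF O.one_closed, of h] by auto
  qed
  then show ?thesis using D_subset[OF O.one_closed] by blast
qed

lemma D_pow:
  assumes "h \<in> carrier (secs Y U)" "x \<in> D h"
  shows "x \<in> D (h [^]\<^bsub>secs Y U\<^esub> (n::nat))"
proof -
  interpret O: cring "secs Y U" using secs_cring[OF U_open] .
  show ?thesis
    using assms D_one D_subset by (induction n) (auto simp: D_mult)
qed

text \<open>The axiom \<open>frac\<close> for all large exponents, so that several coefficients can
  be cleared by the same power of \<open>h\<close>.\<close>

lemma frac_ge:
  assumes h: "h \<in> carrier (secs Y U)" and c: "c \<in> carrier (secs Y (D h))"
  shows "\<exists>n::nat. \<forall>m\<ge>n. \<exists>b\<in>carrier (secs Y U).
    restr Y U (D h) (h [^]\<^bsub>secs Y U\<^esub> m) \<otimes>\<^bsub>secs Y (D h)\<^esub> c = restr Y U (D h) b"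
proof -
  let ?O = "secs Y U" and ?K = "secs Y (D h)" and ?r = "restr Y U (D h)"
  note Dh = D_open[OF h] D_subset[OF h]
  interpret O: cring ?O using secs_cring[OF U_open] .
  interpret K: cring ?K using secs_cring[OF Dh(1)] .
  interpret r: ring_hom_ring ?O ?K ?r using restr_D_hom[OF Dh] .
  obtain n :: nat and a where a: "a \<in> carrier ?O" "?r (h [^]\<^bsub>?O\<^esub> n) \<otimes>\<^bsub>?K\<^esub> c = ?r a"
    using frac[OF h c] by blast
  have "?r (h [^]\<^bsub>?O\<^esub> m) \<otimes>\<^bsub>?K\<^esub> c = ?r (h [^]\<^bsub>?O\<^esub> (m - n) \<otimes>\<^bsub>?O\<^esub> a)" if m: "m \<ge> n" for m
  proof -
    have "?r (h [^]\<^bsub>?O\<^esub> m) = ?r (h [^]\<^bsub>?O\<^esub> (m - n)) \<otimes>\<^bsub>?K\<^esub> ?r (h [^]\<^bsub>?O\<^esub> n)"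
      using h m O.nat_pow_mult[OF h, of "m - n" n] by (simp flip: r.hom_mult)
    then show ?thesis using h a c by (simp add: K.m_assoc)
  qed
  then show ?thesis using h a(1) by blast
qed

end

section \<open>Quasi-coherence on affine open sets\<close>

locale affine_rank_two = rank_two_algebra_sheaf Y A + affine_chart Y U D
  for Y :: "('x, 'r) ringed_space" and A :: "('x, 'r, 'a) module_sheaf" and U D
begin

text \<open>Trivializing open sets are refined to sets \<open>D k\<close>; quasi-compactness makes
  the cover finite, as a uniform exponent requires.\<close>

lemma trivializing_cover:
  obtains F where "finite F" "\<And>k. k \<in> F \<Longrightarrow> k \<in> carrier (secs Y U)" "\<And>x. x \<in> U \<Longrightarrow> \<exists>k\<in>F. x \<in> D k"
    "\<And>k. k \<in> F \<Longrightarrow> \<exists>V \<phi>. D k \<subseteq> V \<and> trivialized_affine Y A 2 V \<phi> U D"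
proof -
  let ?H = "{k \<in> carrier (secs Y U). \<exists>V \<phi>. D k \<subseteq> V \<and> trivialized_affine Y A 2 V \<phi> U D}"
  have "\<exists>k\<in>?H. x \<in> D k" if x: "x \<in> U" for x
  proof -
    obtain V \<phi> where V: "x \<in> V" "V \<subseteq> U" "trivialization Y A 2 V \<phi>" using trivialization_at[OF U_open x] by blast
    obtain k where k: "k \<in> carrier (secs Y U)" "x \<in> D k" "D k \<subseteq> V"
      using D_basis[OF trivialization_open[OF V(3)] V(2,1)] by blast
    have "trivialized_affine Y A 2 V \<phi> U D"
      using trivializedI[OF V(3)] affine_chart_axioms by (rule trivialized_affine.intro)
    then show ?thesis using k by blast
  qed
  then obtain F where F: "F \<subseteq> ?H" "finite F" "\<forall>x\<in>U. \<exists>h\<in>F. x \<in> D h" using quasi_compact[of ?H] by blast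
  show ?thesis by (rule that[OF F(2)]) (use F(1,3) in auto)
qed

text \<open>Each piece \<open>D k\<close> of a finite trivializing cover provides an exponent that
  kills the restriction of \<open>s\<close>; a common exponent kills \<open>s\<close> itself, by
  locality.\<close>

lemma kill_section:
  assumes h: "h \<in> carrier (secs Y U)" and s: "s \<in> carrier (msecs A U)"
    and z: "mrestr A U (D h) s = \<zero>\<^bsub>msecs A (D h)\<^esub>"
  shows "\<exists>m::nat. (h [^]\<^bsub>secs Y U\<^esub> m) \<odot>\<^bsub>msecs A U\<^esub> s = \<zero>\<^bsub>msecs A U\<^esub>"
proof -
  obtain F where F: "finite F" "\<And>k. k \<in> F \<Longrightarrow> k \<in> carrier (secs Y U)" "\<And>x. x \<in> U \<Longrightarrow> \<exists>k\<in>F. x \<in> D k"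
    "\<And>k. k \<in> F \<Longrightarrow> \<exists>V \<phi>. D k \<subseteq> V \<and> trivialized_affine Y A 2 V \<phi> U D" using trivializing_cover by metis
  note Dh = D_open[OF h] D_subset[OF h]
  have ex: "\<exists>m0::nat. \<forall>m\<ge>m0. restr Y U (D k) (h [^]\<^bsub>secs Y U\<^esub> m) \<odot>\<^bsub>msecs A (D k)\<^esub> mrestr A U (D k) s = \<zero>\<^bsub>msecs A (D k)\<^esub>"
    if k: "k \<in> F" for k
  proof -
    obtain V \<phi> where V: "D k \<subseteq> V" "trivialized_affine Y A 2 V \<phi> U D" using F(4)[OF k] by blast
    let ?kh = "k \<otimes>\<^bsub>secs Y U\<^esub> h"
    note kh = D_product[OF F(2)[OF k] h] and Dk = D_open[OF F(2)[OF k]] D_subset[OF F(2)[OF k]]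
    have khh: "D ?kh \<subseteq> D h" using D_mult[OF F(2)[OF k] h] by blast
    interpret q: ring_hom_ring "msecs A (D h)" "msecs A (D ?kh)" "mrestr A (D h) (D ?kh)"
      using mrestr_ring_hom_ring[OF Dh(1) kh(1) khh] .
    have "mrestr A (D k) (D ?kh) (mrestr A U (D k) s) = mrestr A (D h) (D ?kh) (mrestr A U (D h) s)"
      using A.restr_trans[OF U_open Dk(1) kh(1,2) Dk(2) s] A.restr_trans[OF U_open Dh(1) kh(1) khh Dh(2) s] by simp
    also have "\<dots> = \<zero>\<^bsub>msecs A (D ?kh)\<^esub>" unfolding z by simp
    finally show ?thesis
      using trivialized_affine.kill_on_basic_trivial[OF V(2) F(2)[OF k] V(1) h A.restr_closed[OF U_open Dk s]] by blast
  qed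
  obtain m :: nat where m: "\<And>k m'. k \<in> F \<Longrightarrow> m \<le> m' \<Longrightarrow>
      restr Y U (D k) (h [^]\<^bsub>secs Y U\<^esub> m') \<odot>\<^bsub>msecs A (D k)\<^esub> mrestr A U (D k) s = \<zero>\<^bsub>msecs A (D k)\<^esub>"
    by (rule finite_uniform_exponent[OF F(1) ex], assumption) blast
  interpret u: algebra "secs Y U" "msecs A U" using msecs_algebra[OF U_open] .
  have hm: "h [^]\<^bsub>secs Y U\<^esub> m \<in> carrier (secs Y U)" using h by simp
  have "(h [^]\<^bsub>secs Y U\<^esub> m) \<odot>\<^bsub>msecs A U\<^esub> s = \<zero>\<^bsub>msecs A U\<^esub>"
  proof (rule A.sections_eqI[OF U_open])
    show "(h [^]\<^bsub>secs Y U\<^esub> m) \<odot>\<^bsub>msecs A U\<^esub> s \<in> carrier (msecs A U)" using hm s by simp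
    fix x assume "x \<in> U"
    then obtain k where k: "k \<in> F" "x \<in> D k" using F(3) by blast
    note Dk = D_open[OF F(2)[OF k(1)]] D_subset[OF F(2)[OF k(1)]]
    interpret q: ring_hom_ring "msecs A U" "msecs A (D k)" "mrestr A U (D k)"
      using mrestr_ring_hom_ring[OF U_open Dk] .
    have "mrestr A U (D k) ((h [^]\<^bsub>secs Y U\<^esub> m) \<odot>\<^bsub>msecs A U\<^esub> s) = mrestr A U (D k) \<zero>\<^bsub>msecs A U\<^esub>"
      unfolding mrestr_smult[OF U_open Dk hm s] using m[OF k(1), of m] by simp
    then show "\<exists>V. openin (pts Y) V \<and> x \<in> V \<and> V \<subseteq> U \<and>
        mrestr A U V ((h [^]\<^bsub>secs Y U\<^esub> m) \<odot>\<^bsub>msecs A U\<^esub> s) = mrestr A U V \<zero>\<^bsub>msecs A U\<^esub>" using Dk k(2) by blast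
  qed simp
  then show ?thesis by blast
qed

text \<open>On each piece \<open>D k\<close> a multiple of \<open>t\<close> by a power of
  \<open>h\<close> extends. Two extensions need not agree on the overlap, but they agree after
  restriction to \<open>D h\<close>, so a further power of \<open>h\<close> removes the discrepancy
  and the pieces glue.\<close>

lemma extend_section:
  assumes h: "h \<in> carrier (secs Y U)" and t: "t \<in> carrier (msecs A (D h))"
  shows "\<exists>(m::nat) s. s \<in> carrier (msecs A U) \<and>
    mrestr A U (D h) s = restr Y U (D h) (h [^]\<^bsub>secs Y U\<^esub> m) \<odot>\<^bsub>msecs A (D h)\<^esub> t"
proof -
  let ?O = "secs Y U"
  obtain F where F: "finite F" "\<And>k. k \<in> F \<Longrightarrow> k \<in> carrier ?O" "\<And>x. x \<in> U \<Longrightarrow> \<exists>k\<in>F. x \<in> D k"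
    "\<And>k. k \<in> F \<Longrightarrow> \<exists>V \<phi>. D k \<subseteq> V \<and> trivialized_affine Y A 2 V \<phi> U D" using trivializing_cover by metis
  interpret O: cring ?O using secs_cring[OF U_open] .
  note Dh = D_open[OF h] D_subset[OF h]
  have hp: "h [^]\<^bsub>?O\<^esub> (m::nat) \<in> carrier ?O" for m using h by simp
  have khh: "D (k \<otimes>\<^bsub>?O\<^esub> h) \<subseteq> D h" if "k \<in> carrier ?O" for k using D_mult[OF that h] by blast
  let ?p = "\<lambda>W m. restr Y U W (h [^]\<^bsub>?O\<^esub> (m::nat))"
  have pc: "?p W m \<in> carrier (secs Y W)" if "openin (pts Y) W" "W \<subseteq> U" for W m
    using restr_closed[OF U_open that hp] .
  have ptrans: "restr Y V W (?p V m) = ?p W m" if "openin (pts Y) V" "openin (pts Y) W" "W \<subseteq> V" "V \<subseteq> U" for V W m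
    using restr_trans[OF U_open that hp] .
  have ex: "\<exists>m0::nat. \<forall>m\<ge>m0. \<exists>s\<in>carrier (msecs A (D k)). mrestr A (D k) (D (k \<otimes>\<^bsub>?O\<^esub> h)) s
      = ?p (D (k \<otimes>\<^bsub>?O\<^esub> h)) m \<odot>\<^bsub>msecs A (D (k \<otimes>\<^bsub>?O\<^esub> h))\<^esub> mrestr A (D h) (D (k \<otimes>\<^bsub>?O\<^esub> h)) t"
    if k: "k \<in> F" for k
  proof -
    obtain V \<phi> where V: "D k \<subseteq> V" "trivialized_affine Y A 2 V \<phi> U D" using F(4)[OF k] by blast
    note kh = D_product[OF F(2)[OF k] h]
    show ?thesis using trivialized_affine.extend_to_basic_trivial[OF V(2) F(2)[OF k] V(1) h
        A.restr_closed[OF Dh(1) kh(1) khh[OF F(2)[OF k]] t]] .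
  qed
  obtain m :: nat where "\<And>k m'. k \<in> F \<Longrightarrow> m \<le> m' \<Longrightarrow> \<exists>s\<in>carrier (msecs A (D k)). mrestr A (D k) (D (k \<otimes>\<^bsub>?O\<^esub> h)) s
      = ?p (D (k \<otimes>\<^bsub>?O\<^esub> h)) m' \<odot>\<^bsub>msecs A (D (k \<otimes>\<^bsub>?O\<^esub> h))\<^esub> mrestr A (D h) (D (k \<otimes>\<^bsub>?O\<^esub> h)) t"
    by (rule finite_uniform_exponent[OF F(1) ex], assumption) blast
  then have "\<forall>k\<in>F. \<exists>s. s \<in> carrier (msecs A (D k)) \<and> mrestr A (D k) (D (k \<otimes>\<^bsub>?O\<^esub> h)) s
      = ?p (D (k \<otimes>\<^bsub>?O\<^esub> h)) m \<odot>\<^bsub>msecs A (D (k \<otimes>\<^bsub>?O\<^esub> h))\<^esub> mrestr A (D h) (D (k \<otimes>\<^bsub>?O\<^esub> h)) t" by blast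
  from bchoice[OF this] obtain s where s: "\<And>k. k \<in> F \<Longrightarrow> s k \<in> carrier (msecs A (D k))"
    and s_kh: "\<And>k. k \<in> F \<Longrightarrow> mrestr A (D k) (D (k \<otimes>\<^bsub>?O\<^esub> h)) (s k)
      = ?p (D (k \<otimes>\<^bsub>?O\<^esub> h)) m \<odot>\<^bsub>msecs A (D (k \<otimes>\<^bsub>?O\<^esub> h))\<^esub> mrestr A (D h) (D (k \<otimes>\<^bsub>?O\<^esub> h)) t" by blast
  \<comment> \<open>The discrepancy on the overlap. Over D(klh) both terms restrict to the same
    multiple of \<open>t\<close>, so it vanishes there.\<close>
  define diff where "diff k l = mrestr A (D k) (D k \<inter> D l) (s k) \<ominus>\<^bsub>msecs A (D k \<inter> D l)\<^esub> mrestr A (D l) (D k \<inter> D l) (s l)" for k l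
  have ex2: "\<exists>m0::nat. \<forall>m\<ge>m0. ?p (D k \<inter> D l) m \<odot>\<^bsub>msecs A (D k \<inter> D l)\<^esub> diff k l = \<zero>\<^bsub>msecs A (D k \<inter> D l)\<^esub>"
    if kl: "k \<in> F" "l \<in> F" for k l
  proof -
    let ?kl = "k \<otimes>\<^bsub>?O\<^esub> l" and ?klh = "k \<otimes>\<^bsub>?O\<^esub> l \<otimes>\<^bsub>?O\<^esub> h"
    note k = F(2)[OF kl(1)] and l = F(2)[OF kl(2)]
    have klc: "?kl \<in> carrier ?O" using k l by simp
    \<comment> \<open>A trivialization around \<open>D k\<close> is enough: the overlap of
      \<open>D k\<close> and \<open>D l\<close> is D(kl), which lies inside
      \<open>D k\<close>.\<close>
    obtain V \<phi> where V: "D k \<subseteq> V" "trivialized_affine Y A 2 V \<phi> U D" using F(4)[OF kl(1)] by blast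
    have Dkl: "D ?kl = D k \<inter> D l" using D_mult[OF k l] .
    note o = D_open[OF klc] D_subset[OF klc] and oh = D_product[OF klc h]
    have sub: "D ?kl \<subseteq> D k" "D ?kl \<subseteq> D l" "D ?klh \<subseteq> D (k \<otimes>\<^bsub>?O\<^esub> h)" "D ?klh \<subseteq> D (l \<otimes>\<^bsub>?O\<^esub> h)"
      "D ?klh \<subseteq> D k" "D ?klh \<subseteq> D l"
      using D_mult[OF klc h] D_mult[OF k h] D_mult[OF l h] Dkl by auto
    interpret q: ring_hom_ring "msecs A (D ?kl)" "msecs A (D ?klh)" "mrestr A (D ?kl) (D ?klh)"
      using mrestr_ring_hom_ring[OF o(1) oh(1,2)] .
    have r1: "mrestr A (D ?kl) (D ?klh) (mrestr A (D i) (D ?kl) (s i)) = ?p (D ?klh) m \<odot>\<^bsub>msecs A (D ?klh)\<^esub> mrestr A (D h) (D ?klh) t"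
      if i: "i \<in> F" "D ?kl \<subseteq> D i" "D ?klh \<subseteq> D (i \<otimes>\<^bsub>?O\<^esub> h)" for i
    proof -
      note ic = F(2)[OF i(1)] and ih = D_product[OF F(2)[OF i(1)] h]
      have "mrestr A (D ?kl) (D ?klh) (mrestr A (D i) (D ?kl) (s i)) = mrestr A (D (i \<otimes>\<^bsub>?O\<^esub> h)) (D ?klh) (mrestr A (D i) (D (i \<otimes>\<^bsub>?O\<^esub> h)) (s i))"
        using A.restr_trans[OF D_open[OF ic] o(1) oh(1,2) i(2) s[OF i(1)]]
          A.restr_trans[OF D_open[OF ic] ih(1) oh(1) i(3) ih(2) s[OF i(1)]] by simp
      also have "\<dots> = ?p (D ?klh) m \<odot>\<^bsub>msecs A (D ?klh)\<^esub> mrestr A (D h) (D ?klh) t"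
        unfolding s_kh[OF i(1)] mrestr_smult[OF ih(1) oh(1) i(3) pc[OF ih(1,3)] A.restr_closed[OF Dh(1) ih(1) khh[OF ic] t]]
          ptrans[OF ih(1) oh(1) i(3) ih(3)] A.restr_trans[OF Dh(1) ih(1) oh(1) i(3) khh[OF ic] t] ..
      finally show ?thesis .
    qed
    have c: "mrestr A (D k) (D ?kl) (s k) \<in> carrier (msecs A (D ?kl))" "mrestr A (D l) (D ?kl) (s l) \<in> carrier (msecs A (D ?kl))"
      using A.restr_closed[OF D_open[OF k] o(1) sub(1) s[OF kl(1)]] A.restr_closed[OF D_open[OF l] o(1) sub(2) s[OF kl(2)]] .
    have d: "diff k l \<in> carrier (msecs A (D ?kl))" unfolding diff_def Dkl[symmetric] using c by simp
    have "mrestr A (D ?kl) (D ?klh) (mrestr A (D k) (D ?kl) (s k)) = mrestr A (D ?kl) (D ?klh) (mrestr A (D l) (D ?kl) (s l))"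
      using r1[OF kl(1) sub(1,3)] r1[OF kl(2) sub(2,4)] by simp
    then have "mrestr A (D ?kl) (D ?klh) (diff k l) = \<zero>\<^bsub>msecs A (D ?klh)\<^esub>"
      unfolding diff_def Dkl[symmetric] using c by (simp add: a_minus_def q.S.r_neg)
    then show ?thesis
      using trivialized_affine.kill_on_basic_trivial[OF V(2) klc _ h d] sub(1) V(1) unfolding Dkl by blast
  qed
  obtain m' :: nat where m': "\<And>kl n. kl \<in> F \<times> F \<Longrightarrow> m' \<le> n \<Longrightarrow> ?p (D (fst kl) \<inter> D (snd kl)) n
      \<odot>\<^bsub>msecs A (D (fst kl) \<inter> D (snd kl))\<^esub> diff (fst kl) (snd kl) = \<zero>\<^bsub>msecs A (D (fst kl) \<inter> D (snd kl))\<^esub>"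
  proof (rule finite_uniform_exponent[of "F \<times> F"])
    show "finite (F \<times> F)" using F(1) by simp
    show "\<exists>m0::nat. \<forall>n\<ge>m0. ?p (D (fst kl) \<inter> D (snd kl)) n
      \<odot>\<^bsub>msecs A (D (fst kl) \<inter> D (snd kl))\<^esub> diff (fst kl) (snd kl) = \<zero>\<^bsub>msecs A (D (fst kl) \<inter> D (snd kl))\<^esub>"
      if "kl \<in> F \<times> F" for kl using ex2[of "fst kl" "snd kl"] that by auto
  qed blast
  define u where "u k = ?p (D k) m' \<odot>\<^bsub>msecs A (D k)\<^esub> s k" for k
  have uc: "u k \<in> carrier (msecs A (D k))" if k: "k \<in> F" for k
  proof -
    interpret K: algebra "secs Y (D k)" "msecs A (D k)" using msecs_algebra[OF D_open[OF F(2)[OF k]]] .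
    show ?thesis unfolding u_def using pc[OF D_open[OF F(2)[OF k]] D_subset[OF F(2)[OF k]]] s[OF k] by simp
  qed
  have compat: "mrestr A (D k) (D k \<inter> D l) (u k) = mrestr A (D l) (D k \<inter> D l) (u l)" if kl: "k \<in> F" "l \<in> F" for k l
  proof -
    note k = F(2)[OF kl(1)] and l = F(2)[OF kl(2)]
    have o: "openin (pts Y) (D k \<inter> D l)" "D k \<inter> D l \<subseteq> U" using D_open[OF k] D_open[OF l] D_subset[OF k] by auto
    interpret K: algebra "secs Y (D k \<inter> D l)" "msecs A (D k \<inter> D l)" using msecs_algebra[OF o(1)] .
    let ?M = "msecs A (D k \<inter> D l)" and ?P = "?p (D k \<inter> D l) m'"
    let ?a = "mrestr A (D k) (D k \<inter> D l) (s k)" and ?b = "mrestr A (D l) (D k \<inter> D l) (s l)"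
    have c: "?a \<in> carrier ?M" "?b \<in> carrier ?M"
      using A.restr_closed[OF D_open[OF k] o(1) _ s[OF kl(1)]] A.restr_closed[OF D_open[OF l] o(1) _ s[OF kl(2)]] by auto
    have P: "?P \<in> carrier (secs Y (D k \<inter> D l))" using pc[OF o] .
    have "?P \<odot>\<^bsub>?M\<^esub> ?a \<oplus>\<^bsub>?M\<^esub> (\<ominus>\<^bsub>?M\<^esub> (?P \<odot>\<^bsub>?M\<^esub> ?b)) = \<zero>\<^bsub>?M\<^esub>"
      using m'[of "(k, l)" m'] kl c P unfolding diff_def a_minus_def by (simp add: K.smult_r_distr K.smult_r_minus)
    then have "?P \<odot>\<^bsub>?M\<^esub> ?a = ?P \<odot>\<^bsub>?M\<^esub> ?b"
      using c P K.M.minus_equality[of "?P \<odot>\<^bsub>?M\<^esub> ?a" "\<ominus>\<^bsub>?M\<^esub> (?P \<odot>\<^bsub>?M\<^esub> ?b)"] by simp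
    then show ?thesis unfolding u_def
      using mrestr_smult[OF D_open[OF k] o(1) _ pc[OF D_open[OF k] D_subset[OF k]] s[OF kl(1)]]
        mrestr_smult[OF D_open[OF l] o(1) _ pc[OF D_open[OF l] D_subset[OF l]] s[OF kl(2)]]
        ptrans[OF D_open[OF k] o(1) _ D_subset[OF k]] ptrans[OF D_open[OF l] o(1) _ D_subset[OF l]] by simp
  qed
  \<comment> \<open>Gluing is indexed by open sets and different elements of \<open>F\<close> may
    give the same set, so one index is chosen for each set.\<close>
  define \<kappa> where "\<kappa> W = (SOME k. k \<in> F \<and> D k = W)" for W
  have \<kappa>: "\<kappa> W \<in> F" "D (\<kappa> W) = W" if "W \<in> D ` F" for W
  proof -
    have "\<exists>k. k \<in> F \<and> D k = W" using that by blast
    then have "\<kappa> W \<in> F \<and> D (\<kappa> W) = W" unfolding \<kappa>_def by (rule someI_ex)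
    then show "\<kappa> W \<in> F" "D (\<kappa> W) = W" by auto
  qed
  have cov: "\<Union>(D ` F) = U" using F(2,3) D_subset by blast
  have "\<exists>!v. v \<in> carrier (msecs A (\<Union>(D ` F))) \<and> (\<forall>W\<in>D ` F. mrestr A (\<Union>(D ` F)) W v = u (\<kappa> W))"
  proof (rule A.glue)
    show "openin (pts Y) W" if "W \<in> D ` F" for W using that D_open F(2) by blast
    show "u (\<kappa> W) \<in> carrier (msecs A W)" if "W \<in> D ` F" for W using uc[OF \<kappa>(1)[OF that]] \<kappa>(2)[OF that] by simp
    show "mrestr A W (W \<inter> W') (u (\<kappa> W)) = mrestr A W' (W \<inter> W') (u (\<kappa> W'))" if "W \<in> D ` F" "W' \<in> D ` F" for W W'
      using compat[OF \<kappa>(1)[OF that(1)] \<kappa>(1)[OF that(2)]] \<kappa>(2)[OF that(1)] \<kappa>(2)[OF that(2)] by simp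
  qed
  then have "\<exists>v. v \<in> carrier (msecs A U) \<and> (\<forall>W\<in>D ` F. mrestr A U W v = u (\<kappa> W))"
    unfolding cov by (rule ex1_implies_ex)
  then obtain v where v: "v \<in> carrier (msecs A U)" "\<And>W. W \<in> D ` F \<Longrightarrow> mrestr A U W v = u (\<kappa> W)" by blast
  interpret H: algebra "secs Y (D h)" "msecs A (D h)" using msecs_algebra[OF Dh(1)] .
  \<comment> \<open>The exponents add up: \<open>m\<close> was used to extend, \<open>m'\<close> to
    make the extensions agree. The equality is checked on the sets D(kh), which cover
    \<open>D h\<close>.\<close>
  have "mrestr A U (D h) v = ?p (D h) (m' + m) \<odot>\<^bsub>msecs A (D h)\<^esub> t"
  proof (rule A.sections_eqI[OF Dh(1) A.restr_closed[OF U_open Dh v(1)]])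
    show "?p (D h) (m' + m) \<odot>\<^bsub>msecs A (D h)\<^esub> t \<in> carrier (msecs A (D h))" using pc[OF Dh] t by simp
    fix x assume x: "x \<in> D h"
    then obtain W where W: "W \<in> D ` F" "x \<in> W" using cov Dh(2) by blast
    define k where "k = \<kappa> W"
    have k: "k \<in> F" "k \<in> carrier ?O" "D k = W" using \<kappa>[OF W(1)] F(2) unfolding k_def by auto
    note Dk = D_open[OF k(2)] D_subset[OF k(2)] and kh = D_product[OF k(2) h]
    let ?W = "D (k \<otimes>\<^bsub>?O\<^esub> h)"
    interpret Wa: algebra "secs Y ?W" "msecs A ?W" using msecs_algebra[OF kh(1)] .
    have tW: "mrestr A (D h) ?W t \<in> carrier (msecs A ?W)" using A.restr_closed[OF Dh(1) kh(1) khh[OF k(2)] t] .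
    have "mrestr A (D h) ?W (mrestr A U (D h) v) = mrestr A (D k) ?W (mrestr A U (D k) v)"
      using A.restr_trans[OF U_open Dh(1) kh(1) khh[OF k(2)] Dh(2) v(1)]
        A.restr_trans[OF U_open Dk(1) kh(1,2) Dk(2) v(1)] by simp
    also have "mrestr A U (D k) v = u k" using v(2)[OF W(1)] k(3) unfolding k_def by simp
    also have "mrestr A (D k) ?W (u k) = ?p ?W m' \<odot>\<^bsub>msecs A ?W\<^esub> (?p ?W m \<odot>\<^bsub>msecs A ?W\<^esub> mrestr A (D h) ?W t)"
      unfolding u_def mrestr_smult[OF Dk(1) kh(1,2) pc[OF Dk] s[OF k(1)]] ptrans[OF Dk(1) kh(1,2) Dk(2)] s_kh[OF k(1)] ..
    also have "\<dots> = (?p ?W m' \<otimes>\<^bsub>secs Y ?W\<^esub> ?p ?W m) \<odot>\<^bsub>msecs A ?W\<^esub> mrestr A (D h) ?W t"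
      using Wa.smult_assoc1[OF pc[OF kh(1,3)] pc[OF kh(1,3)] tW] by simp
    also have "?p ?W m' \<otimes>\<^bsub>secs Y ?W\<^esub> ?p ?W m = ?p ?W (m' + m)"
      using ring_hom_mult[OF restr_hom[OF U_open kh(1,3)] hp hp] O.nat_pow_mult[OF h] by simp
    also have "\<dots> \<odot>\<^bsub>msecs A ?W\<^esub> mrestr A (D h) ?W t = mrestr A (D h) ?W (?p (D h) (m' + m) \<odot>\<^bsub>msecs A (D h)\<^esub> t)"
      unfolding mrestr_smult[OF Dh(1) kh(1) khh[OF k(2)] pc[OF Dh] t] ptrans[OF Dh(1) kh(1) khh[OF k(2)] Dh(2)] ..
    finally show "\<exists>V. openin (pts Y) V \<and> x \<in> V \<and> V \<subseteq> D h \<and> mrestr A (D h) V (mrestr A U (D h) v)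
        = mrestr A (D h) V (?p (D h) (m' + m) \<odot>\<^bsub>msecs A (D h)\<^esub> t)"
      using kh(1) khh[OF k(2)] x W(2) k(3) D_mult[OF k(2) h] by (intro exI[of _ ?W]) simp
  qed
  then show ?thesis using v(1) by blast
qed

end

section \<open>Traceless sections as a submodule\<close>

context rank_two_algebra_sheaf
begin

abbreviation traceless :: "'x set \<Rightarrow> 'a set" where
  "traceless U \<equiv> {a \<in> carrier (msecs A U). tr U a = \<zero>\<^bsub>secs Y U\<^esub>}"

lemma traceless_submodule:
  assumes U: "openin (pts Y) U"
  shows "submodule (traceless U) (secs Y U) (msecs A U)"
proof -
  interpret u: algebra "secs Y U" "msecs A U" using msecs_algebra[OF U] .
  have smult: "k \<odot>\<^bsub>msecs A U\<^esub> x \<in> traceless U" if "k \<in> carrier (secs Y U)" "x \<in> traceless U" for k x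
    using that by (simp add: sheaf_trace_smult[OF U])
  show ?thesis
  proof (rule u.submoduleI)
    show "x \<oplus>\<^bsub>msecs A U\<^esub> y \<in> traceless U" if "x \<in> traceless U" "y \<in> traceless U" for x y
      using that by (simp add: sheaf_trace_add[OF U])
    have "\<zero>\<^bsub>msecs A U\<^esub> = \<zero>\<^bsub>secs Y U\<^esub> \<odot>\<^bsub>msecs A U\<^esub> \<zero>\<^bsub>msecs A U\<^esub>" by simp
    then have "tr U \<zero>\<^bsub>msecs A U\<^esub> = \<zero>\<^bsub>secs Y U\<^esub> \<otimes>\<^bsub>secs Y U\<^esub> tr U \<zero>\<^bsub>msecs A U\<^esub>"
      using sheaf_trace_smult[OF U u.R.zero_closed u.M.zero_closed] by simp
    then show "\<zero>\<^bsub>msecs A U\<^esub> \<in> traceless U"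
      using sheaf_trace_char(1)[OF U u.M.zero_closed] by simp
    show "\<ominus>\<^bsub>msecs A U\<^esub> x \<in> traceless U" if x: "x \<in> traceless U" for x
      using smult[OF _ x, of "\<ominus>\<^bsub>secs Y U\<^esub> \<one>\<^bsub>secs Y U\<^esub>"] x u.smult_l_minus[OF u.R.one_closed, of x] by simp
    show "k \<odot>\<^bsub>msecs A U\<^esub> x \<in> traceless U" if "k \<in> carrier (secs Y U)" "x \<in> traceless U" for k x
      using smult[OF that] .
  qed auto
qed

lemma trace_kernel_sel:
  "msecs (trace_kernel Y A) U = (msecs A U)\<lparr>carrier := traceless U\<rparr>" "mrestr (trace_kernel Y A) = mrestr A"
  unfolding trace_kernel_def by auto

end

section \<open>Generation by global sections\<close>

text \<open>The traceless and the scalar part of each \<open>a i\<close> are given as data, tied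
  together by \<open>a_decomp\<close>. This form restricts to open sets without evaluating traces;
  that \<open>\<tau> i\<close> is half the trace of \<open>a i\<close> enters when the locale is
  instantiated.\<close>

locale generating_sections = scheme Y + rank_two_algebra_sheaf Y A
  for Y :: "('x, 'r) ringed_space" and A :: "('x, 'r, 'a) module_sheaf" +
  fixes r :: nat and a l :: "nat \<Rightarrow> 'a" and \<tau> :: "nat \<Rightarrow> 'r"
  assumes l_closed: "i < r \<Longrightarrow> l i \<in> traceless (topspace (pts Y))"
    and \<tau>_closed: "i < r \<Longrightarrow> \<tau> i \<in> carrier (secs Y (topspace (pts Y)))"
    and a_decomp: "i < r \<Longrightarrow> a i = l i \<oplus>\<^bsub>msecs A (topspace (pts Y))\<^esub>
      \<tau> i \<odot>\<^bsub>msecs A (topspace (pts Y))\<^esub> \<one>\<^bsub>msecs A (topspace (pts Y))\<^esub>"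
begin

abbreviation E where "E \<equiv> topspace (pts Y)"

definition lr :: "'x set \<Rightarrow> nat \<Rightarrow> 'a" where "lr U i = mrestr A E U (l i)"

definition span :: "'x set \<Rightarrow> 'a set" where
  "span U = lin_span (secs Y U) (msecs A U) {..<r} (lr U)"

lemma openE: "openin (pts Y) E" by simp

lemma lr_traceless:
  assumes U: "openin (pts Y) U" and i: "i < r"
  shows "lr U i \<in> traceless U"
proof -
  note UE = openin_subset[OF U]
  interpret q: ring_hom_ring "secs Y E" "secs Y U" "restr Y E U" using restr_ring_hom_ring[OF openE U UE] .
  have l: "l i \<in> carrier (msecs A E)" "tr E (l i) = \<zero>\<^bsub>secs Y E\<^esub>" using l_closed[OF i] by auto
  show ?thesis
    using A.restr_closed[OF openE U UE l(1)] sheaf_trace_restr[OF openE U UE l(1)] l(2) unfolding lr_def by simp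
qed

lemma lr_closed: "\<lbrakk>openin (pts Y) U; i < r\<rbrakk> \<Longrightarrow> lr U i \<in> carrier (msecs A U)"
  using lr_traceless by blast

lemma lr_restr:
  assumes UV: "openin (pts Y) U" "openin (pts Y) V" "V \<subseteq> U" and i: "i < r"
  shows "mrestr A U V (lr U i) = lr V i"
  unfolding lr_def using A.restr_trans[OF openE UV openin_subset[OF UV(1)]] l_closed[OF i] by blast

lemma a_decomp_on:
  assumes U: "openin (pts Y) U" and i: "i < r"
  shows "mrestr A E U (a i) = lr U i \<oplus>\<^bsub>msecs A U\<^esub> restr Y E U (\<tau> i) \<odot>\<^bsub>msecs A U\<^esub> \<one>\<^bsub>msecs A U\<^esub>"
proof -
  note UE = openin_subset[OF U]
  interpret eM: cring "msecs A E" using algebra.M_cring[OF msecs_algebra[OF openE]] .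
  interpret e: algebra "secs Y E" "msecs A E" using msecs_algebra[OF openE] .
  note h = mrestr_hom[OF openE U UE]
  have l: "l i \<in> carrier (msecs A E)" using l_closed[OF i] by blast
  have "\<tau> i \<odot>\<^bsub>msecs A E\<^esub> \<one>\<^bsub>msecs A E\<^esub> \<in> carrier (msecs A E)" using \<tau>_closed[OF i] by simp
  then show ?thesis
    unfolding a_decomp[OF i] lr_def ring_hom_add[OF h l \<open>\<tau> i \<odot>\<^bsub>msecs A E\<^esub> \<one>\<^bsub>msecs A E\<^esub> \<in> carrier (msecs A E)\<close>]
      mrestr_smult[OF openE U UE \<tau>_closed[OF i] eM.one_closed] ring_hom_one[OF h] by simp
qed

lemma span_closed:
  assumes U: "openin (pts Y) U"
  shows "x \<in> span U \<Longrightarrow> x \<in> traceless U"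
    and "\<lbrakk>x \<in> span U; y \<in> span U\<rbrakk> \<Longrightarrow> x \<oplus>\<^bsub>msecs A U\<^esub> y \<in> span U"
    and "\<lbrakk>k \<in> carrier (secs Y U); x \<in> span U\<rbrakk> \<Longrightarrow> k \<odot>\<^bsub>msecs A U\<^esub> x \<in> span U"
    and "i < r \<Longrightarrow> lr U i \<in> span U"
    and "\<zero>\<^bsub>msecs A U\<^esub> \<in> span U"
proof -
  interpret u: algebra "secs Y U" "msecs A U" using msecs_algebra[OF U] .
  have f: "lr U i \<in> carrier (msecs A U)" if "i \<in> {..<r}" for i using lr_closed[OF U] that by simp
  note c = u.lin_span_closed[OF finite_lessThan, of r "lr U", OF f]
  show "\<lbrakk>x \<in> span U; y \<in> span U\<rbrakk> \<Longrightarrow> x \<oplus>\<^bsub>msecs A U\<^esub> y \<in> span U"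
    "\<lbrakk>k \<in> carrier (secs Y U); x \<in> span U\<rbrakk> \<Longrightarrow> k \<odot>\<^bsub>msecs A U\<^esub> x \<in> span U"
    "i < r \<Longrightarrow> lr U i \<in> span U" "\<zero>\<^bsub>msecs A U\<^esub> \<in> span U"
    unfolding span_def using c(2-5) by auto
  show "x \<in> traceless U" if x: "x \<in> span U"
  proof -
    obtain c where c: "c \<in> {..<r} \<rightarrow> carrier (secs Y U)" "x = (\<Oplus>\<^bsub>msecs A U\<^esub>i\<in>{..<r}. c i \<odot>\<^bsub>msecs A U\<^esub> lr U i)"
      using x unfolding span_def lin_span_def by blast
    show ?thesis unfolding c(2)
    proof (rule u.submodule_finsum(2)[OF traceless_submodule[OF U] finite_lessThan])
      show "c i \<odot>\<^bsub>msecs A U\<^esub> lr U i \<in> traceless U" if "i \<in> {..<r}" for i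
        using u.submoduleE(4)[OF traceless_submodule[OF U], of "c i" "lr U i"] c(1) lr_traceless[OF U, of i] that by auto
    qed
  qed
qed

lemma span_restr:
  assumes UV: "openin (pts Y) U" "openin (pts Y) V" "V \<subseteq> U" and x: "x \<in> span U"
  shows "mrestr A U V x \<in> span V"
proof -
  interpret v: algebra "secs Y V" "msecs A V" using msecs_algebra[OF UV(2)] .
  obtain c where c: "c \<in> {..<r} \<rightarrow> carrier (secs Y U)" "x = (\<Oplus>\<^bsub>msecs A U\<^esub>i\<in>{..<r}. c i \<odot>\<^bsub>msecs A U\<^esub> lr U i)"
    using x unfolding span_def lin_span_def by blast
  have rc: "restr Y U V (c i) \<in> carrier (secs Y V)" if "i < r" for i using restr_closed[OF UV] c(1) that by auto
  have "mrestr A U V x = (\<Oplus>\<^bsub>msecs A V\<^esub>i\<in>{..<r}. restr Y U V (c i) \<odot>\<^bsub>msecs A V\<^esub> mrestr A U V (lr U i))"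
    unfolding c(2) using c(1) lr_closed[OF UV(1)] by (intro mrestr_lin_comb[OF UV]) auto
  also have "\<dots> = (\<Oplus>\<^bsub>msecs A V\<^esub>i\<in>{..<r}. restr Y U V (c i) \<odot>\<^bsub>msecs A V\<^esub> lr V i)"
    using rc lr_closed[OF UV(2)] lr_restr[OF UV] by (intro v.M.finsum_cong') auto
  finally show ?thesis unfolding span_def lin_span_def using rc
    by (intro CollectI exI[of _ "\<lambda>i. restr Y U V (c i)"]) auto
qed

text \<open>Besides comparing sums in the kernel with sums in the algebra, this matches the
  extensional coefficient vectors of the free sheaf with the plain ones of
  \<open>lin_span\<close>.\<close>

lemma sections_map_image:
  assumes U: "openin (pts Y) U"
  shows "sections_map Y (trace_kernel Y A) r l U ` carrier (msecs (free_sheaf Y r) U) = span U"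
proof -
  interpret u: algebra "secs Y U" "msecs A U" using msecs_algebra[OF U] .
  have eq: "sections_map Y (trace_kernel Y A) r l U c = (\<Oplus>\<^bsub>msecs A U\<^esub>i\<in>{..<r}. c i \<odot>\<^bsub>msecs A U\<^esub> lr U i)"
    if c: "c \<in> {..<r} \<rightarrow> carrier (secs Y U)" for c
  proof -
    have "c i \<odot>\<^bsub>msecs A U\<^esub> lr U i \<in> traceless U" if "i \<in> {..<r}" for i
      using u.submoduleE(4)[OF traceless_submodule[OF U], of "c i" "lr U i"] c lr_traceless[OF U, of i] that by auto
    from u.submodule_finsum(1)[OF traceless_submodule[OF U] finite_lessThan this]
    show ?thesis unfolding sections_map_def trace_kernel_sel lr_def by simp
  qed
  have free: "carrier (msecs (free_sheaf Y r) U) = {..<r} \<rightarrow>\<^sub>E carrier (secs Y U)" unfolding free_sheaf_def by simp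
  show ?thesis
  proof (intro equalityI subsetI)
    fix y assume "y \<in> sections_map Y (trace_kernel Y A) r l U ` carrier (msecs (free_sheaf Y r) U)"
    then obtain c where "c \<in> {..<r} \<rightarrow>\<^sub>E carrier (secs Y U)" "y = sections_map Y (trace_kernel Y A) r l U c"
      unfolding free by blast
    then show "y \<in> span U" using eq[of c] unfolding span_def lin_span_def PiE_def by auto
  next
    fix y assume "y \<in> span U"
    then obtain c where c: "c \<in> {..<r} \<rightarrow> carrier (secs Y U)" "y = (\<Oplus>\<^bsub>msecs A U\<^esub>i\<in>{..<r}. c i \<odot>\<^bsub>msecs A U\<^esub> lr U i)"
      unfolding span_def lin_span_def by blast
    have "y = (\<Oplus>\<^bsub>msecs A U\<^esub>i\<in>{..<r}. restrict c {..<r} i \<odot>\<^bsub>msecs A U\<^esub> lr U i)"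
      unfolding c(2) using c(1) lr_closed[OF U] by (intro u.M.finsum_cong') (auto simp: Pi_iff)
    moreover have "restrict c {..<r} \<in> {..<r} \<rightarrow> carrier (secs Y U)" using c(1) by auto
    ultimately have "y = sections_map Y (trace_kernel Y A) r l U (restrict c {..<r})" using eq by metis
    moreover have "restrict c {..<r} \<in> {..<r} \<rightarrow>\<^sub>E carrier (secs Y U)" using c(1) by auto
    ultimately show "y \<in> sections_map Y (trace_kernel Y A) r l U ` carrier (msecs (free_sheaf Y r) U)"
      unfolding free by blast
  qed
qed

lemma generate_as_module_iff:
  "generate_as_module Y (trace_kernel Y A) r l \<longleftrightarrow>
    (\<forall>W y x. openin (pts Y) W \<and> y \<in> traceless W \<and> x \<in> W \<longrightarrow>
      (\<exists>V. openin (pts Y) V \<and> x \<in> V \<and> V \<subseteq> W \<and> mrestr A W V y \<in> span V))"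
proof -
  have "carrier (msecs (trace_kernel Y A) W) = traceless W" for W unfolding trace_kernel_sel by simp
  then show ?thesis
    unfolding generate_as_module_def sheaf_surjective_def trace_kernel_sel(2)
    using l_closed sections_map_image by (simp cong: conj_cong)
qed

text \<open>The product of two traceless sections is a scalar, so the module spanned by \<open>1\<close> and the \<open>l i\<close> is
  already an algebra.\<close>

lemma generated_subalgebra_subset:
  assumes U: "openin (pts Y) U"
    and s: "s \<in> generated_subalgebra (secs Y U) (msecs A U) ((\<lambda>i. mrestr A E U (a i)) ` {..<r})"
  obtains k x where "k \<in> carrier (secs Y U)" "x \<in> span U" "s = k \<odot>\<^bsub>msecs A U\<^esub> \<one>\<^bsub>msecs A U\<^esub> \<oplus>\<^bsub>msecs A U\<^esub> x"
proof -
  let ?O = "secs Y U" and ?M = "msecs A U"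
  interpret R: cring ?O using secs_cring[OF U] .
  interpret M: cring ?M using algebra.M_cring[OF msecs_algebra[OF U]] .
  interpret u: algebra ?O ?M using msecs_algebra[OF U] .
  let ?e = "\<lambda>k. k \<odot>\<^bsub>?M\<^esub> \<one>\<^bsub>?M\<^esub>"
  define S where "S = {?e k \<oplus>\<^bsub>?M\<^esub> x | k x. k \<in> carrier ?O \<and> x \<in> span U}"
  have SI: "?e k \<oplus>\<^bsub>?M\<^esub> x \<in> S" if "k \<in> carrier ?O" "x \<in> span U" for k x using that unfolding S_def by blast
  have spM: "x \<in> carrier ?M" if "x \<in> span U" for x using span_closed(1)[OF U that] by blast
  have Scl: "x \<in> carrier ?M" if "x \<in> S" for x using that spM unfolding S_def by auto
  have one: "\<one>\<^bsub>?M\<^esub> = ?e \<one>\<^bsub>?O\<^esub>" by simp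
  have eS: "?e k \<in> S" if "k \<in> carrier ?O" for k using SI[OF that span_closed(5)[OF U]] that by simp
  have sm: "k \<odot>\<^bsub>?M\<^esub> x \<in> S" if k: "k \<in> carrier ?O" and x: "x \<in> S" for k x
  proof -
    obtain j y where jy: "j \<in> carrier ?O" "y \<in> span U" "x = ?e j \<oplus>\<^bsub>?M\<^esub> y" using x unfolding S_def by blast
    have "k \<odot>\<^bsub>?M\<^esub> x = ?e (k \<otimes>\<^bsub>?O\<^esub> j) \<oplus>\<^bsub>?M\<^esub> k \<odot>\<^bsub>?M\<^esub> y"
      unfolding jy(3) using k jy(1) spM[OF jy(2)] by (simp add: u.smult_r_distr u.smult_assoc1)
    then show ?thesis using SI[of "k \<otimes>\<^bsub>?O\<^esub> j" "k \<odot>\<^bsub>?M\<^esub> y"] k jy(1) span_closed(3)[OF U k jy(2)] by simp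
  qed
  have add: "x \<oplus>\<^bsub>?M\<^esub> y \<in> S" if xy: "x \<in> S" "y \<in> S" for x y
  proof -
    obtain j z where jz: "j \<in> carrier ?O" "z \<in> span U" "x = ?e j \<oplus>\<^bsub>?M\<^esub> z" using xy(1) unfolding S_def by blast
    obtain k w where kw: "k \<in> carrier ?O" "w \<in> span U" "y = ?e k \<oplus>\<^bsub>?M\<^esub> w" using xy(2) unfolding S_def by blast
    have "x \<oplus>\<^bsub>?M\<^esub> y = ?e (j \<oplus>\<^bsub>?O\<^esub> k) \<oplus>\<^bsub>?M\<^esub> (z \<oplus>\<^bsub>?M\<^esub> w)"
      unfolding jz(3) kw(3) using jz(1) kw(1) spM[OF jz(2)] spM[OF kw(2)] by (simp add: u.smult_l_distr M.a_ac)
    then show ?thesis using SI[of "j \<oplus>\<^bsub>?O\<^esub> k" "z \<oplus>\<^bsub>?M\<^esub> w"] jz(1) kw(1) span_closed(2)[OF U jz(2) kw(2)] by simp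
  qed
  \<comment> \<open>The scalar part of \<open>x\<close> moves \<open>y\<close> within the span, and
    the traceless part contributes half the trace of its product with \<open>y\<close>, a
    scalar.\<close>
  have mult_span: "x \<otimes>\<^bsub>?M\<^esub> y \<in> S" if x: "x \<in> S" and y: "y \<in> span U" for x y
  proof -
    obtain j z where jz: "j \<in> carrier ?O" "z \<in> span U" "x = ?e j \<oplus>\<^bsub>?M\<^esub> z" using x unfolding S_def by blast
    have zM: "z \<in> carrier ?M" "tr U z = \<zero>\<^bsub>?O\<^esub>" and yM: "y \<in> carrier ?M" "tr U y = \<zero>\<^bsub>?O\<^esub>"
      using span_closed(1)[OF U jz(2)] span_closed(1)[OF U y] by auto
    have zy: "z \<otimes>\<^bsub>?M\<^esub> y \<in> carrier ?M" using zM yM by simp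
    have k: "half U \<otimes>\<^bsub>?O\<^esub> tr U (z \<otimes>\<^bsub>?M\<^esub> y) \<in> carrier ?O"
      using half_closed(1)[OF U] sheaf_trace_char(1)[OF U zy] by simp
    have "x \<otimes>\<^bsub>?M\<^esub> y = z \<otimes>\<^bsub>?M\<^esub> y \<oplus>\<^bsub>?M\<^esub> j \<odot>\<^bsub>?M\<^esub> y"
      unfolding jz(3) using jz(1) zM(1) yM(1) by (simp add: M.l_distr u.smult_assoc2 M.a_comm)
    also have "\<dots> = ?e (half U \<otimes>\<^bsub>?O\<^esub> tr U (z \<otimes>\<^bsub>?M\<^esub> y)) \<oplus>\<^bsub>?M\<^esub> j \<odot>\<^bsub>?M\<^esub> y"
      using traceless_mult[OF U zM yM] by simp
    finally show ?thesis using SI[OF k span_closed(3)[OF U jz(1) y]] by simp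
  qed
  have "subring S ?M"
  proof (rule M.subringI)
    show "S \<subseteq> carrier ?M" using Scl by blast
    show "\<one>\<^bsub>?M\<^esub> \<in> S" using eS[OF R.one_closed] by simp
    show "\<ominus>\<^bsub>?M\<^esub> x \<in> S" if "x \<in> S" for x
      using sm[OF _ that, of "\<ominus>\<^bsub>?O\<^esub> \<one>\<^bsub>?O\<^esub>"] Scl[OF that] u.smult_l_minus[OF R.one_closed, of x] by simp
    show "x \<oplus>\<^bsub>?M\<^esub> y \<in> S" if "x \<in> S" "y \<in> S" for x y using add[OF that] .
    show "x \<otimes>\<^bsub>?M\<^esub> y \<in> S" if x: "x \<in> S" and y: "y \<in> S" for x y
    proof -
      obtain k w where kw: "k \<in> carrier ?O" "w \<in> span U" "y = ?e k \<oplus>\<^bsub>?M\<^esub> w" using y unfolding S_def by blast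
      have "x \<otimes>\<^bsub>?M\<^esub> y = k \<odot>\<^bsub>?M\<^esub> x \<oplus>\<^bsub>?M\<^esub> x \<otimes>\<^bsub>?M\<^esub> w"
        unfolding kw(3) using kw(1) Scl[OF x] spM[OF kw(2)] by (simp add: M.r_distr u.smult_assoc3)
      then show ?thesis using add[OF sm[OF kw(1) x] mult_span[OF x kw(2)]] by simp
    qed
  qed
  moreover have gens: "?e ` carrier ?O \<union> (\<lambda>i. mrestr A E U (a i)) ` {..<r} \<subseteq> S"
  proof -
    have "mrestr A E U (a i) \<in> S" if i: "i < r" for i
    proof -
      have t: "restr Y E U (\<tau> i) \<in> carrier ?O" using restr_closed[OF openE U openin_subset[OF U] \<tau>_closed[OF i]] .
      show ?thesis unfolding a_decomp_on[OF U i]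
        using SI[OF t span_closed(4)[OF U i]] t lr_closed[OF U i] M.a_comm by simp
    qed
    then show ?thesis using eS by auto
  qed
  ultimately have "generated_subalgebra ?O ?M ((\<lambda>i. mrestr A E U (a i)) ` {..<r}) \<subseteq> S"
    unfolding generated_subalgebra_def using Scl
    by (intro M.generate_ring_min_subring1) auto
  then show ?thesis using s that unfolding S_def by blast
qed

text \<open>The hypothesis speaks about affine open sets, so a traceless section over
  \<open>D h\<close> is first extended to the affine \<open>U\<close> after multiplication by a
  power of \<open>h\<close>. There it is a scalar plus an element of the span; back on
  \<open>D h\<close> the trace removes the scalar, and the power of \<open>h\<close> is a
  unit.\<close>

lemma module_if_algebra:
  assumes gen: "generate_as_algebra Y A r a"
  shows "generate_as_module Y (trace_kernel Y A) r l"
  unfolding generate_as_module_iff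
proof (intro allI impI, elim conjE)
  fix W y x assume W: "openin (pts Y) W" and y: "y \<in> traceless W" and x: "x \<in> W"
  have "x \<in> E" using x openin_subset[OF W] by blast
  then obtain U where U: "affine_open Y U" "x \<in> U" using affine_cover by blast
  obtain D where "affine_chart Y U D" using affine_open_imp_affine_chart[OF U(1)] .
  then interpret affine_rank_two Y A U D
    using rank_two_algebra_sheaf_axioms by (intro affine_rank_two.intro)
  have "openin (pts Y) (W \<inter> U)" using W U_open by blast
  then obtain h where h: "h \<in> carrier (secs Y U)" "x \<in> D h" "D h \<subseteq> W \<inter> U"
    using D_basis[of "W \<inter> U" x] x U(2) by blast
  note Dh = D_open[OF h(1)] D_subset[OF h(1)]
  have DW: "D h \<subseteq> W" using h(3) by blast
  let ?O = "secs Y (D h)" and ?M = "msecs A (D h)"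
  interpret R: cring ?O using secs_cring[OF Dh(1)] .
  interpret u: algebra ?O ?M using msecs_algebra[OF Dh(1)] .
  interpret q: ring_hom_ring "secs Y W" ?O "restr Y W (D h)" using restr_ring_hom_ring[OF W Dh(1) DW] .
  interpret p: ring_hom_ring "secs Y U" ?O "restr Y U (D h)" using restr_D_hom[OF Dh] .
  let ?t = "mrestr A W (D h) y"
  have t: "?t \<in> carrier ?M" "tr (D h) ?t = \<zero>\<^bsub>?O\<^esub>"
    using A.restr_closed[OF W Dh(1) DW] sheaf_trace_restr[OF W Dh(1) DW, of y, symmetric] y by auto
  obtain m :: nat and s where s: "s \<in> carrier (msecs A U)"
    "mrestr A U (D h) s = restr Y U (D h) (h [^]\<^bsub>secs Y U\<^esub> m) \<odot>\<^bsub>?M\<^esub> ?t" using extend_section[OF h(1) t(1)] by blast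
  let ?c = "restr Y U (D h) (h [^]\<^bsub>secs Y U\<^esub> m)"
  have cU: "?c \<in> Units ?O" using R.Units_pow_closed[OF D_unit[OF h(1)]] p.hom_nat_pow[OF h(1)] by simp
  interpret UM: cring "msecs A U" using algebra.M_cring[OF msecs_algebra[OF U_open]] .
  interpret Ua: algebra "secs Y U" "msecs A U" using msecs_algebra[OF U_open] .
  have "s \<in> generated_subalgebra (secs Y U) (msecs A U) ((\<lambda>i. mrestr A E U (a i)) ` {..<r})"
    using gen U(1) s(1) unfolding generate_as_algebra_def by blast
  then obtain k z where kz: "k \<in> carrier (secs Y U)" "z \<in> span U"
    "s = k \<odot>\<^bsub>msecs A U\<^esub> \<one>\<^bsub>msecs A U\<^esub> \<oplus>\<^bsub>msecs A U\<^esub> z" using generated_subalgebra_subset[OF U_open] by blast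
  have zU: "z \<in> carrier (msecs A U)" using span_closed(1)[OF U_open kz(2)] by blast
  let ?k = "restr Y U (D h) k" and ?z = "mrestr A U (D h) z" and ?e = "\<one>\<^bsub>?M\<^esub>"
  have kc: "?k \<in> carrier ?O" using kz(1) by simp
  have zs: "?z \<in> span (D h)" using span_restr[OF U_open Dh kz(2)] .
  have zt: "?z \<in> carrier ?M" "tr (D h) ?z = \<zero>\<^bsub>?O\<^esub>" using span_closed(1)[OF Dh(1) zs] by auto
  have ke: "k \<odot>\<^bsub>msecs A U\<^esub> \<one>\<^bsub>msecs A U\<^esub> \<in> carrier (msecs A U)" using kz(1) by simp
  have e: "?e \<in> carrier ?M" using cring.cring_simprules(6)[OF u.M_cring] .
  have dec: "?c \<odot>\<^bsub>?M\<^esub> ?t = ?k \<odot>\<^bsub>?M\<^esub> ?e \<oplus>\<^bsub>?M\<^esub> ?z"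
    unfolding s(2)[symmetric] kz(3) ring_hom_add[OF mrestr_hom[OF U_open Dh] ke zU]
      mrestr_smult[OF U_open Dh kz(1) UM.one_closed] ring_hom_one[OF mrestr_hom[OF U_open Dh]] ..
  have cc: "?c \<in> carrier ?O" using cU by auto
  \<comment> \<open>In \<open>dec\<close> the left side and \<open>?z\<close> are traceless, so the
    scalar term is traceless as well; half of its trace is \<open>?k\<close>, which therefore
    vanishes.\<close>
  have "tr (D h) (?k \<odot>\<^bsub>?M\<^esub> ?e) = \<zero>\<^bsub>?O\<^esub>"
  proof -
    have kec: "?k \<odot>\<^bsub>?M\<^esub> ?e \<in> carrier ?M" using kc e by simp
    have "tr (D h) (?k \<odot>\<^bsub>?M\<^esub> ?e) \<oplus>\<^bsub>?O\<^esub> \<zero>\<^bsub>?O\<^esub> = tr (D h) (?c \<odot>\<^bsub>?M\<^esub> ?t)"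
      unfolding dec sheaf_trace_add[OF Dh(1) kec zt(1)] zt(2) ..
    also have "\<dots> = \<zero>\<^bsub>?O\<^esub>" unfolding sheaf_trace_smult[OF Dh(1) cc t(1)] t(2) using cc by simp
    finally show ?thesis using sheaf_trace_char(1)[OF Dh(1) kec] by simp
  qed
  then have "?k = \<zero>\<^bsub>?O\<^esub>" using sheaf_trace_scalar[OF Dh(1) kc] half_closed(1)[OF Dh(1)] by simp
  then have ct: "?c \<odot>\<^bsub>?M\<^esub> ?t \<in> span (D h)" using dec zs zt(1) e by simp
  have "?t = inv\<^bsub>?O\<^esub> ?c \<odot>\<^bsub>?M\<^esub> (?c \<odot>\<^bsub>?M\<^esub> ?t)"
    using u.smult_assoc1[OF R.Units_inv_closed[OF cU] cc t(1)] R.Units_l_inv[OF cU] t(1) by simp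
  also have "\<dots> \<in> span (D h)" using span_closed(3)[OF Dh(1) R.Units_inv_closed[OF cU] ct] .
  finally show "\<exists>V. openin (pts Y) V \<and> x \<in> V \<and> V \<subseteq> W \<and> mrestr A W V y \<in> span V" using Dh(1) h(2) DW by blast
qed

text \<open>The multipliers that move \<open>y\<close> into the span form an ideal of the ring of
  sections over \<open>U\<close>. Local generation near each point yields a power of some
  \<open>h\<close> in it that does not vanish there, so the ideal contains 1.\<close>

lemma traceless_span_if_module:
  assumes gen: "generate_as_module Y (trace_kernel Y A) r l" and U: "affine_open Y U" and y: "y \<in> traceless U"
  shows "y \<in> span U"
proof -
  obtain D where "affine_chart Y U D" using affine_open_imp_affine_chart[OF U(1)] .
  then interpret affine_rank_two Y A U D
    using rank_two_algebra_sheaf_axioms by (intro affine_rank_two.intro)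
  let ?O = "secs Y U" and ?M = "msecs A U"
  interpret R: cring ?O using secs_cring[OF U_open] .
  interpret u: algebra ?O ?M using msecs_algebra[OF U_open] .
  note sp = span_closed[OF U_open]
  have yM: "y \<in> carrier ?M" using y by blast
  define J where "J = {k \<in> carrier ?O. k \<odot>\<^bsub>?M\<^esub> y \<in> span U}"
  have "ideal J ?O"
  proof (intro idealI[OF R.ring_axioms] R.add.subgroupI)
    have "\<zero>\<^bsub>?O\<^esub> \<in> J" unfolding J_def using yM sp(5) by simp
    then show "J \<noteq> {}" by blast
    show "j \<oplus>\<^bsub>?O\<^esub> k \<in> J" if "j \<in> J" "k \<in> J" for j k
      using that sp(2) yM unfolding J_def by (simp add: u.smult_l_distr)
    have mult: "j \<otimes>\<^bsub>?O\<^esub> k \<in> J" if "j \<in> carrier ?O" "k \<in> J" for j k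
      using that sp(3) yM unfolding J_def by (simp add: u.smult_assoc1)
    then show "j \<otimes>\<^bsub>?O\<^esub> k \<in> J" "k \<otimes>\<^bsub>?O\<^esub> j \<in> J" if "k \<in> J" "j \<in> carrier ?O" for j k
      using mult[OF that(2,1)] R.m_comm[of k j] that unfolding J_def by auto
    show "\<ominus>\<^bsub>?O\<^esub> k \<in> J" if k: "k \<in> J" for k
      using mult[OF _ k, of "\<ominus>\<^bsub>?O\<^esub> \<one>\<^bsub>?O\<^esub>"] k unfolding J_def by (simp add: R.l_minus)
  qed (auto simp: J_def)
  moreover have "\<exists>h\<in>J. x \<in> D h" if x: "x \<in> U" for x
  proof -
    have "\<exists>V. openin (pts Y) V \<and> x \<in> V \<and> V \<subseteq> U \<and> mrestr A U V y \<in> span V"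
      by (rule gen[unfolded generate_as_module_iff, rule_format]) (intro conjI U_open y x)
    then obtain V where V: "openin (pts Y) V" "x \<in> V" "V \<subseteq> U" "mrestr A U V y \<in> span V" by blast
    obtain h where h: "h \<in> carrier ?O" "x \<in> D h" "D h \<subseteq> V" using D_basis[OF V(1,3,2)] by blast
    note Dh = D_open[OF h(1)] D_subset[OF h(1)]
    let ?K = "secs Y (D h)" and ?N = "msecs A (D h)" and ?p = "restr Y U (D h)"
    interpret K: cring ?K using secs_cring[OF Dh(1)] .
    interpret N: algebra ?K ?N using msecs_algebra[OF Dh(1)] .
    interpret p: ring_hom_ring ?O ?K ?p using restr_D_hom[OF Dh] .
    have "mrestr A U (D h) y \<in> span (D h)"
      using span_restr[OF V(1) Dh(1) h(3) V(4)] A.restr_trans[OF U_open V(1) Dh(1) h(3) V(3) yM] by simp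
    then obtain c where c: "c \<in> {..<r} \<rightarrow> carrier ?K" "mrestr A U (D h) y = (\<Oplus>\<^bsub>?N\<^esub>i\<in>{..<r}. c i \<odot>\<^bsub>?N\<^esub> lr (D h) i)"
      unfolding span_def lin_span_def by blast
    have ex: "\<exists>n::nat. \<forall>m\<ge>n. \<exists>b\<in>carrier ?O. ?p (h [^]\<^bsub>?O\<^esub> m) \<otimes>\<^bsub>?K\<^esub> c i = ?p b" if "i \<in> {..<r}" for i
      using frac_ge[OF h(1)] c(1) that by auto
    obtain n :: nat where n: "\<And>i m. i \<in> {..<r} \<Longrightarrow> n \<le> m \<Longrightarrow> \<exists>b\<in>carrier ?O. ?p (h [^]\<^bsub>?O\<^esub> m) \<otimes>\<^bsub>?K\<^esub> c i = ?p b"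
      by (rule finite_uniform_exponent[OF finite_lessThan ex], assumption) blast
    have "\<forall>i\<in>{..<r}. \<exists>b. b \<in> carrier ?O \<and> ?p (h [^]\<^bsub>?O\<^esub> n) \<otimes>\<^bsub>?K\<^esub> c i = ?p b" using n by blast
    from bchoice[OF this] obtain b where b: "\<And>i. i < r \<Longrightarrow> b i \<in> carrier ?O"
      "\<And>i. i < r \<Longrightarrow> ?p (h [^]\<^bsub>?O\<^esub> n) \<otimes>\<^bsub>?K\<^esub> c i = ?p (b i)" by auto
    \<comment> \<open>The combination over \<open>U\<close> whose restriction to \<open>D h\<close>
      is \<open>h [^] n\<close> times \<open>y\<close>: the local coefficients \<open>c i\<close>
      are multiplied by \<open>h [^] n\<close> to clear denominators.\<close>
    define z where "z = (\<Oplus>\<^bsub>?M\<^esub>i\<in>{..<r}. b i \<odot>\<^bsub>?M\<^esub> lr U i)"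
    have zs: "z \<in> span U" unfolding z_def span_def lin_span_def using b(1) by auto
    then have zM: "z \<in> carrier ?M" using sp(1) by blast
    have hn: "h [^]\<^bsub>?O\<^esub> (i::nat) \<in> carrier ?O" for i using h(1) by simp
    \<comment> \<open>This difference vanishes on \<open>D h\<close> but not necessarily on
      \<open>U\<close>; a further power of \<open>h\<close> kills it, which accounts for the
      exponent \<open>m + n\<close> below.\<close>
    let ?d = "h [^]\<^bsub>?O\<^esub> n \<odot>\<^bsub>?M\<^esub> y \<oplus>\<^bsub>?M\<^esub> \<ominus>\<^bsub>?M\<^esub> z"
    have hy: "h [^]\<^bsub>?O\<^esub> n \<odot>\<^bsub>?M\<^esub> y \<in> carrier ?M" using hn yM by simp
    have lD: "lr (D h) i \<in> carrier ?N" if "i < r" for i using lr_closed[OF Dh(1) that] .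
    have "mrestr A U (D h) (h [^]\<^bsub>?O\<^esub> n \<odot>\<^bsub>?M\<^esub> y) = ?p (h [^]\<^bsub>?O\<^esub> n) \<odot>\<^bsub>?N\<^esub> (\<Oplus>\<^bsub>?N\<^esub>i\<in>{..<r}. c i \<odot>\<^bsub>?N\<^esub> lr (D h) i)"
      unfolding mrestr_smult[OF U_open Dh hn yM] c(2) ..
    also have "\<dots> = (\<Oplus>\<^bsub>?N\<^esub>i\<in>{..<r}. ?p (h [^]\<^bsub>?O\<^esub> n) \<odot>\<^bsub>?N\<^esub> (c i \<odot>\<^bsub>?N\<^esub> lr (D h) i))"
      using c(1) lD hn by (intro N.finsum_smult_ldistr) auto
    also have "\<dots> = (\<Oplus>\<^bsub>?N\<^esub>i\<in>{..<r}. ?p (b i) \<odot>\<^bsub>?N\<^esub> lr (D h) i)"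
    proof (rule N.M.finsum_cong')
      show "?p (h [^]\<^bsub>?O\<^esub> n) \<odot>\<^bsub>?N\<^esub> (c i \<odot>\<^bsub>?N\<^esub> lr (D h) i) = ?p (b i) \<odot>\<^bsub>?N\<^esub> lr (D h) i" if i: "i \<in> {..<r}" for i
      proof -
        have ci: "c i \<in> carrier ?K" "i < r" using c(1) i by auto
        show ?thesis
          unfolding N.smult_assoc1[OF p.hom_closed[OF hn] ci(1) lD[OF ci(2)], symmetric] b(2)[OF ci(2)] ..
      qed
    qed (use b(1) lD in auto)
    also have "\<dots> = mrestr A U (D h) z"
    proof -
      have "mrestr A U (D h) z = (\<Oplus>\<^bsub>?N\<^esub>i\<in>{..<r}. ?p (b i) \<odot>\<^bsub>?N\<^esub> mrestr A U (D h) (lr U i))"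
        unfolding z_def using b(1) lr_closed[OF U_open] by (intro mrestr_lin_comb[OF U_open Dh]) auto
      also have "\<dots> = (\<Oplus>\<^bsub>?N\<^esub>i\<in>{..<r}. ?p (b i) \<odot>\<^bsub>?N\<^esub> lr (D h) i)"
        using b(1) lD lr_restr[OF U_open Dh] by (intro N.M.finsum_cong') auto
      finally show ?thesis ..
    qed
    finally have eq: "mrestr A U (D h) (h [^]\<^bsub>?O\<^esub> n \<odot>\<^bsub>?M\<^esub> y) = mrestr A U (D h) z" .
    interpret g: ring_hom_ring ?M ?N "mrestr A U (D h)" using mrestr_ring_hom_ring[OF U_open Dh] .
    have "mrestr A U (D h) ?d = \<zero>\<^bsub>?N\<^esub>" using hy zM eq by (simp add: N.M.r_neg)
    moreover have dM: "?d \<in> carrier ?M" using hy zM by simp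
    ultimately obtain m :: nat where "h [^]\<^bsub>?O\<^esub> m \<odot>\<^bsub>?M\<^esub> ?d = \<zero>\<^bsub>?M\<^esub>" using kill_section[OF h(1)] by blast
    then have "h [^]\<^bsub>?O\<^esub> m \<odot>\<^bsub>?M\<^esub> (h [^]\<^bsub>?O\<^esub> n \<odot>\<^bsub>?M\<^esub> y) \<oplus>\<^bsub>?M\<^esub> \<ominus>\<^bsub>?M\<^esub> (h [^]\<^bsub>?O\<^esub> m \<odot>\<^bsub>?M\<^esub> z) = \<zero>\<^bsub>?M\<^esub>"
      using hn hy zM by (simp add: u.smult_r_distr u.smult_r_minus)
    then have "h [^]\<^bsub>?O\<^esub> m \<odot>\<^bsub>?M\<^esub> (h [^]\<^bsub>?O\<^esub> n \<odot>\<^bsub>?M\<^esub> y) = h [^]\<^bsub>?O\<^esub> m \<odot>\<^bsub>?M\<^esub> z"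
      using u.M.minus_equality[of "h [^]\<^bsub>?O\<^esub> m \<odot>\<^bsub>?M\<^esub> (h [^]\<^bsub>?O\<^esub> n \<odot>\<^bsub>?M\<^esub> y)" "\<ominus>\<^bsub>?M\<^esub> (h [^]\<^bsub>?O\<^esub> m \<odot>\<^bsub>?M\<^esub> z)"] hn hy zM by simp
    moreover have "h [^]\<^bsub>?O\<^esub> m \<odot>\<^bsub>?M\<^esub> (h [^]\<^bsub>?O\<^esub> n \<odot>\<^bsub>?M\<^esub> y) = h [^]\<^bsub>?O\<^esub> (m + n) \<odot>\<^bsub>?M\<^esub> y"
      using u.smult_assoc1[OF hn hn yM] R.nat_pow_mult[OF h(1)] by simp
    ultimately have "h [^]\<^bsub>?O\<^esub> (m + n) \<in> J" unfolding J_def using hn sp(3)[OF hn zs] by simp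
    then show ?thesis using D_pow[OF h(1,2)] by blast
  qed
  ultimately have "J = carrier ?O" using no_common_zero by blast
  then have "\<one>\<^bsub>?O\<^esub> \<in> J" by simp
  then show ?thesis unfolding J_def using yM by simp
qed

text \<open>The generated algebra contains the scalars, hence each \<open>l i\<close> as a
  difference, hence the span. By the preceding lemma it therefore contains every traceless section,
  and each section is traceless up to a scalar.\<close>

lemma algebra_if_module:
  assumes gen: "generate_as_module Y (trace_kernel Y A) r l"
  shows "generate_as_algebra Y A r a"
  unfolding generate_as_algebra_def
proof (intro allI impI)
  fix U assume aff: "affine_open Y U"
  then have U: "openin (pts Y) U" unfolding affine_open_def by blast
  let ?O = "secs Y U" and ?M = "msecs A U"
  interpret R: cring ?O using secs_cring[OF U] .
  interpret M: cring ?M using algebra.M_cring[OF msecs_algebra[OF U]] .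
  interpret u: algebra ?O ?M using msecs_algebra[OF U] .
  let ?e = "\<lambda>k. k \<odot>\<^bsub>?M\<^esub> \<one>\<^bsub>?M\<^esub>"
  let ?X = "?e ` carrier ?O \<union> (\<lambda>i. mrestr A E U (a i)) ` {..<r}"
  let ?G = "generate_ring ?M ?X"
  have rt: "restr Y E U (\<tau> i) \<in> carrier ?O" if "i < r" for i
    using restr_closed[OF openE U openin_subset[OF U] \<tau>_closed[OF that]] .
  have X: "?X \<subseteq> carrier ?M" using rt lr_closed[OF U] by (auto simp: a_decomp_on[OF U])
  note G = subringE[OF M.generate_ring_is_subring[OF X]]
  have eG: "?e k \<in> ?G" if "k \<in> carrier ?O" for k using that by (intro generate_ring.incl) blast
  have smG: "k \<odot>\<^bsub>?M\<^esub> x \<in> ?G" if "k \<in> carrier ?O" "x \<in> ?G" for k x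
  proof -
    have "k \<odot>\<^bsub>?M\<^esub> x = ?e k \<otimes>\<^bsub>?M\<^esub> x" using that G(1) by (auto simp: u.smult_assoc2)
    then show ?thesis using G(6)[OF eG[OF that(1)] that(2)] by simp
  qed
  have lG: "lr U i \<in> ?G" if i: "i < r" for i
  proof -
    have c: "lr U i \<in> carrier ?M" "?e (restr Y E U (\<tau> i)) \<in> carrier ?M" using lr_closed[OF U i] rt[OF i] by auto
    have "mrestr A E U (a i) \<in> ?G" using i by (intro generate_ring.incl) blast
    then have "mrestr A E U (a i) \<oplus>\<^bsub>?M\<^esub> \<ominus>\<^bsub>?M\<^esub> ?e (restr Y E U (\<tau> i)) \<in> ?G"
      using G(7)[OF _ G(5)[OF eG[OF rt[OF i]]]] by blast
    moreover have "mrestr A E U (a i) \<oplus>\<^bsub>?M\<^esub> \<ominus>\<^bsub>?M\<^esub> ?e (restr Y E U (\<tau> i)) = lr U i"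
      unfolding a_decomp_on[OF U i] using c by (simp add: M.a_assoc M.r_neg)
    ultimately show ?thesis by simp
  qed
  have spanG: "x \<in> ?G" if x: "x \<in> span U" for x
  proof -
    obtain c where c: "c \<in> {..<r} \<rightarrow> carrier ?O" "x = (\<Oplus>\<^bsub>?M\<^esub>i\<in>{..<r}. c i \<odot>\<^bsub>?M\<^esub> lr U i)"
      using x unfolding span_def lin_span_def by blast
    have "submodule ?G ?O ?M"
      using G(1,2,5,7) smG by (intro u.submoduleI) auto
    from u.submodule_finsum(2)[OF this finite_lessThan, of r "\<lambda>i. c i \<odot>\<^bsub>?M\<^esub> lr U i"]
    show ?thesis unfolding c(2) using c(1) lG smG by auto
  qed
  have "s \<in> ?G" if s: "s \<in> carrier ?M" for s
  proof -
    define k where "k = half U \<otimes>\<^bsub>?O\<^esub> tr U s"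
    have k: "k \<in> carrier ?O" unfolding k_def using half_closed(1)[OF U] sheaf_trace_char(1)[OF U s] by simp
    \<comment> \<open>The traceless part of \<open>s\<close>: the scalar \<open>k\<close> has trace
      \<open>2k\<close>, which is the trace of \<open>s\<close>.\<close>
    define y where "y = s \<oplus>\<^bsub>?M\<^esub> ?e (\<ominus>\<^bsub>?O\<^esub> k)"
    have mk: "\<ominus>\<^bsub>?O\<^esub> k \<in> carrier ?O" and em: "?e (\<ominus>\<^bsub>?O\<^esub> k) \<in> carrier ?M" using k by auto
    have tc: "two U \<in> carrier ?O" by simp
    have "k \<otimes>\<^bsub>?O\<^esub> two U = (half U \<otimes>\<^bsub>?O\<^esub> two U) \<otimes>\<^bsub>?O\<^esub> tr U s"
      unfolding k_def using half_closed(1)[OF U] sheaf_trace_char(1)[OF U s] tc by (simp only: R.m_ac R.m_closed)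
    then have k2: "k \<otimes>\<^bsub>?O\<^esub> two U = tr U s" unfolding half_closed(2)[OF U] using sheaf_trace_char(1)[OF U s] by simp
    have "tr U y = tr U s \<oplus>\<^bsub>?O\<^esub> (\<ominus>\<^bsub>?O\<^esub> k) \<otimes>\<^bsub>?O\<^esub> two U"
      unfolding y_def sheaf_trace_add[OF U s em] sheaf_trace_smult[OF U mk M.one_closed] sheaf_trace_one[OF U] ..
    also have "\<dots> = \<zero>\<^bsub>?O\<^esub>" unfolding R.l_minus[OF k tc] k2 using sheaf_trace_char(1)[OF U s] by (rule R.r_neg)
    finally have "y \<in> traceless U" unfolding y_def using s em by simp
    then have "y \<in> ?G" using spanG traceless_span_if_module[OF gen aff] by blast
    then have "y \<oplus>\<^bsub>?M\<^esub> ?e k \<in> ?G" using G(7) eG[OF k] by blast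
    moreover have "y \<oplus>\<^bsub>?M\<^esub> ?e k = s"
      unfolding y_def u.smult_l_minus[OF k M.one_closed] using s k by (simp add: M.a_assoc M.l_neg)
    ultimately show ?thesis by simp
  qed
  then show "generated_subalgebra ?O ?M ((\<lambda>i. mrestr A E U (a i)) ` {..<r}) = carrier ?M"
    unfolding generated_subalgebra_def using G(1) by blast
qed

end

theorem proposition6p3:
  fixes Y :: "('x, 'r) ringed_space"
    and A :: "('x, 'r, 'a) module_sheaf"
    and a :: "nat \<Rightarrow> 'a" and r :: nat
  defines "E \<equiv> topspace (pts Y)"
  assumes "scheme Y"
    and "\<And>x. x \<in> E \<Longrightarrow> \<one>\<^bsub>residue_field Y x\<^esub> \<oplus>\<^bsub>residue_field Y x\<^esub> \<one>\<^bsub>residue_field Y x\<^esub> \<in> Units (residue_field Y x)"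
    and "quadratic_etale_algebra Y A"
    and "\<And>i. i < r \<Longrightarrow> a i \<in> carrier (msecs A E)"
  shows "generate_as_algebra Y A r a \<longleftrightarrow>
    generate_as_module Y (trace_kernel Y A) r
      (\<lambda>i. a i \<ominus>\<^bsub>msecs A E\<^esub>
        (inv\<^bsub>secs Y E\<^esub> (\<one>\<^bsub>secs Y E\<^esub> \<oplus>\<^bsub>secs Y E\<^esub> \<one>\<^bsub>secs Y E\<^esub>)
           \<otimes>\<^bsub>secs Y E\<^esub> sheaf_trace Y A E (a i)) \<odot>\<^bsub>msecs A E\<^esub> \<one>\<^bsub>msecs A E\<^esub>)"
proof -
  interpret scheme Y by fact
  interpret algebra_sheaf Y A using assms(4) unfolding quadratic_etale_algebra_def by blast
  \<comment> \<open>The hypothesis on residue fields is turned into invertibility of 2 over every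
    open set.\<close>
  interpret rank_two_algebra_sheaf Y A
    using assms(4) two_unit[OF assms(3)[unfolded E_def]] unfolding quadratic_etale_algebra_def
    by unfold_locales blast+
  have E: "openin (pts Y) E" unfolding E_def by simp
  let ?O = "secs Y E" and ?M = "msecs A E"
  interpret R: cring ?O using secs_cring[OF E] .
  interpret M: cring ?M using algebra.M_cring[OF msecs_algebra[OF E]] .
  interpret u: algebra ?O ?M using msecs_algebra[OF E] .
  define \<tau> where "\<tau> i = half E \<otimes>\<^bsub>?O\<^esub> tr E (a i)" for i
  define l where "l i = a i \<ominus>\<^bsub>?M\<^esub> \<tau> i \<odot>\<^bsub>?M\<^esub> \<one>\<^bsub>?M\<^esub>" for i
  have tc: "two E \<in> carrier ?O" by simp
  have l: "l i \<in> traceless E" "\<tau> i \<in> carrier ?O" "a i = l i \<oplus>\<^bsub>?M\<^esub> \<tau> i \<odot>\<^bsub>?M\<^esub> \<one>\<^bsub>?M\<^esub>" if i: "i < r" for i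
  proof -
    note ai = assms(5)[OF i] and ta = sheaf_trace_char(1)[OF E assms(5)[OF i]]
    show \<tau>: "\<tau> i \<in> carrier ?O" unfolding \<tau>_def using half_closed(1)[OF E] ta by simp
    have e: "\<tau> i \<odot>\<^bsub>?M\<^esub> \<one>\<^bsub>?M\<^esub> \<in> carrier ?M" using \<tau> by simp
    have lc: "l i \<in> carrier ?M" unfolding l_def using ai e by simp
    show dec: "a i = l i \<oplus>\<^bsub>?M\<^esub> \<tau> i \<odot>\<^bsub>?M\<^esub> \<one>\<^bsub>?M\<^esub>"
      unfolding l_def using ai e by (simp add: M.minus_eq M.a_assoc M.l_neg)
    have "\<tau> i \<otimes>\<^bsub>?O\<^esub> two E = (half E \<otimes>\<^bsub>?O\<^esub> two E) \<otimes>\<^bsub>?O\<^esub> tr E (a i)"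
      unfolding \<tau>_def using half_closed(1)[OF E] ta tc by (simp only: R.m_ac R.m_closed)
    also have "\<dots> = tr E (a i)" unfolding half_closed(2)[OF E] using ta by simp
    \<comment> \<open>The scalar part \<open>\<tau> i\<close> accounts for the whole trace of
      \<open>a i\<close>, so cancelling leaves trace zero for \<open>l i\<close>.\<close>
    finally have "tr E (a i) = tr E (l i) \<oplus>\<^bsub>?O\<^esub> tr E (a i)"
      using sheaf_trace_add[OF E lc e] sheaf_trace_smult[OF E \<tau> M.one_closed] sheaf_trace_one[OF E]
      unfolding dec[symmetric] by simp
    then have "tr E (l i) = \<zero>\<^bsub>?O\<^esub>" using ta sheaf_trace_char(1)[OF E lc] by simp
    then show "l i \<in> traceless E" using lc by simp
  qed
  interpret generating_sections Y A r a l \<tau>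
    using l unfolding E_def by unfold_locales auto
  have "generate_as_algebra Y A r a \<longleftrightarrow> generate_as_module Y (trace_kernel Y A) r l"
    using module_if_algebra algebra_if_module by blast
  then show ?thesis unfolding l_def \<tau>_def .
qed

end
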